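(* Let $\varphi$ be the Laplace transform of a probability distribution on $[0,\infty)$. A characteristic function $f$ on $\mathbf{R}$ has a non-empty domain of $\varphi$-attraction if and only if $f$ is $\varphi$-stable.
   Context: $\varphi(s)=E(e^{-sU})$ for a non-negative random variable $U$, used for all complex $s$ with $\operatorname{Re}s\ge 0$. A characteristic function $g$ belongs to the domain of $\varphi$-attraction of a characteristic function $f$ if there are constants $a_n>0$ and $b_n\in\mathbf{R}$ such that, with $g_n(t)=g(t/a_n)\exp(-itb_n)$, $\varphi\{n(1-g_n(t))\}\to f(t)$ as $n\to\infty$ for all $t\in\mathbf{R}$. (Here $\varphi\{n(1-s)\}$ is the probability generating function of the number of summands, taken independent of the summands.) A characteristic function $f$ is $\varphi$-stable if $f(t)=\varphi\{-\log\omega(t)\}$ for all $t$, where $\omega$ is the characteristic function of a stable law; $\log\omega$ is the continuous branch vanishing at $t=0$. *)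

theory Defs
  imports "HOL-Probability.Probability"
begin

definition char_function :: "(real \<Rightarrow> complex) \<Rightarrow> bool" where
  "char_function f \<longleftrightarrow> (\<exists>M. real_distribution M \<and> f = char M)"

(* Used only for Re s >= 0, where the integrand is bounded if the distribution lives on [0,\<infinity>). *)
definition laplace_transform :: "real measure \<Rightarrow> complex \<Rightarrow> complex" where
  "laplace_transform \<nu> s = (CLINT u|\<nu>. exp (- (s * complex_of_real u)))"

(* Stability in the wide sense: a X1 + b X2 has the law of c X + d for independent copies X1, X2
   of X. Shifts d are allowed (not only strict stability), and degenerate laws count as stable. *)
definition stable_law :: "real measure \<Rightarrow> bool" where
  "stable_law M \<longleftrightarrow> real_distribution M \<and>
     (\<forall>a>0. \<forall>b>0. \<exists>c>0. \<exists>d.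
        distr (M \<Otimes>\<^sub>M M) borel (\<lambda>(x, y). a * x + b * y) = distr M borel (\<lambda>x. c * x + d))"

definition continuous_log :: "(real \<Rightarrow> complex) \<Rightarrow> (real \<Rightarrow> complex) \<Rightarrow> bool" where
  "continuous_log \<omega> L \<longleftrightarrow>
     continuous_on UNIV L \<and> L 0 = 0 \<and> (\<forall>t. exp (L t) = \<omega> t)"

lemma continuous_log_unique:
  assumes "continuous_log \<omega> L" "continuous_log \<omega> L'"
  shows "L = L'"
proof
  fix t
  have "(\<lambda>t. L t - L' t) constant_on UNIV"
  proof (rule continuous_discrete_range_constant[OF connected_UNIV])
    show "continuous_on UNIV (\<lambda>t. L t - L' t)"
      using assms by (auto simp: continuous_log_def intro!: continuous_intros)
    have eq: "exp (L t - L' t) = 1" for t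
    proof -
      have "exp (L t) = exp (L' t)"
        using assms by (simp add: continuous_log_def)
      then show ?thesis by (simp add: exp_diff)
    qed
    show "\<exists>e>0. \<forall>y. y \<in> UNIV \<and> L y - L' y \<noteq> L x - L' x \<longrightarrow>
            e \<le> norm ((L y - L' y) - (L x - L' x))" for x
    proof (intro exI[of _ "2 * pi"] conjI allI impI)
      fix y assume "y \<in> UNIV \<and> L y - L' y \<noteq> L x - L' x"
      then have ne: "L y - L' y \<noteq> L x - L' x" by simp
      have "\<not> \<bar>Im (L y - L' y) - Im (L x - L' x)\<bar> < 2 * pi"
      proof
        assume "\<bar>Im (L y - L' y) - Im (L x - L' x)\<bar> < 2 * pi"
        then have "L y - L' y = L x - L' x"
          by (rule exp_complex_eqI) (simp only: eq)
        with ne show False ..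
      qed
      then show "2 * pi \<le> norm ((L y - L' y) - (L x - L' x))"
        using abs_Im_le_cmod[of "(L y - L' y) - (L x - L' x)"]
        unfolding minus_complex.sel by linarith
    qed simp
  qed
  then obtain c where c: "\<And>x. L x - L' x = c"
    unfolding constant_on_def by blast
  have "L t - L' t = L 0 - L' 0"
    by (simp only: c)
  then show "L t = L' t"
    using assms by (simp add: continuous_log_def)
qed

definition attraction_domain ::
    "(complex \<Rightarrow> complex) \<Rightarrow> (real \<Rightarrow> complex) \<Rightarrow> (real \<Rightarrow> complex) set" where
  "attraction_domain \<phi> f = {g. char_function g \<and>
     (\<exists>(a :: nat \<Rightarrow> real) (b :: nat \<Rightarrow> real). (\<forall>n. a n > 0) \<and>
        (\<forall>t. (\<lambda>n. \<phi> (of_nat n * (1 - g (t / a n) * iexp (- (t * b n))))) \<longlonglongrightarrow> f t))}"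

definition phi_stable :: "(complex \<Rightarrow> complex) \<Rightarrow> (real \<Rightarrow> complex) \<Rightarrow> bool" where
  "phi_stable \<phi> f \<longleftrightarrow>
     (\<exists>M L. stable_law M \<and> continuous_log (char M) L \<and> (\<forall>t. f t = \<phi> (- L t)))"

end

theory Submission
  imports Defs "HOL-Complex_Analysis.Complex_Analysis"
begin

text \<open>
  If \<open>\<omega>\<close> is stable with logarithm \<open>L\<close>, then \<open>n * L\<close> and \<open>L\<close> agree up to scale and shift, so that
  \<open>\<omega>\<close> itself lies in the domain of attraction of \<open>\<phi> (- L)\<close>.

  Conversely let \<open>\<phi> (s n) \<rightarrow> f\<close> with \<open>s n = n * (1 - g n)\<close>. As \<open>\<bar>\<phi> z\<bar> \<le> \<phi> (Re z) < 1\<close> for \<open>Re z > 0\<close>, the real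
  parts of the \<open>s n\<close> are uniformly small near 0; the imaginary parts are under control because otherwise
  \<open>\<nu>\<close> would be concentrated at 0. Hence the \<open>s n\<close> are relatively compact, and every limit
  point \<open>s\<close> satisfies \<open>\<phi> \<circ> s = f\<close>. Since \<open>\<phi>\<close> need not be injective, limit points need not be unique.
  However, comparing \<open>s n\<close> with \<open>s m\<close>, \<open>m\<close> about \<open>c * n\<close>, shows that for all \<open>c > 0\<close> some rescaling
  \<open>c * s (\<kappa> t) + \<i> d t\<close> also solves the equation. Letting \<open>c \<rightarrow> 1\<close> and using compactness once more yields a
  solution \<open>\<sigma>\<close> and rescalings of it, tending to the identity with \<open>c \<noteq> 1\<close>, that are again solutions.
  As \<open>\<phi>\<close> is holomorphic and nonconstant on the right half-plane, its fibres are discrete there; so these rescalings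
  eventually fix \<open>\<sigma>\<close>, locally uniformly away from the critical points of \<open>\<phi>\<close>. A function invariant under
  arbitrarily small scalings is a power function, up to a drift, and \<open>exp (- \<sigma>)\<close> is stable.
\<close>

section \<open>Characteristic functions\<close>

text \<open>Convergence is assumed only pointwise and only after \<open>\<phi>\<close>, so Levy's
  theorem does not apply to the \<open>s n\<close>. Uniformity comes from Baire's theorem: the sets
  of \<open>t\<close> at which an estimate holds from index \<open>N\<close> on are closed and cover
  an interval, so one of them contains a subinterval, and the Cauchy-Schwarz bound in
  \<open>exponent\<close> carries the estimate to the differences of its points, a neighbourhood of
  0. The second use of compactness concerns rescaled solutions, which are not of the form
  \<open>n * (1 - g)\<close>; hence an abstract class closed under rescaling and drift. Two cases
  escape holomorphy. If \<open>\<nu>\<close> is the point mass at 0, \<open>\<phi>\<close> is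
  constant and \<open>f = 1\<close>. If some solution has real part 0 throughout, it lies on the
  boundary of the half-plane, where fibres need not be discrete; but then it is linear and a
  degenerate law does. Otherwise every solution has nonzero real part somewhere, which keeps the
  limits of scale factors away from 0 and infinity. The condition \<open>c \<noteq> 1\<close>
  excludes trivial invariances and curves with locally constant positive real part; the latter could
  rest at a critical point of \<open>\<phi>\<close>.\<close>

lemma nn_integral_one_minus_cos_ge:
  fixes d x :: real
  assumes "d > 0" and "\<bar>x\<bar> \<ge> 2 / d"
  shows "ennreal (d / 2) \<le> (\<integral>\<^sup>+t. ennreal (1 - cos (t * x)) * indicator {0..d} t \<partial>lborel)"
proof -
  have x0: "x \<noteq> 0" and dx: "2 \<le> d * \<bar>x\<bar>"
    using assms by (auto simp: field_simps)
  have "(\<integral>\<^sup>+t. ennreal (1 - cos (t * x)) * indicator {0..d} t \<partial>lborel)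
      = ennreal ((d - sin (d * x) / x) - (0 - sin (0 * x) / x))"
    using x0 assms(1)
    by (intro nn_integral_FTC_Icc[where F = "\<lambda>t. t - sin (t * x) / x"])
       (auto intro!: derivative_eq_intros)
  \<comment> \<open>The integral equals \<open>d - sin (d * x) / x\<close>; beyond the threshold
    \<open>2 / d\<close> the second term costs at most half of \<open>d\<close>.\<close>
  moreover have "sin (d * x) / x \<le> d / 2"
  proof -
    have "sin (d * x) / x \<le> \<bar>sin (d * x)\<bar> / \<bar>x\<bar>"
      by (metis abs_divide abs_ge_self)
    also have "\<dots> \<le> 1 / \<bar>x\<bar>"
      by (intro divide_right_mono) auto
    also have "\<dots> \<le> d / 2"
      using dx x0 by (simp add: field_simps)
    finally show ?thesis .
  qed
  ultimately show ?thesis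
    by (simp add: ennreal_leI)
qed

lemma (in real_distribution) expectation_cos:
  "integrable M (\<lambda>x. cos (t * x))" "(LINT x|M. cos (t * x)) = Re (char M t)"
proof -
  have i: "complex_integrable M (\<lambda>x. iexp (t * x))"
    using integrable_iexp[of "\<lambda>x. complex_of_real (t * x)"] by simp
  have "Re (iexp (t * x)) = cos (t * x)" for x
    by (simp add: Re_exp)
  then show "integrable M (\<lambda>x. cos (t * x))" "(LINT x|M. cos (t * x)) = Re (char M t)"
    unfolding char_def using integrable_Re[OF i] integral_Re[OF i] by simp_all
qed

text \<open>The pointwise bound for \<open>1 - cos\<close>, integrated over \<open>M\<close>; for
  nonnegative integrals Tonelli's theorem exchanges the order.\<close>

lemma (in real_distribution) tail_le_char:
  fixes d :: real
  assumes d: "d > 0"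
  shows "ennreal (d / 2) * emeasure M {x. \<bar>x\<bar> \<ge> 2 / d}
    \<le> (\<integral>\<^sup>+t. ennreal (1 - Re (char M t)) * indicator {0..d} t \<partial>lborel)"
proof -
  interpret P: pair_sigma_finite M lborel ..
  have "ennreal (d / 2) * emeasure M {x. \<bar>x\<bar> \<ge> 2 / d}
      = (\<integral>\<^sup>+x. ennreal (d / 2) * indicator {x. \<bar>x\<bar> \<ge> 2 / d} x \<partial>M)"
    by (subst nn_integral_cmult_indicator) auto
  also have "\<dots> \<le> (\<integral>\<^sup>+x. (\<integral>\<^sup>+t. ennreal (1 - cos (t * x)) * indicator {0..d} t \<partial>lborel) \<partial>M)"
    using nn_integral_one_minus_cos_ge[OF d]
    by (intro nn_integral_mono) (auto split: split_indicator)
  also have "\<dots> = (\<integral>\<^sup>+t. (\<integral>\<^sup>+x. ennreal (1 - cos (t * x)) * indicator {0..d} t \<partial>M) \<partial>lborel)"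
    by (rule P.Fubini'[symmetric]) (simp add: split_beta')
  also have "\<dots> = (\<integral>\<^sup>+t. ennreal (1 - Re (char M t)) * indicator {0..d} t \<partial>lborel)"
  proof (intro nn_integral_cong)
    fix t :: real
    have "(\<integral>\<^sup>+x. ennreal (1 - cos (t * x)) \<partial>M) = ennreal (LINT x|M. 1 - cos (t * x))"
      by (rule nn_integral_eq_integral) (auto simp: expectation_cos)
    also have "(LINT x|M. 1 - cos (t * x)) = 1 - Re (char M t)"
      using prob_space by (subst Bochner_Integration.integral_diff) (auto simp: expectation_cos simp del: space_eq_univ)
    finally show "(\<integral>\<^sup>+x. ennreal (1 - cos (t * x)) * indicator {0..d} t \<partial>M)
        = ennreal (1 - Re (char M t)) * indicator {0..d} t"
      by (simp add: nn_integral_multc)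
  qed
  finally show ?thesis .
qed

text \<open>Applied later to the mixing distribution itself: a characteristic function close to 1 on
  a long interval leaves little mass away from 0.\<close>

lemma (in real_distribution) tail_le_of_char_ge:
  fixes d :: real
  assumes d: "d > 0" and ge: "\<And>t. 0 \<le> t \<Longrightarrow> t \<le> d \<Longrightarrow> 1 - \<eta> \<le> Re (char M t)"
  shows "measure M {x. \<bar>x\<bar> \<ge> 2 / d} \<le> 2 * \<eta>"
proof -
  have eta: "0 \<le> \<eta>"
    using ge[of 0] d by (simp add: char_zero)
  have "ennreal (d / 2) * emeasure M {x. \<bar>x\<bar> \<ge> 2 / d}
      \<le> (\<integral>\<^sup>+t. ennreal \<eta> * indicator {0..d} t \<partial>lborel)"
    by (rule order_trans[OF tail_le_char[OF d]])
       (use ge in \<open>auto intro!: nn_integral_mono ennreal_leI split: split_indicator simp: algebra_simps\<close>)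
  also have "\<dots> = ennreal (\<eta> * d)"
    using d eta by (simp add: nn_integral_cmult_indicator ennreal_mult)
  finally have "ennreal (d / 2 * measure M {x. \<bar>x\<bar> \<ge> 2 / d}) \<le> ennreal (\<eta> * d)"
    using d by (simp add: emeasure_eq_measure ennreal_mult[symmetric])
  then have "d / 2 * measure M {x. \<bar>x\<bar> \<ge> 2 / d} \<le> \<eta> * d"
    using d eta by (subst (asm) ennreal_le_iff) auto
  then show ?thesis
    using d by (simp add: field_simps)
qed

lemma (in real_distribution) eventually_prob_interval_gt:
  assumes "\<epsilon> > 0"
  shows "\<forall>\<^sub>F k in sequentially. 1 - \<epsilon> < measure M {- real k<..real k}"
proof -
  have "(\<lambda>k. measure M {- real k<..real k}) \<longlonglongrightarrow> measure M (\<Union>k. {- real k<..real k})"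
    by (rule finite_Lim_measure_incseq) (auto simp: incseq_def)
  also have "(\<Union>k. {- real k<..real k}) = space M"
  proof -
    have "\<exists>k. - real k < x \<and> x \<le> real k" for x
      using reals_Archimedean2[of "\<bar>x\<bar>"] by (metis abs_less_iff less_imp_le minus_less_iff)
    then show ?thesis by auto
  qed
  finally have "(\<lambda>k. measure M {- real k<..real k}) \<longlonglongrightarrow> 1"
    using prob_space by simp
  then show ?thesis
    using assms by (intro order_tendstoD(1)) auto
qed

text \<open>Continuity of \<open>h\<close> at 0 makes the mean of \<open>1 - Re h\<close> over a
  short interval small; dominated convergence passes this to all but finitely many
  \<open>M n\<close>, and finitely many laws are always tight.\<close>

lemma tight_if_char_tendsto:
  fixes M :: "nat \<Rightarrow> real measure" and h :: "real \<Rightarrow> complex"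
  assumes M: "\<And>n. real_distribution (M n)"
    and lim: "\<And>t. (\<lambda>n. char (M n) t) \<longlonglongrightarrow> h t"
    and cont: "isCont h 0"
  shows "tight M"
  unfolding tight_def
proof (intro conjI allI impI M)
  fix \<epsilon> :: real assume eps: "\<epsilon> > 0"
  interpret M: real_distribution "M n" for n by (rule M)
  have h0: "h 0 = 1"
    using lim[of 0] by (simp add: M.char_zero LIMSEQ_const_iff)
  have h_meas [measurable]: "h \<in> borel_measurable borel"
    by (rule borel_measurable_LIMSEQ_metric[OF M.char_measurable lim])
  \<comment> \<open>The bound \<open>\<epsilon> / 8\<close> becomes \<open>\<epsilon> / 4\<close> in
    order to hold strictly for large \<open>n\<close>, and division by the factor
    \<open>d / 2\<close> of the tail inequality makes it \<open>\<epsilon> / 2\<close>.\<close>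
  obtain d where d: "d > 0" and hd: "\<And>t. \<bar>t\<bar> \<le> d \<Longrightarrow> 1 - Re (h t) \<le> \<epsilon> / 8"
  proof -
    have "\<forall>\<^sub>F t in at 0. dist (h t) 1 < \<epsilon> / 8"
      using cont eps unfolding isCont_def h0 by (intro tendstoD) auto
    then obtain e where e: "e > 0" "\<And>t. t \<noteq> 0 \<Longrightarrow> \<bar>t\<bar> < e \<Longrightarrow> cmod (h t - 1) < \<epsilon> / 8"
      unfolding eventually_at by (auto simp: dist_norm)
    have "1 - Re (h t) \<le> \<epsilon> / 8" if "\<bar>t\<bar> \<le> e / 2" for t
    proof (cases "t = 0")
      case False
      then have "cmod (h t - 1) < \<epsilon> / 8" using e that by auto
      then show ?thesis using abs_Re_le_cmod[of "h t - 1"] by auto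
    qed (use eps h0 in auto)
    with e(1) show ?thesis by (intro that[of "e / 2"]) auto
  qed
  define I where "I n = (\<integral>\<^sup>+t. ennreal (1 - Re (char (M n) t)) * indicator {0..d} t \<partial>lborel)" for n
  have "(\<lambda>n. I n) \<longlonglongrightarrow> (\<integral>\<^sup>+t. ennreal (1 - Re (h t)) * indicator {0..d} t \<partial>lborel)"
    unfolding I_def
  proof (rule nn_integral_dominated_convergence[where w = "\<lambda>t. ennreal 2 * indicator {0..d} t"])
    show "AE t in lborel. ennreal (1 - Re (char (M n) t)) * indicator {0..d} t
        \<le> ennreal 2 * indicator {0..d} t" for n
    proof (intro AE_I2 mult_right_mono ennreal_leI)
      fix t show "1 - Re (char (M n) t) \<le> 2"
        using M.cmod_char_le_1[of n t] abs_Re_le_cmod[of "char (M n) t"] by linarith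
    qed auto
    show "(\<integral>\<^sup>+t. ennreal 2 * indicator {0..d} t \<partial>lborel) < \<infinity>"
      using d by (subst nn_integral_cmult_indicator) (auto simp: ennreal_mult_less_top)
    show "AE t in lborel. (\<lambda>n. ennreal (1 - Re (char (M n) t)) * indicator {0..d} t)
        \<longlonglongrightarrow> ennreal (1 - Re (h t)) * indicator {0..d} t"
      by (intro AE_I2) (auto split: split_indicator intro!: tendsto_intros lim)
  qed auto
  moreover have "(\<integral>\<^sup>+t. ennreal (1 - Re (h t)) * indicator {0..d} t \<partial>lborel) \<le> ennreal (d * \<epsilon> / 8)"
  proof -
    have "(\<integral>\<^sup>+t. ennreal (1 - Re (h t)) * indicator {0..d} t \<partial>lborel)
        \<le> (\<integral>\<^sup>+t. ennreal (\<epsilon> / 8) * indicator {0..d} t \<partial>lborel)"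
      using hd by (intro nn_integral_mono) (auto split: split_indicator intro!: ennreal_leI)
    also have "\<dots> = ennreal (d * \<epsilon> / 8)"
      using d eps by (subst nn_integral_cmult_indicator) (auto simp: ennreal_mult'[symmetric] mult.commute)
    finally show ?thesis .
  qed
  ultimately have "\<forall>\<^sub>F n in sequentially. I n < ennreal (d * \<epsilon> / 4)"
    using d eps by (elim order_tendstoD(2)) (auto elim!: order.strict_trans1 intro!: ennreal_lessI)
  then obtain N where N: "\<And>n. n \<ge> N \<Longrightarrow> I n < ennreal (d * \<epsilon> / 4)"
    by (auto simp: eventually_sequentially)
  have tail: "measure (M n) {x. \<bar>x\<bar> \<ge> 2 / d} < \<epsilon>" if "n \<ge> N" for n
  proof -
    have "ennreal (d / 2) * emeasure (M n) {x. \<bar>x\<bar> \<ge> 2 / d} < ennreal (d * \<epsilon> / 4)"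
      using M.tail_le_char[OF d, of n] N[OF that] unfolding I_def by (rule order.strict_trans1)
    then have "ennreal (d / 2 * measure (M n) {x. \<bar>x\<bar> \<ge> 2 / d}) < ennreal (d * \<epsilon> / 4)"
      using d by (simp add: M.emeasure_eq_measure ennreal_mult[symmetric])
    then have "d / 2 * measure (M n) {x. \<bar>x\<bar> \<ge> 2 / d} < d * \<epsilon> / 4"
      using d by (subst (asm) ennreal_less_iff) auto
    then show ?thesis
      using d eps by (simp add: field_simps)
  qed
  have "\<forall>\<^sub>F k in sequentially. \<forall>n\<in>{..<N}. 1 - \<epsilon> < measure (M n) {- real k<..real k}"
    by (intro eventually_ball_finite ballI M.eventually_prob_interval_gt eps) auto
  moreover have "\<forall>\<^sub>F k in sequentially. 2 / d \<le> real k"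
    by real_asymp
  moreover have "\<forall>\<^sub>F k in sequentially. 0 < k"
    by (rule eventually_gt_at_top)
  ultimately have "\<forall>\<^sub>F k in sequentially. 0 < k \<and> 2 / d \<le> real k
      \<and> (\<forall>n\<in>{..<N}. 1 - \<epsilon> < measure (M n) {- real k<..real k})"
    by eventually_elim auto
  then have "\<exists>k. 0 < k \<and> 2 / d \<le> real k
      \<and> (\<forall>n\<in>{..<N}. 1 - \<epsilon> < measure (M n) {- real k<..real k})"
    by (rule eventually_happens'[OF sequentially_bot])
  then obtain k where k: "0 < k" "2 / d \<le> real k"
      "\<And>n. n < N \<Longrightarrow> 1 - \<epsilon> < measure (M n) {- real k<..real k}"
    by blast
  have "1 - \<epsilon> < measure (M n) {- real k<..real k}" for n
  proof (cases "n < N")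
    case False
    have "1 - measure (M n) {- real k<..real k} = measure (M n) (- {- real k<..real k})"
      using M.prob_compl[of "{- real k<..real k}" n] by (simp add: Compl_eq_Diff_UNIV)
    also have "\<dots> \<le> measure (M n) {x. \<bar>x\<bar> \<ge> 2 / d}"
      using k(2) by (intro M.finite_measure_mono) auto
    also have "\<dots> < \<epsilon>"
      using False by (intro tail) auto
    finally show ?thesis by simp
  qed (rule k)
  then show "\<exists>a b. a < b \<and> (\<forall>n. 1 - \<epsilon> < measure (M n) {a<..b})"
    using k(1) by (intro exI[of _ "- real k"] exI[of _ "real k"]) auto
qed

text \<open>Levy's continuity theorem for a limit not known to be a characteristic function:
  tightness provides a weak limit along a subsequence, and its characteristic function can only be
  \<open>h\<close>.\<close>

theorem char_function_limit:
  fixes g :: "nat \<Rightarrow> real \<Rightarrow> complex"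
  assumes g: "\<And>n. char_function (g n)"
    and lim: "\<And>t. (\<lambda>n. g n t) \<longlonglongrightarrow> h t"
    and cont: "isCont h 0"
  shows "char_function h"
proof -
  obtain M where M: "\<And>n. real_distribution (M n)" "\<And>n. g n = char (M n)"
    using g unfolding char_function_def by metis
  have "tight M"
    using lim cont by (intro tight_if_char_tendsto[where h = h] M) (simp_all add: M(2))
  from tight_imp_convergent_subsubsequence[OF this strict_mono_id]
  obtain r M' where r: "strict_mono (r :: nat \<Rightarrow> nat)" and M': "real_distribution M'"
    and conv: "weak_conv_m (M \<circ> id \<circ> r) M'"
    by blast
  have "h t = char M' t" for t
  proof (rule LIMSEQ_unique)
    show "(\<lambda>n. char (M (r n)) t) \<longlonglongrightarrow> h t"
      using LIMSEQ_subseq_LIMSEQ[OF lim r, of t] by (simp add: o_def M(2))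
    show "(\<lambda>n. char (M (r n)) t) \<longlonglongrightarrow> char M' t"
      using levy_continuity1[OF _ M' conv, of t] M(1) by (simp add: o_def)
  qed
  then show ?thesis
    using M' by (auto simp: char_function_def)
qed

section \<open>Affine images, sums and powers; the additivity defect\<close>

lemma real_distribution_distr:
  assumes "real_distribution M" "f \<in> borel_measurable borel"
  shows "real_distribution (distr M borel f)"
proof -
  interpret real_distribution M by fact
  have "prob_space (distr M borel f)"
    using assms(2) by (intro prob_space_distr) simp
  then show ?thesis
    by (simp add: real_distribution_def real_distribution_axioms_def)
qed

lemma char_affine:
  assumes "real_distribution M"
  shows "char (distr M borel (\<lambda>x. c * x + d)) t = iexp (t * d) * char M (c * t)"
proof -
  interpret real_distribution M by fact
  have "char (distr M borel (\<lambda>x. c * x + d)) t = (CLINT x|M. iexp (t * d) * iexp (c * t * x))"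
    unfolding char_def
    by (subst integral_distr) (auto simp: exp_add[symmetric] algebra_simps intro!: Bochner_Integration.integral_cong)
  then show ?thesis
    by (simp add: char_def)
qed

lemma char_linear_combination:
  assumes "real_distribution M" "real_distribution N"
  shows "real_distribution (distr (M \<Otimes>\<^sub>M N) borel (\<lambda>(x, y). a * x + b * y))"
    and "char (distr (M \<Otimes>\<^sub>M N) borel (\<lambda>(x, y). a * x + b * y)) t = char M (a * t) * char N (b * t)"
proof -
  interpret M: real_distribution M by fact
  interpret N: real_distribution N by fact
  interpret P: pair_prob_space M N ..
  have "prob_space (distr (M \<Otimes>\<^sub>M N) borel (\<lambda>(x, y). a * x + b * y))"
    by (intro P.prob_space_distr) simp
  then show "real_distribution (distr (M \<Otimes>\<^sub>M N) borel (\<lambda>(x, y). a * x + b * y))"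
    by (simp add: real_distribution_def real_distribution_axioms_def)
  have "char (distr (M \<Otimes>\<^sub>M N) borel (\<lambda>(x, y). a * x + b * y)) t
      = (CLINT z|M \<Otimes>\<^sub>M N. iexp (a * t * fst z) * iexp (b * t * snd z))"
    unfolding char_def
    by (subst integral_distr)
       (auto simp: exp_add[symmetric] algebra_simps split_beta intro!: Bochner_Integration.integral_cong)
  also have "\<dots> = (CLINT x|M. CLINT y|N. iexp (a * t * x) * iexp (b * t * y))"
  proof (subst P.integral_fst'[symmetric])
    show "complex_integrable (M \<Otimes>\<^sub>M N) (\<lambda>z. iexp (a * t * fst z) * iexp (b * t * snd z))"
      by (rule P.integrable_const_bound[where B = 1]) (auto simp: norm_mult)
  qed simp
  also have "\<dots> = char M (a * t) * char N (b * t)"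
    by (simp add: char_def)
  finally show "char (distr (M \<Otimes>\<^sub>M N) borel (\<lambda>(x, y). a * x + b * y)) t = char M (a * t) * char N (b * t)" .
qed

lemma stable_law_iff:
  "stable_law M \<longleftrightarrow> real_distribution M \<and>
    (\<forall>a>0. \<forall>b>0. \<exists>c>0. \<exists>d. \<forall>t. char M (a * t) * char M (b * t) = iexp (t * d) * char M (c * t))"
proof -
  have "distr (M \<Otimes>\<^sub>M M) borel (\<lambda>(x, y). a * x + b * y) = distr M borel (\<lambda>x. c * x + d) \<longleftrightarrow>
      (\<forall>t. char M (a * t) * char M (b * t) = iexp (t * d) * char M (c * t))"
    if M: "real_distribution M" for a b c d :: real
  proof
    assume "distr (M \<Otimes>\<^sub>M M) borel (\<lambda>(x, y). a * x + b * y) = distr M borel (\<lambda>x. c * x + d)"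
    then show "\<forall>t. char M (a * t) * char M (b * t) = iexp (t * d) * char M (c * t)"
      using char_linear_combination(2)[OF M M, of a b] char_affine[OF M, of c d] by metis
  next
    assume "\<forall>t. char M (a * t) * char M (b * t) = iexp (t * d) * char M (c * t)"
    then show "distr (M \<Otimes>\<^sub>M M) borel (\<lambda>(x, y). a * x + b * y) = distr M borel (\<lambda>x. c * x + d)"
      by (intro Levy_uniqueness char_linear_combination M real_distribution_distr ext)
         (auto simp: char_linear_combination[OF M M] char_affine[OF M] simp del: of_real_mult)
  qed
  then show ?thesis
    unfolding stable_law_def by blast
qed

lemma char_function_mult:
  assumes "char_function f" "char_function g"
  shows "char_function (\<lambda>t. f t * g t)"
proof -
  obtain M N where MN: "real_distribution M" "f = char M" "real_distribution N" "g = char N"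
    using assms unfolding char_function_def by blast
  show ?thesis
    unfolding char_function_def
    using char_linear_combination[OF MN(1,3), of 1 1]
    by (intro exI[of _ "distr (M \<Otimes>\<^sub>M N) borel (\<lambda>(x, y). 1 * x + 1 * y)"]) (simp add: MN fun_eq_iff)
qed

lemma char_function_iexp: "char_function (\<lambda>t. iexp (t * d))"
proof -
  have "prob_space (return borel d)"
    by (rule prob_space_return) simp
  then have "real_distribution (return borel d)"
    by (simp add: real_distribution_def real_distribution_axioms_def)
  moreover have "char (return borel d) = (\<lambda>t. iexp (t * d))"
    unfolding char_def by (intro ext, subst integral_return) auto
  ultimately show ?thesis
    unfolding char_function_def by metis
qed

lemma char_function_one: "char_function (\<lambda>t. 1)"
  using char_function_iexp[of 0] by simp

lemma char_function_power:
  assumes "char_function f"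
  shows "char_function (\<lambda>t. f t ^ n)"
  by (induction n) (simp_all add: char_function_one char_function_mult assms)

lemma char_function_affine:
  assumes "char_function f"
  shows "char_function (\<lambda>t. f (c * t) * iexp (t * d))"
proof -
  obtain M where M: "real_distribution M" "f = char M"
    using assms unfolding char_function_def by blast
  have "char (distr M borel (\<lambda>x. c * x + d)) = (\<lambda>t. f (c * t) * iexp (t * d))"
    by (rule ext, subst char_affine[OF M(1)]) (simp add: M(2))
  moreover have "real_distribution (distr M borel (\<lambda>x. c * x + d))"
    by (rule real_distribution_distr[OF M(1)]) simp
  ultimately show ?thesis
    unfolding char_function_def by (intro exI[of _ "distr M borel (\<lambda>x. c * x + d)"]) simp
qed

lemma char_function_basic:
  assumes "char_function f"
  shows "f 0 = 1" and "cmod (f t) \<le> 1" and "isCont f t" and "f (- t) = cnj (f t)"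
proof -
  obtain M where M: "real_distribution M" "f = char M"
    using assms unfolding char_function_def by blast
  interpret real_distribution M by (rule M)
  show "f 0 = 1" and "cmod (f t) \<le> 1" and "isCont f t"
    using char_zero cmod_char_le_1 isCont_char by (auto simp: M(2))
  have "cnj (f t) = (CLINT x|M. cnj (iexp (t * x)))"
    unfolding M(2) char_def by (rule Bochner_Integration.integral_cnj[symmetric])
  then show "f (- t) = cnj (f t)"
    by (simp add: M(2) char_def exp_cnj)
qed

text \<open>This turns a bound with a free weight \<open>r\<close> into Cauchy-Schwarz form; for
  positive \<open>A\<close> and \<open>B\<close> the best weight is
  \<open>sqrt B / sqrt A\<close>.\<close>

lemma le_two_sqrt_mult:
  fixes A B z :: real
  assumes "\<And>r. r > 0 \<Longrightarrow> z \<le> r * A + B / r" and "A \<ge> 0" "B \<ge> 0"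
  shows "z \<le> 2 * (sqrt A * sqrt B)"
proof -
  consider "A > 0" "B > 0" | "A = 0" | "B = 0"
    using assms by linarith
  then show ?thesis
  proof cases
    case 1
    have "z \<le> sqrt B / sqrt A * A + B / (sqrt B / sqrt A)"
      using 1 by (intro assms(1)) simp
    also have "sqrt B / sqrt A * A = sqrt B * sqrt A"
      using 1 by (metis less_imp_le real_div_sqrt times_divide_eq_left times_divide_eq_right)
    also have "B / (sqrt B / sqrt A) = sqrt B * sqrt A"
      using 1 by (metis divide_divide_eq_right less_imp_le real_div_sqrt times_divide_eq_left)
    finally show ?thesis by simp
  next
    case 2
    have "z \<le> 0"
    proof (rule ccontr)
      assume "\<not> z \<le> 0"
      \<comment> \<open>With \<open>A = 0\<close> larger weights are always better; this one leaves
        \<open>z * B / (B + 1)\<close>, which is less than \<open>z\<close>.\<close>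
      then have "z \<le> (B + 1) / z * A + B / ((B + 1) / z)"
        using assms(3) by (intro assms(1)) simp
      then show False
        using 2 \<open>\<not> z \<le> 0\<close> assms(3) by (simp add: field_simps)
    qed
    then show ?thesis using 2 by simp
  next
    case 3
    have "z \<le> 0"
    proof (rule ccontr)
      assume "\<not> z \<le> 0"
      then have "z \<le> z / (A + 1) * A + B / (z / (A + 1))"
        using assms(2) by (intro assms(1)) simp
      then show False
        using 3 \<open>\<not> z \<le> 0\<close> assms(2) by (simp add: field_simps)
    qed
    then show ?thesis using 3 by simp
  qed
qed

text \<open>The left side is the modulus of the expectation of
  \<open>(iexp (t * x) - 1) * (iexp (u * x) - 1)\<close>, and the mean square of the first factor is
  \<open>2 * (1 - Re (f t))\<close>, likewise for \<open>u\<close>; so this is the Cauchy-Schwarz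
  inequality.\<close>

lemma char_function_additivity_defect:
  assumes "char_function f"
  shows "cmod (1 + f (t + u) - f t - f u) \<le> 2 * (sqrt (1 - Re (f t)) * sqrt (1 - Re (f u)))"
proof (rule le_two_sqrt_mult)
  obtain M where M: "real_distribution M" "f = char M"
    using assms unfolding char_function_def by blast
  interpret real_distribution M by (rule M)
  have [simp]: "complex_integrable M (\<lambda>x. iexp (v * x))" for v
    using integrable_iexp[of "\<lambda>x. complex_of_real (v * x)"] by simp
  have sq: "(cmod (iexp v - 1))\<^sup>2 = 2 * (1 - cos v)" for v
    using sin_cos_squared_add[of v]
    unfolding cmod_power2 by (simp add: Re_exp Im_exp power2_eq_square algebra_simps)
  fix r :: real assume r: "r > 0"
  have "1 + f (t + u) - f t - f u = (CLINT x|M. (iexp (t * x) - 1) * (iexp (u * x) - 1))"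
  proof -
    have "(CLINT x|M. (iexp (t * x) - 1) * (iexp (u * x) - 1))
        = (CLINT x|M. (iexp ((t + u) * x) - iexp (t * x)) - (iexp (u * x) - 1))"
      by (intro Bochner_Integration.integral_cong) (auto simp: algebra_simps exp_add)
    also have "\<dots> = (char M (t + u) - char M t) - (char M u - 1)"
      unfolding char_def using prob_space
      by (subst Bochner_Integration.integral_diff; simp del: of_real_mult of_real_add space_eq_univ)+
    finally show ?thesis by (simp add: M(2))
  qed
  also have "cmod \<dots> \<le> (LINT x|M. r * (1 - cos (t * x)) + (1 - cos (u * x)) / r)"
  proof (rule Bochner_Integration.integral_norm_bound_integral)
    show "complex_integrable M (\<lambda>x. (iexp (t * x) - 1) * (iexp (u * x) - 1))"
    proof (rule integrable_const_bound[where B = 4])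
      have "cmod (iexp v - 1) \<le> 2" for v
        using norm_triangle_ineq4[of "iexp v" 1] by simp
      then have "cmod ((iexp (t * x) - 1) * (iexp (u * x) - 1)) \<le> 2 * 2" for x
        unfolding norm_mult by (intro mult_mono) (simp_all del: of_real_mult)
      then show "AE x in M. cmod ((iexp (t * x) - 1) * (iexp (u * x) - 1)) \<le> 4"
        by simp
    qed simp
    show "integrable M (\<lambda>x. r * (1 - cos (t * x)) + (1 - cos (u * x)) / r)"
      by (simp add: expectation_cos)
    fix x
    have "cmod ((iexp (t * x) - 1) * (iexp (u * x) - 1)) = cmod (iexp (t * x) - 1) * cmod (iexp (u * x) - 1)"
      by (rule norm_mult)
    also have "\<dots> \<le> (r * (cmod (iexp (t * x) - 1))\<^sup>2 + (cmod (iexp (u * x) - 1))\<^sup>2 / r) / 2"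
    proof -
      have "0 \<le> (r * cmod (iexp (t * x) - 1) - cmod (iexp (u * x) - 1))\<^sup>2 / r"
        using r by simp
      then show ?thesis
        using r by (simp add: power2_eq_square field_simps)
    qed
    also have "\<dots> = r * (1 - cos (t * x)) + (1 - cos (u * x)) / r"
      unfolding sq using r by (simp add: field_simps)
    finally show "cmod ((iexp (t * x) - 1) * (iexp (u * x) - 1)) \<le> r * (1 - cos (t * x)) + (1 - cos (u * x)) / r" .
  qed
  also have "\<dots> = r * (1 - Re (f t)) + (1 - Re (f u)) / r"
    using prob_space by (simp add: expectation_cos M(2) del: space_eq_univ)
  finally show "cmod (1 + f (t + u) - f t - f u) \<le> r * (1 - Re (f t)) + (1 - Re (f u)) / r" .
next
  show "0 \<le> 1 - Re (f t)" "0 \<le> 1 - Re (f u)"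
    using char_function_basic(2)[OF assms, of t] char_function_basic(2)[OF assms, of u]
      complex_Re_le_cmod[of "f t"] complex_Re_le_cmod[of "f u"] by linarith+
qed

section \<open>The Laplace transform of the mixing distribution\<close>

locale mixing = real_distribution \<nu> for \<nu> :: "real measure" +
  assumes nonneg: "AE u in \<nu>. 0 \<le> u"
begin

abbreviation \<Phi> :: "complex \<Rightarrow> complex" where
  "\<Phi> \<equiv> laplace_transform \<nu>"

lemma integrable_kernel: "Re s \<ge> 0 \<Longrightarrow> complex_integrable \<nu> (\<lambda>u. exp (- (s * complex_of_real u)))"
  using nonneg by (intro integrable_const_bound[where B = 1]) auto

lemma integrable_exp_kernel: "x \<ge> 0 \<Longrightarrow> integrable \<nu> (\<lambda>u. exp (- (x * u)))"
  using nonneg by (intro integrable_const_bound[where B = 1]) auto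

lemma laplace_zero: "\<Phi> 0 = 1"
  using prob_space by (simp add: laplace_transform_def del: space_eq_univ)

lemma norm_laplace_le: "cmod (\<Phi> s) \<le> (LINT u|\<nu>. exp (- (Re s * u)))"
proof -
  have "cmod (\<Phi> s) \<le> (LINT u|\<nu>. cmod (exp (- (s * complex_of_real u))))"
    unfolding laplace_transform_def by (rule integral_norm_bound)
  then show ?thesis by simp
qed

lemma real_laplace_mono:
  assumes "0 \<le> x" "x \<le> y"
  shows "(LINT u|\<nu>. exp (- (y * u))) \<le> (LINT u|\<nu>. exp (- (x * u)))"
  using nonneg assms
  by (intro integral_mono_AE integrable_exp_kernel) (auto intro: mult_right_mono elim!: eventually_mono)

text \<open>The contrapositive of monotonicity; it converts closeness of
  \<open>cmod (\<Phi> s)\<close> to 1 into smallness of \<open>Re s\<close>.\<close>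

lemma Re_less_if_norm_laplace_gt:
  assumes "0 \<le> x" "(LINT u|\<nu>. exp (- (x * u))) < cmod (\<Phi> s)"
  shows "Re s < x"
proof (rule ccontr)
  assume "\<not> Re s < x"
  then have "(LINT u|\<nu>. exp (- (Re s * u))) \<le> (LINT u|\<nu>. exp (- (x * u)))"
    using assms(1) by (intro real_laplace_mono) auto
  then show False
    using norm_laplace_le[of s] assms(2) by linarith
qed

lemma continuous_on_laplace: "continuous_on {s. Re s \<ge> 0} \<Phi>"
  unfolding continuous_on_sequentially
proof (intro ballI allI impI)
  fix a and z :: "nat \<Rightarrow> complex"
  assume a: "a \<in> {s. Re s \<ge> 0}" and z: "(\<forall>n. z n \<in> {s. Re s \<ge> 0}) \<and> z \<longlonglongrightarrow> a"
  have "AE u in \<nu>. cmod (exp (- (z n * complex_of_real u))) \<le> 1" for n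
    using nonneg z by (auto elim!: eventually_mono)
  then show "(\<Phi> \<circ> z) \<longlonglongrightarrow> \<Phi> a"
    unfolding laplace_transform_def comp_def
    using z by (intro integral_dominated_convergence[where w = "\<lambda>_. 1"]) (auto intro!: tendsto_intros)
qed

lemma tendsto_laplace:
  assumes "(z \<longlongrightarrow> a) F" "\<And>n. Re (z n) \<ge> 0" "Re a \<ge> 0"
  shows "((\<lambda>n. \<Phi> (z n)) \<longlongrightarrow> \<Phi> a) F"
  by (rule continuous_on_tendsto_compose[OF continuous_on_laplace assms(1)]) (use assms(2,3) in auto)

end

locale nontrivial_mixing = mixing +
  assumes not_zero: "measure \<nu> {0} < 1"
begin

text \<open>Otherwise \<open>exp (- (x * u)) = 1\<close> almost everywhere, and all mass would be at
  0.\<close>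

lemma real_laplace_less_one:
  assumes "0 < x"
  shows "(LINT u|\<nu>. exp (- (x * u))) < 1"
proof (rule ccontr)
  assume "\<not> ?thesis"
  moreover have "(LINT u|\<nu>. 1 - exp (- (x * u))) = 1 - (LINT u|\<nu>. exp (- (x * u)))"
    using prob_space assms
    by (subst Bochner_Integration.integral_diff) (auto simp: integrable_exp_kernel simp del: space_eq_univ)
  moreover have ge: "AE u in \<nu>. 0 \<le> 1 - exp (- (x * u))"
    using nonneg assms by (auto elim!: eventually_mono)
  ultimately have "(LINT u|\<nu>. 1 - exp (- (x * u))) = 0"
    using integral_nonneg_AE[OF ge] by linarith
  then have "AE u in \<nu>. 1 - exp (- (x * u)) = 0"
    using assms by (subst (asm) integral_nonneg_eq_0_iff_AE[OF _ ge]) (auto simp: integrable_exp_kernel)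
  then have "AE u in \<nu>. u \<in> {0}"
    using assms by (auto elim!: eventually_mono)
  then have "measure \<nu> {0} = 1"
    by (intro prob_eq_1[THEN iffD2]) auto
  then show False
    using not_zero by simp
qed

text \<open>Differentiation under the integral. Since \<open>u\<close> itself may fail to be
  integrable, the domination uses the decay of the exponential away from the imaginary axis.\<close>

lemma has_field_derivative_laplace:
  assumes z: "Re z > 0"
  shows "(\<Phi> has_field_derivative (CLINT u|\<nu>. - (complex_of_real u * exp (- (z * complex_of_real u))))) (at z)"
  unfolding has_field_derivative_iff tendsto_at_iff_sequentially
proof (intro allI impI)
  fix X :: "nat \<Rightarrow> complex"
  assume X: "\<forall>i. X i \<in> UNIV - {z}" and lim: "X \<longlonglongrightarrow> z"
  \<comment> \<open>The half-plane \<open>Re s > d\<close> is convex, contains \<open>z\<close> and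
    eventually the \<open>X i\<close>, and on it the derivative of the kernel is bounded by
    \<open>1 / d\<close>.\<close>
  define d where "d = Re z / 2"
  have d: "d > 0" using z by (simp add: d_def)
  have "(\<lambda>i. Re (X i)) \<longlonglongrightarrow> Re z"
    by (intro tendsto_intros lim)
  then have "\<forall>\<^sub>F i in sequentially. Re (X i) > d"
    using z by (intro order_tendstoD) (auto simp: d_def)
  then obtain N where N: "\<And>i. i \<ge> N \<Longrightarrow> Re (X i) > d"
    by (auto simp: eventually_sequentially)
  define Q where "Q i u = (exp (- (X (i + N) * complex_of_real u)) - exp (- (z * complex_of_real u))) / (X (i + N) - z)" for i u
  have Q_lim: "(\<lambda>i. Q i u) \<longlonglongrightarrow> - (complex_of_real u * exp (- (z * complex_of_real u)))" for u
  proof -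
    have "((\<lambda>s. exp (- (s * complex_of_real u))) has_field_derivative
        - (complex_of_real u * exp (- (z * complex_of_real u)))) (at z)"
      by (auto intro!: derivative_eq_intros)
    then have "(\<lambda>i. (exp (- (X i * complex_of_real u)) - exp (- (z * complex_of_real u))) / (X i - z))
        \<longlonglongrightarrow> - (complex_of_real u * exp (- (z * complex_of_real u)))"
      using X lim unfolding has_field_derivative_iff tendsto_at_iff_sequentially comp_def by blast
    then show ?thesis
      unfolding Q_def by (rule LIMSEQ_ignore_initial_segment)
  qed
  have Q_bound: "cmod (Q i u) \<le> 1 / d" if u: "u \<ge> 0" for i u
  proof -
    have "cmod (exp (- (X (i + N) * complex_of_real u)) - exp (- (z * complex_of_real u)))
        \<le> (1 / d) * cmod (X (i + N) - z)"
    proof (rule field_differentiable_bound[where S = "{s. Re s > d}"])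
      show "convex {s. Re s > d}"
        by (rule convex_halfspace_Re_gt)
      show "X (i + N) \<in> {s. Re s > d}" "z \<in> {s. Re s > d}"
        using N d by (auto simp: d_def)
      show "((\<lambda>s. exp (- (s * complex_of_real u))) has_field_derivative
          - (complex_of_real u * exp (- (s * complex_of_real u)))) (at s within {s. Re s > d})" for s
        by (auto intro!: derivative_eq_intros)
      fix s :: complex assume "s \<in> {s. Re s > d}"
      then have "u * exp (- (Re s * u)) \<le> u * exp (- (d * u))"
        using u by (intro mult_left_mono) (auto intro!: mult_right_mono)
      moreover have "d * u \<le> exp (d * u)"
        using exp_ge_add_one_self[of "d * u"] by linarith
      then have "u * exp (- (d * u)) \<le> 1 / d"
        using d by (simp add: exp_minus field_simps)
      ultimately show "cmod (- (complex_of_real u * exp (- (s * complex_of_real u)))) \<le> 1 / d"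
        using u by (simp add: norm_mult)
    qed
    then show ?thesis
      using X d by (simp add: Q_def norm_divide divide_simps)
  qed
  have "(\<lambda>i. CLINT u|\<nu>. Q i u) \<longlonglongrightarrow> (CLINT u|\<nu>. - (complex_of_real u * exp (- (z * complex_of_real u))))"
  proof (rule integral_dominated_convergence[where w = "\<lambda>_. 1 / d"])
    show "Q i \<in> borel_measurable \<nu>" for i
      unfolding Q_def by simp
    show "AE u in \<nu>. cmod (Q i u) \<le> 1 / d" for i
      using nonneg by eventually_elim (rule Q_bound)
  qed (auto intro!: Q_lim AE_I2)
  moreover have "(CLINT u|\<nu>. Q i u) = (\<Phi> (X (i + N)) - \<Phi> z) / (X (i + N) - z)" for i
  proof -
    have "Re (X (i + N)) \<ge> 0"
      using N[of "i + N"] d by simp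
    then show ?thesis
      using z unfolding Q_def laplace_transform_def
      by (subst Bochner_Integration.integral_divide_zero)
         (auto simp: integrable_kernel less_imp_le Bochner_Integration.integral_diff)
  qed
  ultimately have "(\<lambda>i. (\<Phi> (X (i + N)) - \<Phi> z) / (X (i + N) - z))
      \<longlonglongrightarrow> (CLINT u|\<nu>. - (complex_of_real u * exp (- (z * complex_of_real u))))"
    by simp
  then show "((\<lambda>y. (\<Phi> y - \<Phi> z) / (y - z)) \<circ> X)
      \<longlonglongrightarrow> (CLINT u|\<nu>. - (complex_of_real u * exp (- (z * complex_of_real u))))"
    unfolding comp_def by (rule LIMSEQ_offset)
qed

lemma holomorphic_laplace: "\<Phi> holomorphic_on {s. Re s > 0}"
  using has_field_derivative_laplace
  by (auto simp: holomorphic_on_open open_halfspace_Re_gt)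

text \<open>A constant value would be 1, by continuity at the boundary point 0, against
  \<open>cmod (\<Phi> 1) < 1\<close>.\<close>

lemma laplace_nonconstant: "\<exists>w. Re w > 0 \<and> \<Phi> w \<noteq> c"
proof (rule ccontr)
  assume const: "\<nexists>w. Re w > 0 \<and> \<Phi> w \<noteq> c"
  have "(\<lambda>n. \<Phi> (of_real (inverse (real (Suc n))))) \<longlonglongrightarrow> \<Phi> 0"
    using tendsto_of_real[OF LIMSEQ_inverse_real_of_nat, where 'a = complex]
    by (intro tendsto_laplace) (auto simp del: of_nat_Suc)
  moreover have "\<Phi> (of_real (inverse (real (Suc n)))) = c" for n
    using const by (auto simp del: of_nat_Suc of_real_inverse)
  ultimately have "c = 1"
    by (simp add: LIMSEQ_const_iff laplace_zero)
  moreover have "cmod (\<Phi> 1) < 1"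
    using norm_laplace_le[of 1] real_laplace_less_one[of 1] by simp
  moreover have "\<Phi> 1 = c"
    using const by auto
  ultimately show False by simp
qed

lemma laplace_isolated:
  assumes "Re z > 0"
  obtains r where "r > 0" "\<And>w. w \<in> ball z r \<Longrightarrow> w \<noteq> z \<Longrightarrow> \<Phi> w \<noteq> \<Phi> z"
proof -
  obtain b where b: "Re b > 0" "\<Phi> b \<noteq> \<Phi> z"
    using laplace_nonconstant by blast
  have hol: "(\<lambda>w. \<Phi> w - \<Phi> z) holomorphic_on {s. Re s > 0}"
    by (intro holomorphic_intros holomorphic_laplace)
  obtain r where "0 < r" "ball z r \<subseteq> {s. Re s > 0}" "\<And>w. w \<in> ball z r - {z} \<Longrightarrow> \<Phi> w - \<Phi> z \<noteq> 0"
    by (rule isolated_zeros[OF hol open_halfspace_Re_gt convex_connected[OF convex_halfspace_Re_gt], of z b])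
      (use assms b in auto)
  then show ?thesis
    by (intro that[of r]) auto
qed

text \<open>If the derivative vanished identically, the transform would be constant. Otherwise its
  zeros are isolated; \<open>z\<close> itself may be one.\<close>

lemma laplace_critical_isolated:
  assumes "Re z > 0"
  obtains r where "r > 0" "ball z r \<subseteq> {s. Re s > 0}"
    "\<And>w. w \<in> ball z r \<Longrightarrow> w \<noteq> z \<Longrightarrow> deriv \<Phi> w \<noteq> 0"
proof (cases "\<exists>b. Re b > 0 \<and> deriv \<Phi> b \<noteq> 0")
  case False
  have "\<exists>c. \<forall>s\<in>{s. Re s > 0}. \<Phi> s = c"
    using False
    by (intro has_field_derivative_zero_constant convex_halfspace_Re_gt)
       (metis (mono_tags, lifting) has_field_derivative_at_within has_field_derivative_laplace DERIV_imp_deriv mem_Collect_eq)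
  then show ?thesis
    using laplace_nonconstant by blast
next
  case True
  then obtain b where b: "Re b > 0" "deriv \<Phi> b \<noteq> 0" by blast
  have hol: "deriv \<Phi> holomorphic_on {s. Re s > 0}"
    by (intro holomorphic_deriv holomorphic_laplace open_halfspace_Re_gt)
  obtain r where r: "r > 0" "ball z r \<subseteq> {s. Re s > 0}"
    using assms open_contains_ball[of "{s. Re s > 0}"] open_halfspace_Re_gt[of 0] by auto
  show ?thesis
  proof (cases "deriv \<Phi> z = 0")
    case True
    obtain r' where r': "0 < r'" "ball z r' \<subseteq> {s. Re s > 0}"
        "\<And>w. w \<in> ball z r' - {z} \<Longrightarrow> deriv \<Phi> w \<noteq> 0"
      by (rule isolated_zeros[OF hol open_halfspace_Re_gt convex_connected[OF convex_halfspace_Re_gt], of z b])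
        (use assms b True in auto)
    then show ?thesis
      using r by (intro that[of r']) auto
  next
    case False
    have "isCont (deriv \<Phi>) z"
      using hol assms open_halfspace_Re_gt[of 0]
      by (metis continuous_on_eq_continuous_at holomorphic_on_imp_continuous_on mem_Collect_eq)
    then obtain r' where "0 < r'" "\<And>w. dist z w < r' \<Longrightarrow> deriv \<Phi> w \<noteq> 0"
      using continuous_at_avoid[of z "deriv \<Phi>" 0] False by auto
    then show ?thesis
      using r by (intro that[of "min r r'"]) auto
  qed
qed

lemma laplace_locally_injective:
  assumes "Re z > 0" "deriv \<Phi> z \<noteq> 0"
  obtains r where "r > 0" "inj_on \<Phi> (ball z r)"
  using has_complex_derivative_locally_injective[OF holomorphic_laplace _ open_halfspace_Re_gt assms(2)] assms(1)
  by auto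

text \<open>For \<open>x \<ge> 0\<close> and \<open>u \<ge> 0\<close>,
  \<open>exp (- (x * u)) * cos v\<close> is at most \<open>(1 + cos v) / 2\<close>, whatever the
  sign of the cosine. This removes the real part of \<open>s\<close> at the price of a factor
  2.\<close>

lemma Re_char_ge_of_Re_laplace_ge:
  assumes s: "Re s \<ge> 0" and ge: "1 - \<eta> \<le> Re (\<Phi> s)"
  shows "1 - 2 * \<eta> \<le> Re (char \<nu> (Im s))"
proof -
  have *: "Re (exp (- (s * complex_of_real u))) = exp (- (Re s * u)) * cos (Im s * u)" for u
    by (simp add: Re_exp)
  have int: "integrable \<nu> (\<lambda>u. Re (exp (- (s * complex_of_real u))))"
    using integrable_kernel[OF s] by (rule integrable_Re)
  have "(LINT u|\<nu>. Re (exp (- (s * complex_of_real u)))) \<le> (LINT u|\<nu>. (1 + cos (Im s * u)) / 2)"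
  proof (rule integral_mono_AE)
    show "AE u in \<nu>. Re (exp (- (s * complex_of_real u))) \<le> (1 + cos (Im s * u)) / 2"
      using nonneg
    proof eventually_elim
      fix u :: real assume u: "0 \<le> u"
      have e: "exp (- (Re s * u)) \<le> 1" using u s by simp
      define c where "c = cos (Im s * u)"
      have c: "- 1 \<le> c" "c \<le> 1" by (simp_all add: c_def)
      show "Re (exp (- (s * complex_of_real u))) \<le> (1 + cos (Im s * u)) / 2"
      proof (cases "cos (Im s * u) \<ge> 0")
        case True
        then have "exp (- (Re s * u)) * c \<le> c"
          unfolding c_def using e by (intro mult_left_le_one_le) auto
        then show ?thesis unfolding * c_def[symmetric] using c by argo
      next
        case False
        then have "exp (- (Re s * u)) * c \<le> 0"
          unfolding c_def by (intro mult_nonneg_nonpos) auto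
        then show ?thesis unfolding * c_def[symmetric] using c by argo
      qed
    qed
  qed (auto intro!: int simp: expectation_cos)
  moreover have "(LINT u|\<nu>. Re (exp (- (s * complex_of_real u)))) = Re (\<Phi> s)"
    unfolding laplace_transform_def by (rule integral_Re[OF integrable_kernel[OF s]])
  moreover have "(LINT u|\<nu>. (1 + cos (Im s * u)) / 2) = (1 + Re (char \<nu> (Im s))) / 2"
    using prob_space by (simp add: expectation_cos del: space_eq_univ)
  ultimately show ?thesis
    using ge by (simp add: field_simps)
qed

end

section \<open>Compactness of exponents\<close>

text \<open>The properties of negative logarithms of infinitely divisible characteristic functions that
  survive rescalings, shifts and locally uniform limits. The last one, an instance of the Cauchy-Schwarz
  inequality, does not see the drift \<open>\<i> d t\<close>; it bounds the modulus of continuity at every point by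
  the behaviour near 0.\<close>
definition exponent :: "(real \<Rightarrow> complex) \<Rightarrow> bool" where
  "exponent s \<longleftrightarrow> s 0 = 0 \<and> (\<forall>t. isCont s t) \<and> (\<forall>t. 0 \<le> Re (s t)) \<and> (\<forall>t. s (- t) = cnj (s t)) \<and>
    (\<forall>t u. cmod (s t + s u - s (t + u)) \<le> 2 * (sqrt (Re (s t)) * sqrt (Re (s u))))"

lemma exponentD:
  assumes "exponent s"
  shows "s 0 = 0" "isCont s t" "0 \<le> Re (s t)" "s (- t) = cnj (s t)"
    "cmod (s t + s u - s (t + u)) \<le> 2 * (sqrt (Re (s t)) * sqrt (Re (s u)))"
  using assms by (auto simp: exponent_def)

lemma exponent_continuous_on: "exponent s \<Longrightarrow> continuous_on A s"
  by (simp add: continuous_at_imp_continuous_on exponentD)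

text \<open>The real part of the Cauchy-Schwarz bound completes a square. Subadditivity of the root
  is what spreads smallness from an interval to the differences of its points.\<close>

lemma exponent_sqrt_Re_add:
  assumes "exponent s"
  shows "sqrt (Re (s (t + u))) \<le> sqrt (Re (s t)) + sqrt (Re (s u))"
proof (rule real_le_lsqrt)
  have "Re (s (t + u)) - (Re (s t) + Re (s u)) \<le> cmod (s t + s u - s (t + u))"
    using abs_Re_le_cmod[of "s t + s u - s (t + u)"] by simp
  also have "\<dots> \<le> 2 * (sqrt (Re (s t)) * sqrt (Re (s u)))"
    by (rule exponentD[OF assms])
  finally show "Re (s (t + u)) \<le> (sqrt (Re (s t)) + sqrt (Re (s u)))\<^sup>2"
    using exponentD(3)[OF assms] by (simp add: power2_sum)
qed (simp add: exponentD[OF assms])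

lemma exponent_sqrt_Re_diff:
  assumes "exponent s"
  shows "sqrt (Re (s (t - u))) \<le> sqrt (Re (s t)) + sqrt (Re (s u))"
  using exponent_sqrt_Re_add[OF assms, of t "- u"] exponentD(4)[OF assms, of u] by simp

lemma exponent_increment:
  assumes "exponent s"
  shows "cmod (s v - s t) \<le> cmod (s (v - t)) + 2 * (sqrt (Re (s t)) * sqrt (Re (s (v - t))))"
proof -
  have "s v - s t = s (v - t) - (s t + s (v - t) - s (t + (v - t)))"
    by simp
  then have "cmod (s v - s t) \<le> cmod (s (v - t)) + cmod (s t + s (v - t) - s (t + (v - t)))"
    by (metis norm_triangle_ineq4)
  then show ?thesis
    using exponentD(5)[OF assms, of t "v - t"] by linarith
qed

lemma exponent_increment':
  assumes "exponent s"
  shows "cmod (s v - s t) \<le> cmod (s (v - t)) + 2 * (sqrt (cmod (s t)) * sqrt (cmod (s (v - t))))"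
proof -
  have "sqrt (Re (s t)) * sqrt (Re (s (v - t))) \<le> sqrt (cmod (s t)) * sqrt (cmod (s (v - t)))"
    by (intro mult_mono) (auto simp: complex_Re_le_cmod exponentD[OF assms])
  then show ?thesis
    using exponent_increment[OF assms, of v t] by linarith
qed

text \<open>At \<open>u = t\<close> the defect is at most \<open>2 * Re (s t)\<close>, so a doubling
  costs at most a factor 4. Bounds near 0 thus give bounds at every point.\<close>

lemma exponent_pow2:
  assumes "exponent s"
  shows "cmod (s (2 ^ k * t)) \<le> 4 ^ k * cmod (s t)"
proof (induction k)
  case (Suc k)
  define v where "v = 2 ^ k * t"
  have v2: "2 ^ Suc k * t = v + v"
    by (simp add: v_def)
  have "cmod (s (v + v)) = cmod (2 * s v - (s v + s v - s (v + v)))"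
    by simp
  also have "\<dots> \<le> cmod (2 * s v) + cmod (s v + s v - s (v + v))"
    by (rule norm_triangle_ineq4)
  also have "\<dots> \<le> 2 * cmod (s v) + 2 * Re (s v)"
    using exponentD(3)[OF assms, of v] exponentD(5)[OF assms, of v v] by (simp add: norm_mult)
  also have "\<dots> \<le> 4 * cmod (s v)"
    using complex_Re_le_cmod[of "s v"] by simp
  finally show ?case
    using Suc unfolding v2 v_def by simp
qed simp

text \<open>Each of the \<open>m\<close> defects carries the factor \<open>sqrt (Re (s u))\<close>.
  Where this is small, the value at \<open>u\<close> is nearly one \<open>m\<close>-th of the value
  at \<open>m * u\<close>, so that a merely bounded imaginary part near 0 becomes a small
  one.\<close>

lemma exponent_multiple:
  assumes "exponent s" and "\<And>i. i < m \<Longrightarrow> sqrt (Re (s (real i * u))) \<le> Q"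
  shows "cmod (of_nat m * s u - s (real m * u)) \<le> real m * (2 * (Q * sqrt (Re (s u))))"
  using assms(2)
proof (induction m)
  case 0
  then show ?case using exponentD(1)[OF assms(1)] by simp
next
  case (Suc m)
  have "of_nat (Suc m) * s u - s (real (Suc m) * u)
      = (of_nat m * s u - s (real m * u)) + (s (real m * u) + s u - s (real m * u + u))"
    by (simp add: algebra_simps)
  also have "cmod \<dots> \<le> cmod (of_nat m * s u - s (real m * u)) + cmod (s (real m * u) + s u - s (real m * u + u))"
    by (rule norm_triangle_ineq)
  also have "\<dots> \<le> real m * (2 * (Q * sqrt (Re (s u)))) + 2 * (Q * sqrt (Re (s u)))"
  proof (intro add_mono)
    have "sqrt (Re (s (real m * u))) * sqrt (Re (s u)) \<le> Q * sqrt (Re (s u))"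
      using Suc.prems[of m] exponentD(3)[OF assms(1)] by (intro mult_right_mono) auto
    then show "cmod (s (real m * u) + s u - s (real m * u + u)) \<le> 2 * (Q * sqrt (Re (s u)))"
      using exponentD(5)[OF assms(1), of "real m * u" u] by linarith
  qed (use Suc in auto)
  finally show ?case
    by (simp add: algebra_simps)
qed

lemma exponent_one_minus_char_function:
  assumes g: "char_function g" and x: "x \<ge> 0"
  shows "exponent (\<lambda>t. of_real x * (1 - g t))"
  unfolding exponent_def
proof (intro conjI allI)
  fix t u
  show "isCont (\<lambda>t. of_real x * (1 - g t)) t"
    using char_function_basic(3)[OF g] by (intro continuous_intros) auto
  have Re: "Re (g t) \<le> 1" for t
    using char_function_basic(2)[OF g, of t] complex_Re_le_cmod[of "g t"] by linarith
  then show "0 \<le> Re (of_real x * (1 - g t))"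
    using x by simp
  have "cmod (of_real x * (1 - g t) + of_real x * (1 - g u) - of_real x * (1 - g (t + u)))
      = cmod (of_real x * (1 + g (t + u) - g t - g u))"
    by (simp add: algebra_simps)
  also have "\<dots> = x * cmod (1 + g (t + u) - g t - g u)"
    using x by (simp add: norm_mult)
  also have "\<dots> \<le> x * (2 * (sqrt (1 - Re (g t)) * sqrt (1 - Re (g u))))"
    by (intro mult_left_mono char_function_additivity_defect g x)
  also have "\<dots> = 2 * ((sqrt x * sqrt (1 - Re (g t))) * (sqrt x * sqrt (1 - Re (g u))))"
    using x by (simp add: algebra_simps)
  finally show "cmod (of_real x * (1 - g t) + of_real x * (1 - g u) - of_real x * (1 - g (t + u)))
      \<le> 2 * (sqrt (Re (of_real x * (1 - g t))) * sqrt (Re (of_real x * (1 - g u))))"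
    by (simp add: real_sqrt_mult)
qed (simp_all add: char_function_basic[OF g])

lemma exponent_rescale:
  assumes s: "exponent s" and lam: "a \<ge> 0"
  shows "exponent (\<lambda>t. of_real a * s (\<kappa> * t) + \<i> * of_real (d * t))"
  unfolding exponent_def
proof (intro conjI allI)
  fix t u
  have "isCont (\<lambda>t. s (\<kappa> * t)) t"
    by (rule isCont_o2[where g = s]) (auto intro!: continuous_intros exponentD[OF s])
  then show "isCont (\<lambda>t. of_real a * s (\<kappa> * t) + \<i> * of_real (d * t)) t"
    by (intro continuous_intros) auto
  have "cmod (of_real a * s (\<kappa> * t) + \<i> * of_real (d * t) + (of_real a * s (\<kappa> * u) + \<i> * of_real (d * u))
      - (of_real a * s (\<kappa> * (t + u)) + \<i> * of_real (d * (t + u))))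
    = cmod (of_real a * (s (\<kappa> * t) + s (\<kappa> * u) - s (\<kappa> * t + \<kappa> * u)))"
    by (simp add: algebra_simps)
  also have "\<dots> = a * cmod (s (\<kappa> * t) + s (\<kappa> * u) - s (\<kappa> * t + \<kappa> * u))"
    using lam by (simp add: norm_mult)
  also have "\<dots> \<le> a * (2 * (sqrt (Re (s (\<kappa> * t))) * sqrt (Re (s (\<kappa> * u)))))"
    by (intro mult_left_mono exponentD(5)[OF s] lam)
  also have "\<dots> = 2 * ((sqrt a * sqrt (Re (s (\<kappa> * t)))) * (sqrt a * sqrt (Re (s (\<kappa> * u)))))"
    using lam by (simp add: algebra_simps)
  finally show "cmod (of_real a * s (\<kappa> * t) + \<i> * of_real (d * t) + (of_real a * s (\<kappa> * u) + \<i> * of_real (d * u))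
      - (of_real a * s (\<kappa> * (t + u)) + \<i> * of_real (d * (t + u))))
    \<le> 2 * (sqrt (Re (of_real a * s (\<kappa> * t) + \<i> * of_real (d * t)))
      * sqrt (Re (of_real a * s (\<kappa> * u) + \<i> * of_real (d * u))))"
    by (simp add: real_sqrt_mult)
qed (use lam in \<open>simp_all add: exponentD[OF s]\<close>)

text \<open>The difference from the linear function vanishes at the integers, hence has period 1 and
  is bounded; a bounded additive function is 0.\<close>

lemma continuous_additive_linear:
  fixes h :: "real \<Rightarrow> complex"
  assumes cont: "\<And>t. isCont h t" and add: "\<And>t u. h (t + u) = h t + h u"
  shows "h t = of_real t * h 1"
proof -
  define k where "k t = h t - of_real t * h 1" for t
  have k_add: "k (t + u) = k t + k u" for t u
    by (simp add: k_def add algebra_simps)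
  have k1: "k 1 = 0" by (simp add: k_def)
  have k0: "k 0 = 0" using k_add[of 0 0] by simp
  have k_nat: "k (real n * t) = of_nat n * k t" for n t
    by (induction n) (simp_all add: k0 k_add distrib_right algebra_simps)
  have k_minus: "k (- t) = - k t" for t
    using k_add[of t "- t"] k0 by (simp add: add_eq_0_iff)
  have k_nat1: "k (real n) = 0" for n
    using k_nat[of n 1] k1 by simp
  have k_int: "k (of_int n) = 0" for n
    by (cases n) (simp_all add: k_nat1 k_minus k_nat1[of "Suc _", simplified] del: of_nat_Suc)
  have "continuous_on {0..1} k"
    unfolding k_def by (intro continuous_at_imp_continuous_on ballI continuous_intros cont)
  then have "bounded (k ` {0..1})"
    by (intro compact_imp_bounded compact_continuous_image) auto
  then obtain B where B: "\<And>t. t \<in> {0..1} \<Longrightarrow> cmod (k t) \<le> B"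
    unfolding bounded_iff by blast
  have bound: "cmod (k t) \<le> B" for t
  proof -
    have "k t = k (frac t)"
      using k_add[of "frac t" "of_int \<lfloor>t\<rfloor>"] k_int by (simp add: frac_def)
    then show ?thesis
      using B[of "frac t"] frac_lt_1[of t] by simp
  qed
  have "k t = 0"
  proof (rule ccontr)
    assume "k t \<noteq> 0"
    then obtain n where "B < real n * cmod (k t)"
      using reals_Archimedean3[of "cmod (k t)"] by auto
    then show False
      using bound[of "real n * t"] by (simp add: k_nat norm_mult)
  qed
  then show ?thesis by (simp add: k_def)
qed

text \<open>Without real part the Cauchy-Schwarz bound leaves no defect, so \<open>s\<close> is
  additive.\<close>

lemma exponent_Re_zero:
  assumes s: "exponent s" and "\<And>t. Re (s t) = 0"
  shows "s t = \<i> * of_real (t * Im (s 1))"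
proof -
  have "s (t + u) = s t + s u" for t u
    using exponentD(5)[OF s, of t u] assms(2) by simp
  then have "s t = of_real t * s 1"
    by (intro continuous_additive_linear exponentD[OF s])
  moreover have "s 1 = \<i> * of_real (Im (s 1))"
    using assms(2)[of 1] by (simp add: complex_eq_iff)
  ultimately show ?thesis
    by (metis mult.left_commute of_real_mult)
qed

section \<open>Equicontinuity and compactness of sequences of exponents\<close>

definition equivanishing :: "(nat \<Rightarrow> real \<Rightarrow> complex) \<Rightarrow> bool" where
  "equivanishing s \<longleftrightarrow> (\<forall>\<epsilon>>0. \<exists>\<delta>>0. \<exists>N. \<forall>n\<ge>N. \<forall>u. \<bar>u\<bar> \<le> \<delta> \<longrightarrow> cmod (s n u) \<le> \<epsilon>)"

text \<open>Equivalent to locally uniform convergence to a continuous limit. The sequential form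
  suits scale factors that vary along with the index.\<close>

definition continuously_converges :: "(nat \<Rightarrow> real \<Rightarrow> complex) \<Rightarrow> (real \<Rightarrow> complex) \<Rightarrow> bool" where
  "continuously_converges s l \<longleftrightarrow> (\<forall>X t. X \<longlonglongrightarrow> t \<longrightarrow> (\<lambda>n. s n (X n)) \<longlonglongrightarrow> l t)"

lemma continuously_convergesD:
  assumes "continuously_converges s l"
  shows "X \<longlonglongrightarrow> t \<Longrightarrow> (\<lambda>n. s n (X n)) \<longlonglongrightarrow> l t" and "(\<lambda>n. s n t) \<longlonglongrightarrow> l t"
  using assms by (auto simp: continuously_converges_def)

lemma continuously_converges_subseq:
  assumes conv: "continuously_converges s l" and r: "strict_mono r"
  shows "continuously_converges (\<lambda>n. s (r n)) l"
  unfolding continuously_converges_def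
proof (intro allI impI)
  fix X :: "nat \<Rightarrow> real" and t
  assume X: "X \<longlonglongrightarrow> t"
  \<comment> \<open>\<open>X\<close> is indexed by the subsequence; the gaps are filled with the
    limit \<open>t\<close>, which does not disturb convergence.\<close>
  define Y where "Y n = (if n \<in> range r then X (inv r n) else t)" for n
  have inj: "inj r" using r by (rule strict_mono_imp_inj_on)
  have Y: "Y \<longlonglongrightarrow> t"
  proof (rule LIMSEQ_I)
    fix e :: real assume "e > 0"
    then obtain N where N: "\<And>n. n \<ge> N \<Longrightarrow> norm (X n - t) < e"
      using LIMSEQ_D[OF X] by blast
    show "\<exists>no. \<forall>n\<ge>no. norm (Y n - t) < e"
    proof (intro exI[of _ "r N"] allI impI)
      fix n assume "n \<ge> r N"
      then show "norm (Y n - t) < e"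
        using \<open>e > 0\<close> N r inj by (auto simp: Y_def strict_mono_less_eq)
    qed
  qed
  have "Y (r n) = X n" for n
    using inj by (simp add: Y_def)
  then show "(\<lambda>n. s (r n) (X n)) \<longlonglongrightarrow> l t"
    using LIMSEQ_subseq_LIMSEQ[OF continuously_convergesD(1)[OF conv Y] r] by (simp add: o_def)
qed

lemma equivanishing_tendsto:
  assumes "equivanishing s" "strict_mono r" "X \<longlonglongrightarrow> 0"
  shows "(\<lambda>n. s (r n) (X n)) \<longlonglongrightarrow> 0"
proof (rule LIMSEQ_I)
  fix e :: real assume "e > 0"
  then have "\<exists>\<delta>>0. \<exists>N. \<forall>n\<ge>N. \<forall>u. \<bar>u\<bar> \<le> \<delta> \<longrightarrow> cmod (s n u) \<le> e / 2"
    using assms(1) unfolding equivanishing_def by (metis half_gt_zero)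
  then obtain \<delta> N where d: "\<delta> > 0" and N: "\<And>n u. n \<ge> N \<Longrightarrow> \<bar>u\<bar> \<le> \<delta> \<Longrightarrow> cmod (s n u) \<le> e / 2"
    by blast
  obtain N' where N': "\<And>n. n \<ge> N' \<Longrightarrow> \<bar>X n\<bar> < \<delta>"
    using LIMSEQ_D[OF assms(3) d] by auto
  have "cmod (s (r n) (X n)) \<le> e / 2" if "n \<ge> max N N'" for n
  proof (rule N)
    show "N \<le> r n"
      using seq_suble[OF assms(2), of n] that by simp
    show "\<bar>X n\<bar> \<le> \<delta>"
      using N'[of n] that by simp
  qed
  then have "\<forall>n\<ge>max N N'. norm (s (r n) (X n) - 0) < e"
    using \<open>e > 0\<close> by fastforce
  then show "\<exists>no. \<forall>n\<ge>no. norm (s (r n) (X n) - 0) < e" ..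
qed

text \<open>Arzela-Ascoli: doubling gives pointwise bounds, a diagonal choice gives convergence at
  the rationals, and \<open>exponent_increment'\<close> turns equicontinuity at 0 into
  equicontinuity everywhere.\<close>

theorem exponents_convergent_subsequence:
  assumes s: "\<And>n. exponent (s n)" and eq: "equivanishing s"
  obtains r l where "strict_mono r" "exponent l" "continuously_converges (\<lambda>n. s (r n)) l"
proof -
  have "\<exists>B. \<forall>n. cmod (s n t) \<le> B" for t
  proof -
    obtain \<delta> N where d: "\<delta> > 0" and N: "\<And>n u. n \<ge> N \<Longrightarrow> \<bar>u\<bar> \<le> \<delta> \<Longrightarrow> cmod (s n u) \<le> 1"
      using eq unfolding equivanishing_def by (metis zero_less_one)
    \<comment> \<open>The point \<open>t\<close> is halved until it lies where the bound 1 holds;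
      the finitely many early members are bounded by their sum.\<close>
    obtain k where k: "\<bar>t\<bar> / \<delta> < 2 ^ k"
      using real_arch_pow[of 2 "\<bar>t\<bar> / \<delta>"] by auto
    define u where "u = t / 2 ^ k"
    have u: "\<bar>u\<bar> \<le> \<delta>" "t = 2 ^ k * u"
      using k d by (auto simp: u_def field_simps)
    have "cmod (s n t) \<le> 4 ^ k + (\<Sum>i<N. cmod (s i t))" for n
    proof (cases "n < N")
      case True
      then have "cmod (s n t) \<le> (\<Sum>i<N. cmod (s i t))"
        by (intro member_le_sum) auto
      then show ?thesis by (simp add: add_increasing)
    next
      case False
      have "cmod (s n t) \<le> 4 ^ k * cmod (s n u)"
        using exponent_pow2[OF s, of n k u] u(2) by simp
      also have "\<dots> \<le> 4 ^ k * 1"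
        using False u(1) by (intro mult_left_mono N) auto
      finally show ?thesis
        by (simp add: add_increasing2 sum_nonneg)
    qed
    then show ?thesis by blast
  qed
  then obtain B where B: "\<And>n t. cmod (s n t) \<le> B t"
    by metis
  have B0: "0 \<le> B t" for t
    using B[of 0 t] norm_ge_zero order_trans by blast
  \<comment> \<open>Diagonal selection asks for a bound common to all \<open>q\<close>, so the
    values are divided by \<open>B q + 1\<close>; the 1 keeps the divisor positive.\<close>
  obtain r where r: "strict_mono r"
    and conv: "\<And>q. q \<in> \<rat> \<Longrightarrow> \<exists>l. (\<lambda>n. s (r n) q / of_real (B q + 1)) \<longlonglongrightarrow> l"
  proof (rule function_convergent_subsequence[of "\<rat> :: real set" "\<lambda>n q. s n q / of_real (B q + 1)" 1])
    show "countable (\<rat> :: real set)" by (rule countable_rat)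
    fix n and q :: real
    have "0 < B q + 1" using B0[of q] by linarith
    then show "norm (s n q / of_real (B q + 1)) \<le> 1"
      using B[of n q] by (simp add: norm_divide divide_simps del: of_real_add)
  qed blast
  have conv_rat: "Cauchy (\<lambda>n. s (r n) q)" if "q \<in> \<rat>" for q
  proof -
    obtain l where l: "(\<lambda>n. s (r n) q / of_real (B q + 1)) \<longlonglongrightarrow> l"
      using conv[OF \<open>q \<in> \<rat>\<close>] by blast
    have "complex_of_real (B q + 1) \<noteq> 0"
      using B0[of q] by (simp del: of_real_add)
    then have "(\<lambda>n. s (r n) q) \<longlonglongrightarrow> l * of_real (B q + 1)"
      using tendsto_mult_right[OF l, of "of_real (B q + 1)"] by simp
    then show ?thesis by (rule LIMSEQ_imp_Cauchy)
  qed
  have near: "cmod (s (r n) v - s (r n) t)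
      \<le> cmod (s (r n) (v - t)) + 2 * (sqrt (B t) * sqrt (cmod (s (r n) (v - t))))" for n v t
  proof -
    have "sqrt (cmod (s (r n) t)) * sqrt (cmod (s (r n) (v - t))) \<le> sqrt (B t) * sqrt (cmod (s (r n) (v - t)))"
      by (intro mult_right_mono) (auto simp: B)
    then show ?thesis
      using exponent_increment'[OF s, of "r n" v t] by linarith
  qed
  have "Cauchy (\<lambda>n. s (r n) t)" for t
  proof (rule CauchyI)
    fix e :: real assume e: "e > 0"
    \<comment> \<open>The tolerance \<open>x\<close> near 0 is chosen so small that increments at
      \<open>t\<close> stay below \<open>e / 3\<close>.\<close>
    have "((\<lambda>x. x + 2 * (sqrt (B t) * sqrt x)) \<longlongrightarrow> 0 + 2 * (sqrt (B t) * sqrt 0)) (at_right 0)"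
      by (intro tendsto_intros)
    then have "\<forall>\<^sub>F x in at_right 0. x + 2 * (sqrt (B t) * sqrt x) < e / 3"
      using e by (intro order_tendstoD(2)) auto
    moreover have "\<forall>\<^sub>F x in at_right 0. (0 :: real) < x"
      by (simp add: eventually_at_right_less)
    ultimately have "\<forall>\<^sub>F x in at_right 0. 0 < x \<and> x + 2 * (sqrt (B t) * sqrt x) < e / 3"
      by eventually_elim auto
    then obtain x where x: "0 < x" "x + 2 * (sqrt (B t) * sqrt x) < e / 3"
      using eventually_happens'[OF trivial_limit_at_right_real] by blast
    obtain \<delta> N where d: "\<delta> > 0" and N: "\<And>n u. n \<ge> N \<Longrightarrow> \<bar>u\<bar> \<le> \<delta> \<Longrightarrow> cmod (s n u) \<le> x"
      using eq x(1) unfolding equivanishing_def by metis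
    obtain q where q: "q \<in> \<rat>" "t < q" "q < t + \<delta>"
      using Rats_dense_in_real[of t "t + \<delta>"] d by auto
    have near_q: "cmod (s (r n) q - s (r n) t) < e / 3" if "n \<ge> N" for n
    proof -
      have "cmod (s (r n) (q - t)) \<le> x"
        using q seq_suble[OF r, of n] that by (intro N) auto
      then have "cmod (s (r n) (q - t)) + 2 * (sqrt (B t) * sqrt (cmod (s (r n) (q - t))))
          \<le> x + 2 * (sqrt (B t) * sqrt x)"
        by (intro add_mono mult_left_mono) (auto simp: B0)
      then show ?thesis
        using near[of n q t] x(2) by linarith
    qed
    obtain M where M: "\<And>m n. m \<ge> M \<Longrightarrow> n \<ge> M \<Longrightarrow> cmod (s (r m) q - s (r n) q) < e / 3"
      using CauchyD[OF conv_rat[OF q(1)], of "e / 3"] e by auto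
    show "\<exists>M. \<forall>m\<ge>M. \<forall>n\<ge>M. norm (s (r m) t - s (r n) t) < e"
    proof (intro exI[of _ "max M N"] allI impI)
      fix m n assume mn: "max M N \<le> m" "max M N \<le> n"
      have "s (r m) t - s (r n) t = (s (r m) q - s (r n) q) - (s (r m) q - s (r m) t) + (s (r n) q - s (r n) t)"
        by simp
      also have "cmod \<dots> \<le> cmod (s (r m) q - s (r n) q) + cmod (s (r m) q - s (r m) t) + cmod (s (r n) q - s (r n) t)"
        by (intro order_trans[OF norm_triangle_ineq] add_right_mono norm_triangle_ineq4)
      also have "\<dots> < e"
        using M[of m n] near_q[of m] near_q[of n] mn by simp
      finally show "norm (s (r m) t - s (r n) t) < e" .
    qed
  qed
  then have conv_all: "convergent (\<lambda>n. s (r n) t)" for t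
    by (rule Cauchy_convergent)
  define l where "l t = lim (\<lambda>n. s (r n) t)" for t
  have l: "(\<lambda>n. s (r n) t) \<longlonglongrightarrow> l t" for t
    using conv_all unfolding l_def convergent_LIMSEQ_iff .
  have conv_l: "continuously_converges (\<lambda>n. s (r n)) l"
    unfolding continuously_converges_def
  proof (intro allI impI)
    fix X :: "nat \<Rightarrow> real" and t
    assume X: "X \<longlonglongrightarrow> t"
    have "(\<lambda>n. X n - t) \<longlonglongrightarrow> 0"
      using X by (simp add: LIM_zero)
    then have lim0: "(\<lambda>n. s (r n) (X n - t)) \<longlonglongrightarrow> 0"
      by (rule equivanishing_tendsto[OF eq r])
    have "(\<lambda>n. cmod (s (r n) (X n - t)) + 2 * (sqrt (B t) * sqrt (cmod (s (r n) (X n - t)))))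
        \<longlonglongrightarrow> cmod 0 + 2 * (sqrt (B t) * sqrt (cmod 0))"
      by (intro tendsto_intros lim0)
    then have "(\<lambda>n. s (r n) (X n) - s (r n) t) \<longlonglongrightarrow> 0"
      using near by (intro Lim_null_comparison[OF always_eventually[OF allI[OF near]]]) simp
    from tendsto_add[OF this l[of t]] show "(\<lambda>n. s (r n) (X n)) \<longlonglongrightarrow> l t"
      by simp
  qed
  have l_near: "cmod (l v - l t) \<le> cmod (l (v - t)) + 2 * (sqrt (B t) * sqrt (cmod (l (v - t))))" for v t
    by (rule LIMSEQ_le[of "\<lambda>n. cmod (s (r n) v - s (r n) t)" _
          "\<lambda>n. cmod (s (r n) (v - t)) + 2 * (sqrt (B t) * sqrt (cmod (s (r n) (v - t))))"])
       (auto intro!: tendsto_intros l near)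
  have l_zero: "(l \<longlongrightarrow> 0) (at 0)"
  proof (rule tendstoI)
    fix e :: real assume e: "e > 0"
    obtain \<delta> N where d: "\<delta> > 0" and N: "\<And>n u. n \<ge> N \<Longrightarrow> \<bar>u\<bar> \<le> \<delta> \<Longrightarrow> cmod (s n u) \<le> e / 2"
      using eq e unfolding equivanishing_def by (metis half_gt_zero)
    have half: "cmod (l u) \<le> e / 2" if "\<bar>u\<bar> \<le> \<delta>" for u
    proof (rule LIMSEQ_le_const2)
      show "(\<lambda>n. cmod (s (r n) u)) \<longlonglongrightarrow> cmod (l u)"
        by (intro tendsto_intros l)
      show "\<exists>M. \<forall>n\<ge>M. cmod (s (r n) u) \<le> e / 2"
        using that seq_suble[OF r] by (intro exI[of _ N] allI impI N) (auto intro: order_trans)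
    qed
    have "dist (l u) 0 < e" if "dist u 0 < \<delta>" for u
      using half[of u] that e by simp
    then show "\<forall>\<^sub>F u in at 0. dist (l u) 0 < e"
      using d unfolding eventually_at by blast
  qed
  have l_cont: "isCont l t" for t
    unfolding isCont_def
  proof (rule LIM_zero_cancel)
    have "filterlim (\<lambda>v. v - t) (at 0) (at t)"
      by (auto simp: filterlim_at eventually_at_filter intro!: tendsto_eq_intros)
    then have "((\<lambda>v. l (v - t)) \<longlongrightarrow> 0) (at t)"
      by (rule filterlim_compose[OF l_zero])
    then have "((\<lambda>v. cmod (l (v - t)) + 2 * (sqrt (B t) * sqrt (cmod (l (v - t)))))
        \<longlongrightarrow> cmod 0 + 2 * (sqrt (B t) * sqrt (cmod 0))) (at t)"
      by (intro tendsto_intros)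
    then show "((\<lambda>v. l v - l t) \<longlongrightarrow> 0) (at t)"
      by (intro Lim_null_comparison[OF always_eventually[OF allI[OF l_near]]]) simp
  qed
  have "exponent l"
    unfolding exponent_def
  proof (intro conjI allI l_cont)
    show "l 0 = 0"
      using l[of 0] exponentD(1)[OF s] by (simp add: LIMSEQ_const_iff)
    fix t u
    show "0 \<le> Re (l t)"
      by (rule LIMSEQ_le_const[OF tendsto_Re[OF l]]) (auto simp: exponentD(3)[OF s])
    show "l (- t) = cnj (l t)"
      using LIMSEQ_unique[OF l[of "- t"]] tendsto_cnj[OF l[of t]] exponentD(4)[OF s] by simp
    show "cmod (l t + l u - l (t + u)) \<le> 2 * (sqrt (Re (l t)) * sqrt (Re (l u)))"
      by (rule LIMSEQ_le[of "\<lambda>n. cmod (s (r n) t + s (r n) u - s (r n) (t + u))" _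
            "\<lambda>n. 2 * (sqrt (Re (s (r n) t)) * sqrt (Re (s (r n) u)))"])
         (auto intro!: tendsto_intros l exponentD(5)[OF s])
  qed
  with r conv_l show ?thesis
    using that by blast
qed

text \<open>Otherwise the complements of the \<open>A n\<close> would be open and dense in
  \<open>{a..b}\<close>, and Baire's theorem would make their empty intersection dense.\<close>

lemma Baire_interval:
  fixes A :: "nat \<Rightarrow> real set"
  assumes ab: "a < b" and closed: "\<And>n. closed (A n)" and cover: "{a..b} \<subseteq> (\<Union>n. A n)"
  obtains N c d where "c < d" "a \<le> c" "d \<le> b" "{c..d} \<subseteq> A N"
proof (rule ccontr)
  note interval = that
  assume none: "\<not> thesis"
  have "{a..b} \<subseteq> closure (\<Inter>(range (\<lambda>n. {a..b} - A n)))"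
  proof (rule Baire)
    fix T assume "T \<in> range (\<lambda>n. {a..b} - A n)"
    then obtain n where T: "T = {a..b} - A n" by blast
    have "openin (top_of_set {a..b}) T"
      unfolding T Diff_eq by (intro openin_open_Int closed[THEN open_Compl])
    moreover have "x \<in> closure T" if x: "x \<in> {a..b}" for x
      unfolding closure_approachable
    proof (intro allI impI)
      fix e :: real assume e: "e > 0"
      define c where "c = max a (x - e / 2)"
      define d where "d = min b (x + e / 2)"
      have "c < d" "a \<le> c" "d \<le> b"
        using x e ab by (auto simp: c_def d_def)
      then have "\<not> {c..d} \<subseteq> A n"
        using none interval by blast
      then obtain y where "y \<in> {c..d}" "y \<notin> A n" by blast
      then show "\<exists>y\<in>T. dist y x < e"
        using e unfolding T by (intro bexI[of _ y]) (auto simp: c_def d_def dist_real_def)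
    qed
    ultimately show "openin (top_of_set {a..b}) T \<and> {a..b} \<subseteq> closure T"
      by blast
  qed auto
  moreover have "\<Inter>(range (\<lambda>n. {a..b} - A n)) = {}"
    using cover by auto
  ultimately have "{a..b} = {}"
    by (metis closure_empty subset_empty)
  then show False
    using ab by auto
qed

section \<open>Equicontinuity from convergence of the transforms\<close>

context nontrivial_mixing
begin

context
  fixes s :: "nat \<Rightarrow> real \<Rightarrow> complex" and f :: "real \<Rightarrow> complex"
  assumes s: "\<And>n. exponent (s n)"
    and lim: "\<And>t. (\<lambda>n. \<Phi> (s n t)) \<longlonglongrightarrow> f t"
    and f_cont: "isCont f 0" and f0: "f 0 = 1"
begin

text \<open>Near 0 the modulus of \<open>f\<close> exceeds the transform at \<open>e > 0\<close>, so
  at each such \<open>t\<close> the real part is eventually below \<open>e\<close>. Baire makes the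
  index uniform on an interval, and the differences of its points fill a neighbourhood of 0.\<close>

lemma Re_equivanishing:
  assumes eps: "\<epsilon> > 0"
  obtains \<delta> N where "\<delta> > 0" "\<And>n u. n \<ge> N \<Longrightarrow> \<bar>u\<bar> \<le> \<delta> \<Longrightarrow> sqrt (Re (s n u)) \<le> \<epsilon>"
proof -
  \<comment> \<open>The two points of a difference contribute \<open>\<epsilon> / 2\<close> each to
    the root.\<close>
  define e where "e = (\<epsilon> / 2)\<^sup>2"
  have e: "e > 0" using eps by (simp add: e_def)
  define L where "L = (LINT u|\<nu>. exp (- (e * u)))"
  have "((\<lambda>t. cmod (f t)) \<longlongrightarrow> cmod (f 0)) (at 0)"
    using f_cont by (intro tendsto_intros) (simp add: isCont_def)
  then have "\<forall>\<^sub>F t in at 0. L < cmod (f t)"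
    using real_laplace_less_one[OF e] f0 by (intro order_tendstoD(1)) (auto simp: L_def)
  then obtain d where d: "d > 0" "\<And>t. t \<noteq> 0 \<Longrightarrow> \<bar>t\<bar> < d \<Longrightarrow> L < cmod (f t)"
    unfolding eventually_at by (auto simp: dist_norm)
  define A where "A N = (\<Inter>n\<in>{N..}. {t. Re (s n t) \<le> e})" for N
  have closed: "closed (A N)" for N
    unfolding A_def
    by (intro closed_INT ballI closed_Collect_le continuous_on_Re exponent_continuous_on s continuous_on_const)
  have cover: "{d / 4..d / 2} \<subseteq> (\<Union>N. A N)"
  proof
    fix t assume t: "t \<in> {d / 4..d / 2}"
    have "(\<lambda>n. cmod (\<Phi> (s n t))) \<longlonglongrightarrow> cmod (f t)"
      by (intro tendsto_intros lim)
    then have "\<forall>\<^sub>F n in sequentially. L < cmod (\<Phi> (s n t))"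
      using t d by (intro order_tendstoD(1)) auto
    then have "\<forall>\<^sub>F n in sequentially. Re (s n t) \<le> e"
      using e unfolding L_def
      by (auto elim!: eventually_mono dest: Re_less_if_norm_laplace_gt[rotated])
    then show "t \<in> (\<Union>N. A N)"
      by (auto simp: eventually_sequentially A_def)
  qed
  have "d / 4 < d / 2" using d by simp
  then obtain N a b where ab: "a < b" "d / 4 \<le> a" "b \<le> d / 2" "{a..b} \<subseteq> A N"
    by (rule Baire_interval[OF _ closed cover])
  have root: "sqrt (Re (s n t)) \<le> \<epsilon> / 2" if "n \<ge> N" "t \<in> {a..b}" for n t
  proof -
    have "Re (s n t) \<le> e"
      using ab that by (auto simp: A_def)
    then show ?thesis
      using eps by (intro real_le_lsqrt) (auto simp: e_def exponentD[OF s])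
  qed
  show ?thesis
  proof (rule that[of "b - a" N])
    fix n u assume n: "n \<ge> N" and u: "\<bar>u\<bar> \<le> b - a"
    obtain v w where vw: "v \<in> {a..b}" "w \<in> {a..b}" "u = v - w"
    proof (cases "u \<ge> 0")
      case True
      with u show ?thesis by (intro that[of "a + u" a]) auto
    next
      case False
      with u show ?thesis by (intro that[of a "a - u"]) auto
    qed
    show "sqrt (Re (s n u)) \<le> \<epsilon>"
      using exponent_sqrt_Re_diff[OF s, of n v w] root[OF n vw(1)] root[OF n vw(2)] vw(3) by simp
  qed (use ab in simp)
qed

text \<open>If \<open>Im (s n)\<close> had unbounded oscillation on an interval where \<open>\<Phi> (s n)\<close> stays close to 1, then
  the characteristic function of \<open>\<nu>\<close> would be close to 1 on long intervals, so that \<open>\<nu>\<close>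
  would be concentrated at 0.\<close>
lemma Im_locally_bounded:
  obtains L \<tau> N where "\<tau> > 0" "\<And>n u. n \<ge> N \<Longrightarrow> \<bar>u\<bar> \<le> \<tau> \<Longrightarrow> \<bar>Im (s n u)\<bar> \<le> L"
proof -
  define p where "p = 1 - measure \<nu> {0}"
  have p: "p > 0" using not_zero by (simp add: p_def)
  \<comment> \<open>The estimates below produce the tail bound \<open>2 * (8 * \<eta>)\<close>, that
    is \<open>p / 2\<close>.\<close>
  define \<eta> where "\<eta> = p / 32"
  have eta: "\<eta> > 0" using p by (simp add: \<eta>_def)
  \<comment> \<open>More than half of the mass off 0 lies beyond \<open>2 / Y\<close>.\<close>
  obtain Y where Y: "Y > 0" "p / 2 < measure \<nu> {x. \<bar>x\<bar> \<ge> 2 / Y}"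
  proof -
    have "(\<lambda>k. measure \<nu> {x. \<bar>x\<bar> \<ge> 2 / real (Suc k)}) \<longlonglongrightarrow> measure \<nu> (\<Union>k. {x. \<bar>x\<bar> \<ge> 2 / real (Suc k)})"
    proof (rule finite_Lim_measure_incseq)
      show "incseq (\<lambda>k. {x. \<bar>x\<bar> \<ge> 2 / real (Suc k)})"
        by (rule monoI) (auto elim!: order_trans[rotated] intro!: divide_left_mono simp del: of_nat_Suc)
    qed auto
    moreover have "(\<Union>k. {x. \<bar>x\<bar> \<ge> 2 / real (Suc k)}) = space \<nu> - {0 :: real}"
    proof -
      have "\<exists>k. 2 / real (Suc k) \<le> \<bar>x\<bar>" if "x \<noteq> 0" for x :: real
      proof -
        obtain k where "2 / \<bar>x\<bar> < real k"
          using reals_Archimedean2 by blast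
        with that have "2 / real (Suc k) \<le> \<bar>x\<bar>"
          by (simp add: field_simps)
        then show ?thesis ..
      qed
      then show ?thesis by auto
    qed
    moreover have "measure \<nu> (space \<nu> - {0}) = p"
      unfolding p_def by (rule prob_compl) auto
    ultimately have "\<forall>\<^sub>F k in sequentially. p / 2 < measure \<nu> {x. \<bar>x\<bar> \<ge> 2 / real (Suc k)}"
      using p by (intro order_tendstoD(1)) auto
    then obtain k where "p / 2 < measure \<nu> {x. \<bar>x\<bar> \<ge> 2 / real (Suc k)}"
      using eventually_happens'[OF sequentially_bot] by blast
    then show ?thesis
      by (intro that[of "real (Suc k)"]) auto
  qed
  have "((\<lambda>t. Re (f t)) \<longlongrightarrow> Re (f 0)) (at 0)"
    using f_cont by (intro tendsto_intros) (simp add: isCont_def)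
  then have "\<forall>\<^sub>F t in at 0. 1 - \<eta> < Re (f t)"
    using f0 eta by (intro order_tendstoD(1)) auto
  then obtain d where d: "d > 0" "\<And>t. t \<noteq> 0 \<Longrightarrow> \<bar>t\<bar> < d \<Longrightarrow> 1 - \<eta> < Re (f t)"
    unfolding eventually_at by (auto simp: dist_norm)
  obtain d' N' where d': "d' > 0" "\<And>n u. n \<ge> N' \<Longrightarrow> \<bar>u\<bar> \<le> d' \<Longrightarrow> sqrt (Re (s n u)) \<le> 1"
    using Re_equivanishing[of 1] by auto
  define h where "h = min d d'"
  have h: "h > 0" using d d' by (simp add: h_def)
  define A where "A N = (\<Inter>n\<in>{N..}. {t. 1 - \<eta> \<le> Re (\<Phi> (s n t))})" for N
  have "continuous_on UNIV (\<lambda>t. \<Phi> (s n t))" for n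
    by (rule continuous_on_compose2[OF continuous_on_laplace])
       (auto simp: exponentD[OF s] intro!: exponent_continuous_on s)
  then have closed: "closed (A N)" for N
    unfolding A_def by (intro closed_INT ballI closed_Collect_le continuous_on_Re continuous_on_const) auto
  have cover: "{h / 4..h / 2} \<subseteq> (\<Union>N. A N)"
  proof
    fix t assume t: "t \<in> {h / 4..h / 2}"
    have "(\<lambda>n. Re (\<Phi> (s n t))) \<longlonglongrightarrow> Re (f t)"
      by (intro tendsto_intros lim)
    moreover have "1 - \<eta> < Re (f t)"
      using t h by (intro d(2)) (auto simp: h_def)
    ultimately have "\<forall>\<^sub>F n in sequentially. 1 - \<eta> < Re (\<Phi> (s n t))"
      by (rule order_tendstoD(1))
    then have "\<forall>\<^sub>F n in sequentially. 1 - \<eta> \<le> Re (\<Phi> (s n t))"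
      by (rule eventually_mono) simp
    then show "t \<in> (\<Union>N. A N)"
      by (auto simp: eventually_sequentially A_def)
  qed
  have "h / 4 < h / 2" using h by simp
  then obtain N a b where ab: "a < b" "h / 4 \<le> a" "b \<le> h / 2" "{a..b} \<subseteq> A N"
    by (rule Baire_interval[OF _ closed cover])
  have char_ge: "1 - 2 * \<eta> \<le> Re (char \<nu> (Im (s n t)))" if "n \<ge> N" "t \<in> {a..b}" for n t
    using ab that by (intro Re_char_ge_of_Re_laplace_ge exponentD[OF s]) (auto simp: A_def)
  have osc: "\<bar>Im (s n t) - Im (s n a)\<bar> < Y" if n: "n \<ge> N" and t: "t \<in> {a..b}" for n t
  proof (rule ccontr)
    assume "\<not> ?thesis"
    then have large: "Y \<le> \<bar>Im (s n t) - Im (s n a)\<bar>" by simp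
    have "1 - 8 * \<eta> \<le> Re (char \<nu> y)" if y: "0 \<le> y" "y \<le> Y" for y
    proof -
      have cont: "continuous_on {a..t} (\<lambda>t. Im (s n t))"
        by (intro continuous_on_Im exponent_continuous_on s)
      \<comment> \<open>By the intermediate value theorem an oscillation of size \<open>Y\<close>
        passes through all smaller ones, so every \<open>y\<close> up to \<open>Y\<close> is, up to
        sign, a difference of two arguments at which \<open>char \<nu>\<close> is close to
        1.\<close>
      obtain v where v: "v \<in> {a..t}" "\<bar>Im (s n v) - Im (s n a)\<bar> = y"
      proof (cases "Im (s n a) \<le> Im (s n t)")
        case True
        then show ?thesis
          using IVT'[of "\<lambda>t. Im (s n t)" a "Im (s n a) + y" t] y large t cont that by force
      next
        case False
        then show ?thesis
          using IVT2'[of "\<lambda>t. Im (s n t)" t "Im (s n a) - y" a] y large t cont that by force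
      qed
      define P where "P = Im (s n v)"
      define Q where "Q = Im (s n a)"
      have P: "1 - 2 * \<eta> \<le> Re (char \<nu> P)" and Q: "1 - 2 * \<eta> \<le> Re (char \<nu> Q)"
        unfolding P_def Q_def using v(1) t n by (auto intro!: char_ge)
      \<comment> \<open>For unit complex numbers this is the bound of a squared sum by twice the sum
        of squares; it takes deviations \<open>2 * \<eta>\<close> at \<open>P\<close> and
        \<open>Q\<close> to \<open>8 * \<eta>\<close> at \<open>P - Q\<close>.\<close>
      have cos_le: "1 - cos (p - q) \<le> 2 * (1 - cos p) + 2 * (1 - cos q)" for p q :: real
      proof -
        have "2 * (1 - cos p) + 2 * (1 - cos q) - (1 - cos (p - q))
            = ((1 - cos p + (1 - cos q))\<^sup>2 + (sin p + sin q)\<^sup>2) / 2"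
          by (simp add: cos_diff power2_eq_square algebra_simps)
             (use sin_cos_squared_add3[of p] sin_cos_squared_add3[of q] in linarith)
        also have "\<dots> \<ge> 0" by simp
        finally show ?thesis by simp
      qed
      have "(LINT u|\<nu>. 1 - cos ((P - Q) * u)) \<le> (LINT u|\<nu>. 2 * (1 - cos (P * u)) + 2 * (1 - cos (Q * u)))"
      proof (rule integral_mono)
        show "1 - cos ((P - Q) * u) \<le> 2 * (1 - cos (P * u)) + 2 * (1 - cos (Q * u))" for u
          using cos_le[of "P * u" "Q * u"] by (simp only: left_diff_distrib)
      qed (intro Bochner_Integration.integrable_diff Bochner_Integration.integrable_add
            integrable_mult_right integrable_const expectation_cos)+
      also have "\<dots> = 2 * (1 - Re (char \<nu> P)) + 2 * (1 - Re (char \<nu> Q))"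
        using prob_space by (simp add: expectation_cos del: space_eq_univ)
      also have "(LINT u|\<nu>. 1 - cos ((P - Q) * u)) = 1 - Re (char \<nu> (P - Q))"
        using prob_space expectation_cos[of "P - Q"] by (simp del: space_eq_univ)
      finally have "1 - 8 * \<eta> \<le> Re (char \<nu> (P - Q))"
        using P Q by argo
      moreover have "Re (char \<nu> (P - Q)) = Re (char \<nu> y)"
      proof (cases "P \<ge> Q")
        case False
        then have "P - Q = - y" using v(2) by (simp add: P_def Q_def)
        then show ?thesis
          using expectation_cos(2)[of "P - Q"] expectation_cos(2)[of y] by simp
      qed (use v(2) in \<open>simp add: P_def Q_def\<close>)
      ultimately show ?thesis by simp
    qed
    then have "measure \<nu> {x. \<bar>x\<bar> \<ge> 2 / Y} \<le> 2 * (8 * \<eta>)"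
      by (rule tail_le_of_char_ge[OF Y(1)])
    then show False
      using Y(2) by (simp add: \<eta>_def)
  qed
  \<comment> \<open>The bounded oscillation on \<open>{a..b}\<close> moves to a neighbourhood of 0
    at the cost of one additivity defect, which is at most 2.\<close>
  have pos: "\<bar>Im (s n u)\<bar> \<le> Y + 2" if n: "n \<ge> max N N'" and u: "0 \<le> u" "u \<le> b - a" for n u
  proof -
    have "sqrt (Re (s n a)) \<le> 1" "sqrt (Re (s n u)) \<le> 1"
    proof -
      have "h \<le> d'" by (simp add: h_def)
      then have "\<bar>a\<bar> \<le> d'" "\<bar>u\<bar> \<le> d'"
        using u ab h by auto
      then show "sqrt (Re (s n a)) \<le> 1" "sqrt (Re (s n u)) \<le> 1"
        using n by (auto simp del: real_sqrt_le_1_iff intro!: d'(2))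
    qed
    then have "sqrt (Re (s n a)) * sqrt (Re (s n u)) \<le> 1 * 1"
      by (intro mult_mono) (auto simp: exponentD[OF s])
    then have "cmod (s n a + s n u - s n (a + u)) \<le> 2"
      using exponentD(5)[OF s, of n a u] by simp
    then have "\<bar>Im (s n a) + Im (s n u) - Im (s n (a + u))\<bar> \<le> 2"
      using abs_Im_le_cmod[of "s n a + s n u - s n (a + u)"] by simp
    moreover have "\<bar>Im (s n (a + u)) - Im (s n a)\<bar> < Y"
      using n u by (intro osc) auto
    ultimately show ?thesis by linarith
  qed
  show ?thesis
  proof (rule that[of "b - a" "max N N'" "Y + 2"])
    fix n u assume n: "n \<ge> max N N'" and u: "\<bar>u\<bar> \<le> b - a"
    show "\<bar>Im (s n u)\<bar> \<le> Y + 2"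
    proof (cases "u \<ge> 0")
      case False
      have "Im (s n u) = - Im (s n (- u))"
        using exponentD(4)[OF s, of n u] by simp
      then show ?thesis
        using pos[of n "- u"] n u False by simp
    qed (use pos n u in auto)
  qed (use ab in simp)
qed

text \<open>Boundedness of the imaginary parts near 0 becomes smallness by comparison with a large
  multiple of the argument, via \<open>exponent_multiple\<close>.\<close>

lemma equivanishing_if_laplace_converges: "equivanishing s"
  unfolding equivanishing_def
proof (intro allI impI)
  fix \<epsilon> :: real assume eps: "\<epsilon> > 0"
  obtain L \<tau> N where tau: "\<tau> > 0" and L: "\<And>n u. n \<ge> N \<Longrightarrow> \<bar>u\<bar> \<le> \<tau> \<Longrightarrow> \<bar>Im (s n u)\<bar> \<le> L"
    by (rule Im_locally_bounded) (rule that)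
  obtain d1 N1 where d1: "d1 > 0" "\<And>n u. n \<ge> N1 \<Longrightarrow> \<bar>u\<bar> \<le> d1 \<Longrightarrow> sqrt (Re (s n u)) \<le> 1"
    using Re_equivanishing[of 1] by auto
  \<comment> \<open>For \<open>q = sqrt (Re (s n u)) \<le> 1\<close> the real part is
    \<open>q * q \<le> q\<close>, and the imaginary part will be at most
    \<open>\<epsilon> / 2 + 2 * q\<close>; so \<open>q \<le> \<epsilon> / 6\<close>
    suffices.\<close>
  obtain d2 N2 where d2: "d2 > 0" "\<And>n u. n \<ge> N2 \<Longrightarrow> \<bar>u\<bar> \<le> d2 \<Longrightarrow> sqrt (Re (s n u)) \<le> min 1 (\<epsilon> / 6)"
  proof (rule Re_equivanishing[of "min 1 (\<epsilon> / 6)"])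
    show "0 < min 1 (\<epsilon> / 6)" using eps by simp
  qed (rule that)
  obtain m where m: "2 * L / \<epsilon> < real m" "m > 0"
  proof -
    obtain k where "2 * L / \<epsilon> < real k" using reals_Archimedean2 by blast
    then show ?thesis by (intro that[of "Suc k"]) auto
  qed
  define \<delta> where "\<delta> = min d2 (min (d1 / m) (\<tau> / m))"
  have bound: "cmod (s n u) \<le> \<epsilon>" if n: "n \<ge> max N (max N1 N2)" and u: "\<bar>u\<bar> \<le> \<delta>" for n u
  proof -
    define q where "q = sqrt (Re (s n u))"
    have u': "\<bar>u\<bar> \<le> d2" "real m * \<bar>u\<bar> \<le> d1" "real m * \<bar>u\<bar> \<le> \<tau>"
      using u m(2) by (simp_all add: \<delta>_def field_simps)
    have q: "0 \<le> q" "q \<le> 1" "q \<le> \<epsilon> / 6"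
      using d2(2)[of n u] n u' by (auto simp: q_def exponentD[OF s])
    have "sqrt (Re (s n (real i * u))) \<le> 1" if "i < m" for i
    proof (rule d1(2))
      have "real i * \<bar>u\<bar> \<le> real m * \<bar>u\<bar>"
        using that by (intro mult_right_mono) auto
      then show "\<bar>real i * u\<bar> \<le> d1"
        using u'(2) by (simp add: abs_mult)
    qed (use n in auto)
    then have "cmod (of_nat m * s n u - s n (real m * u)) \<le> real m * (2 * (1 * q))"
      unfolding q_def by (rule exponent_multiple[OF s])
    moreover have "\<bar>Im (of_nat m * s n u - s n (real m * u))\<bar> \<le> cmod (of_nat m * s n u - s n (real m * u))"
      by (rule abs_Im_le_cmod)
    moreover have "\<bar>Im (s n (real m * u))\<bar> \<le> L"
      using n u'(3) by (intro L) (auto simp: abs_mult)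
    ultimately have "\<bar>real m * Im (s n u)\<bar> \<le> L + real m * (2 * q)"
      by simp
    then have "real m * \<bar>Im (s n u)\<bar> \<le> real m * (\<epsilon> / 2 + 2 * q)"
      using m eps by (simp add: abs_mult field_simps)
    then have "\<bar>Im (s n u)\<bar> \<le> \<epsilon> / 2 + 2 * q"
      using m(2) by simp
    moreover have "\<bar>Re (s n u)\<bar> \<le> q"
    proof -
      have "Re (s n u) = q * q"
        by (simp add: q_def exponentD[OF s])
      also have "\<dots> \<le> q * 1"
        using q by (intro mult_left_mono) auto
      finally show ?thesis
        using exponentD(3)[OF s, of n u] by simp
    qed
    ultimately show ?thesis
      using cmod_le[of "s n u"] q by linarith
  qed
  have "\<delta> > 0"
    using d1 d2 tau m by (simp add: \<delta>_def)
  then show "\<exists>\<delta>>0. \<exists>N. \<forall>n\<ge>N. \<forall>u. \<bar>u\<bar> \<le> \<delta> \<longrightarrow> cmod (s n u) \<le> \<epsilon>"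
    using bound by blast
qed

theorem exponent_limit_of_laplace:
  obtains r l where "strict_mono r" "exponent l" "continuously_converges (\<lambda>n. s (r n)) l"
    "\<And>t. \<Phi> (l t) = f t"
proof -
  obtain r l where r: "strict_mono r" and l: "exponent l"
    and conv: "continuously_converges (\<lambda>n. s (r n)) l"
    by (rule exponents_convergent_subsequence[OF s equivanishing_if_laplace_converges])
  have "\<Phi> (l t) = f t" for t
  proof (rule LIMSEQ_unique)
    show "(\<lambda>n. \<Phi> (s (r n) t)) \<longlonglongrightarrow> \<Phi> (l t)"
      by (intro tendsto_laplace continuously_convergesD(2)[OF conv] exponentD(3) s l)
    show "(\<lambda>n. \<Phi> (s (r n) t)) \<longlonglongrightarrow> f t"
      using LIMSEQ_subseq_LIMSEQ[OF lim r, of t] by (simp add: o_def)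
  qed
  with r l conv that show ?thesis by blast
qed

end

end

section \<open>Difference equations with arbitrarily small steps\<close>

text \<open>Steps of size \<open>\<epsilon> n\<close> telescope from \<open>x\<close> to a point
  within one step of \<open>y\<close>. As the limit of \<open>\<beta>\<close> is the same for every
  admissible pair, \<open>\<mu>\<close> turns out to be an affine function of
  \<open>w\<close>.\<close>

lemma difference_quotient_limit:
  fixes \<mu> w :: "real \<Rightarrow> real" and \<epsilon> \<beta> :: "nat \<Rightarrow> real"
  assumes cont: "\<And>x. x \<in> {a<..<b} \<Longrightarrow> isCont \<mu> x" "\<And>x. isCont w x"
    and eps: "\<epsilon> \<longlonglongrightarrow> 0"
    and eq: "\<forall>\<^sub>F n in sequentially. \<epsilon> n \<noteq> 0 \<and>
      (\<forall>x. x \<in> {a<..<b} \<longrightarrow> x + \<epsilon> n \<in> {a<..<b} \<longrightarrow> \<mu> (x + \<epsilon> n) - \<mu> x = \<beta> n * (w (x + \<epsilon> n) - w x))"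
    and xy: "x \<in> {a<..<b}" "y \<in> {a<..<b}" "x < y" and w: "w x \<noteq> w y"
  shows "\<beta> \<longlonglongrightarrow> (\<mu> y - \<mu> x) / (w y - w x)"
proof -
  \<comment> \<open>The steps may have either sign; the chain always runs upwards, and negative
    steps are read backwards.\<close>
  define k where "k n = nat \<lfloor>(y - x) / \<bar>\<epsilon> n\<bar>\<rfloor>" for n
  define Y where "Y n = x + real (k n) * \<bar>\<epsilon> n\<bar>" for n
  have near: "y - \<bar>\<epsilon> n\<bar> \<le> Y n \<and> Y n \<le> y" if "\<epsilon> n \<noteq> 0" for n
  proof -
    have e: "\<bar>\<epsilon> n\<bar> > 0" using that by simp
    have "real (k n) = of_int \<lfloor>(y - x) / \<bar>\<epsilon> n\<bar>\<rfloor>"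
      using xy(3) by (simp add: k_def)
    then have "real (k n) \<le> (y - x) / \<bar>\<epsilon> n\<bar>" "(y - x) / \<bar>\<epsilon> n\<bar> \<le> real (k n) + 1"
      by linarith+
    then show ?thesis
      using e by (simp add: Y_def field_simps)
  qed
  have tele: "\<mu> (Y n) - \<mu> x = \<beta> n * (w (Y n) - w x)"
    if ne: "\<epsilon> n \<noteq> 0" and step: "\<And>v. v \<in> {a<..<b} \<Longrightarrow> v + \<epsilon> n \<in> {a<..<b} \<Longrightarrow>
      \<mu> (v + \<epsilon> n) - \<mu> v = \<beta> n * (w (v + \<epsilon> n) - w v)" for n
  proof -
    have "\<mu> (x + real j * \<bar>\<epsilon> n\<bar>) - \<mu> x = \<beta> n * (w (x + real j * \<bar>\<epsilon> n\<bar>) - w x)" if "j \<le> k n" for j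
      using that
    proof (induction j)
      case (Suc j)
      define p where "p = x + real j * \<bar>\<epsilon> n\<bar>"
      have succ: "x + real (Suc j) * \<bar>\<epsilon> n\<bar> = p + \<bar>\<epsilon> n\<bar>"
        by (simp add: p_def algebra_simps)
      have "real (Suc j) * \<bar>\<epsilon> n\<bar> \<le> real (k n) * \<bar>\<epsilon> n\<bar>"
        using Suc.prems by (intro mult_right_mono) auto
      then have "p + \<bar>\<epsilon> n\<bar> \<le> y"
        using near[OF ne] by (simp add: Y_def p_def algebra_simps)
      moreover have "x \<le> p"
        by (simp add: p_def)
      ultimately have p: "p \<in> {a<..<b}" "p + \<bar>\<epsilon> n\<bar> \<in> {a<..<b}"
        using xy by auto
      have "\<mu> (p + \<bar>\<epsilon> n\<bar>) - \<mu> p = \<beta> n * (w (p + \<bar>\<epsilon> n\<bar>) - w p)"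
      proof (cases "\<epsilon> n > 0")
        case True
        then show ?thesis using step[of p] p by simp
      next
        case False
        then have "\<mu> p - \<mu> (p + \<bar>\<epsilon> n\<bar>) = \<beta> n * (w p - w (p + \<bar>\<epsilon> n\<bar>))"
          using step[of "p + \<bar>\<epsilon> n\<bar>"] p by simp
        then show ?thesis by (simp add: algebra_simps)
      qed
      moreover have "\<mu> p - \<mu> x = \<beta> n * (w p - w x)"
        using Suc by (simp add: p_def)
      ultimately show ?case
        unfolding succ by (simp add: algebra_simps)
    qed simp
    then show ?thesis by (simp add: Y_def)
  qed
  have Y: "Y \<longlonglongrightarrow> y"
  proof (rule tendsto_sandwich)
    show "(\<lambda>n. y - \<bar>\<epsilon> n\<bar>) \<longlonglongrightarrow> y"
      using tendsto_diff[OF tendsto_const tendsto_rabs[OF eps], of y] by simp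
    show "\<forall>\<^sub>F n in sequentially. y - \<bar>\<epsilon> n\<bar> \<le> Y n" "\<forall>\<^sub>F n in sequentially. Y n \<le> y"
      using eq by (auto elim!: eventually_mono dest: near)
  qed simp
  have lim: "(\<lambda>n. (\<mu> (Y n) - \<mu> x) / (w (Y n) - w x)) \<longlonglongrightarrow> (\<mu> y - \<mu> x) / (w y - w x)"
    using w xy by (intro tendsto_intros isCont_tendsto_compose[OF _ Y] cont) auto
  have "(\<lambda>n. w (Y n)) \<longlonglongrightarrow> w y"
    by (intro isCont_tendsto_compose[OF _ Y] cont)
  then have "\<forall>\<^sub>F n in sequentially. w (Y n) \<noteq> w x"
    using w by (intro tendsto_imp_eventually_ne) auto
  then have "\<forall>\<^sub>F n in sequentially. (\<mu> (Y n) - \<mu> x) / (w (Y n) - w x) = \<beta> n"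
    using eq
  proof eventually_elim
    case (elim n)
    then have "\<mu> (Y n) - \<mu> x = \<beta> n * (w (Y n) - w x)"
      by (intro tele) auto
    with elim show ?case by simp
  qed
  then show ?thesis
    by (rule Lim_transform_eventually[OF lim])
qed

section \<open>Curves invariant under small rescalings\<close>

text \<open>In the variable \<open>x = ln t\<close>, the drift term \<open>t\<close> (or \<open>t * ln t\<close> if \<open>a = 1\<close>) divided by \<open>t powr a\<close>.\<close>
definition weight :: "real \<Rightarrow> real \<Rightarrow> real" where
  "weight a x = (if a = 1 then x else exp ((1 - a) * x))"

lemma isCont_weight: "isCont (weight a) x"
  unfolding weight_def by (cases "a = 1") (auto intro!: continuous_intros)

lemma weight_neq: "x < y \<Longrightarrow> weight a x \<noteq> weight a y"
  by (auto simp: weight_def)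

context nontrivial_mixing
begin

text \<open>To be applied to \<open>z x = \<sigma> (exp x)\<close> and \<open>\<epsilon> n = ln (\<kappa> n)\<close>, so that scalings become translations.\<close>
context
  fixes z :: "real \<Rightarrow> complex" and c \<epsilon> d :: "nat \<Rightarrow> real"
  assumes z_cont: "\<And>x. isCont z x"
    and Re_z: "\<And>x. 0 \<le> Re (z x)"
    and c: "c \<longlonglongrightarrow> 1" "\<And>n. c n > 0" "\<And>n. c n \<noteq> 1"
    and eps: "\<epsilon> \<longlonglongrightarrow> 0"
    and d: "d \<longlonglongrightarrow> 0"
    and invariant: "\<And>n x. \<Phi> (of_real (c n) * z (x + \<epsilon> n) + \<i> * of_real (d n * exp x)) = \<Phi> (z x)"
begin

definition moved :: "nat \<Rightarrow> real \<Rightarrow> complex" where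
  "moved n x = of_real (c n) * z (x + \<epsilon> n) + \<i> * of_real (d n * exp x)"

lemma Re_moved: "Re (moved n x) = c n * Re (z (x + \<epsilon> n))"
  and Im_moved: "Im (moved n x) = c n * Im (z (x + \<epsilon> n)) + d n * exp x"
  by (simp_all add: moved_def)

text \<open>Convergence is joint in index and point, because one index has to serve a whole
  neighbourhood in \<open>moved_locally_eq\<close>.\<close>

lemma moved_tendsto: "((\<lambda>(n, x). moved n x) \<longlongrightarrow> z y) (sequentially \<times>\<^sub>F nhds y)"
proof -
  have n: "((\<lambda>p. u (fst p)) \<longlongrightarrow> l) (sequentially \<times>\<^sub>F nhds y)" if "u \<longlonglongrightarrow> l" for u and l :: real
    by (rule filterlim_compose[OF that filterlim_fst])
  have x: "(snd \<longlongrightarrow> y) (sequentially \<times>\<^sub>F nhds y)"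
    by (rule filterlim_snd)
  have "((\<lambda>p. snd p + \<epsilon> (fst p)) \<longlongrightarrow> y + 0) (sequentially \<times>\<^sub>F nhds y)"
    by (intro tendsto_intros x n eps)
  then have "((\<lambda>p. z (snd p + \<epsilon> (fst p))) \<longlongrightarrow> z y) (sequentially \<times>\<^sub>F nhds y)"
    by (intro isCont_tendsto_compose[OF z_cont]) simp
  then have "((\<lambda>p. of_real (c (fst p)) * z (snd p + \<epsilon> (fst p)) + \<i> * of_real (d (fst p) * exp (snd p)))
      \<longlongrightarrow> of_real 1 * z y + \<i> * of_real (0 * exp y)) (sequentially \<times>\<^sub>F nhds y)"
    by (intro tendsto_intros x n c d)
  then show ?thesis
    by (simp add: moved_def case_prod_beta')
qed

text \<open>\<open>moved n x\<close> lies in the fibre of \<open>z x\<close> and tends to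
  \<open>z x\<close>, which is isolated in that fibre. The index depends on
  \<open>x\<close>.\<close>

lemma moved_eventually_eq:
  assumes "Re (z x) > 0"
  shows "\<forall>\<^sub>F n in sequentially. moved n x = z x"
proof -
  obtain r where r: "r > 0" "\<And>w. w \<in> ball (z x) r \<Longrightarrow> w \<noteq> z x \<Longrightarrow> \<Phi> w \<noteq> \<Phi> (z x)"
    using laplace_isolated[OF assms] by blast
  have "filterlim (\<lambda>n. (n, x)) (sequentially \<times>\<^sub>F nhds x) sequentially"
    by (intro filterlim_Pair filterlim_ident tendsto_const)
  from filterlim_compose[OF moved_tendsto this]
  have "(\<lambda>n. moved n x) \<longlonglongrightarrow> z x" by simp
  then have "\<forall>\<^sub>F n in sequentially. dist (moved n x) (z x) < r"
    using r(1) by (rule tendstoD)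
  then show ?thesis
  proof eventually_elim
    case (elim n)
    then show ?case
      using r(2)[of "moved n x"] invariant[of n x] by (auto simp: moved_def dist_commute)
  qed
qed

text \<open>Away from critical points local injectivity replaces isolation, and the index becomes
  uniform near \<open>x\<close>.\<close>

lemma moved_locally_eq:
  assumes "Re (z x) > 0" "deriv \<Phi> (z x) \<noteq> 0"
  obtains \<delta> where "\<delta> > 0" "\<And>y. \<bar>y - x\<bar> < \<delta> \<Longrightarrow> Re (z y) > 0"
    "\<forall>\<^sub>F n in sequentially. \<forall>y. \<bar>y - x\<bar> < \<delta> \<longrightarrow> moved n y = z y"
proof -
  obtain r where r: "r > 0" "inj_on \<Phi> (ball (z x) r)"
    using laplace_locally_injective[OF assms] by blast
  have "\<forall>\<^sub>F p in sequentially \<times>\<^sub>F nhds x. dist (case p of (n, y) \<Rightarrow> moved n y) (z x) < r"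
    using moved_tendsto r(1) by (rule tendstoD)
  then obtain P Q where P: "eventually P sequentially" and Q: "eventually Q (nhds x)"
    and PQ: "\<And>n y. P n \<Longrightarrow> Q y \<Longrightarrow> dist (moved n y) (z x) < r"
    unfolding eventually_prod_filter by fastforce
  have "\<forall>\<^sub>F y in nhds x. dist (z y) (z x) < r"
    using z_cont[of x] r(1) unfolding isCont_def tendsto_at_iff_tendsto_nhds by (rule tendstoD)
  moreover have "(z \<longlongrightarrow> z x) (nhds x)"
    using z_cont[of x] unfolding isCont_def tendsto_at_iff_tendsto_nhds .
  from order_tendstoD(1)[OF tendsto_Re[OF this] assms(1)]
  have "\<forall>\<^sub>F y in nhds x. 0 < Re (z y)" .
  ultimately have "\<forall>\<^sub>F y in nhds x. Q y \<and> dist (z y) (z x) < r \<and> 0 < Re (z y)"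
    using Q by eventually_elim auto
  then obtain \<delta> where delta: "\<delta> > 0" "\<And>y. \<bar>y - x\<bar> < \<delta> \<Longrightarrow> Q y \<and> dist (z y) (z x) < r \<and> 0 < Re (z y)"
    unfolding eventually_nhds_metric by (auto simp: dist_real_def)
  have "\<forall>\<^sub>F n in sequentially. \<forall>y. \<bar>y - x\<bar> < \<delta> \<longrightarrow> moved n y = z y"
    using P
  proof eventually_elim
    case (elim n)
    show ?case
    proof (intro allI impI)
      fix y assume y: "\<bar>y - x\<bar> < \<delta>"
      show "moved n y = z y"
        using inj_onD[OF r(2), of "moved n y" "z y"] invariant[of n y] delta(2)[OF y] PQ[OF elim, of y]
        by (auto simp: moved_def dist_commute)
    qed
  qed
  with delta show ?thesis
    using that by blast
qed

text \<open>At an interior point invariance would give \<open>c n * r = r\<close>, but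
  \<open>c n \<noteq> 1\<close>.\<close>

lemma Re_not_locally_constant:
  assumes uv: "u < v" and pos: "r > 0" and const: "\<And>y. u \<le> y \<Longrightarrow> y \<le> v \<Longrightarrow> Re (z y) = r"
  shows False
proof -
  define y where "y = (u + v) / 2"
  have y: "u < y" "y < v" using uv by (auto simp: y_def)
  have "\<forall>\<^sub>F n in sequentially. moved n y = z y"
    using y pos const by (intro moved_eventually_eq) auto
  moreover have "(\<lambda>n. y + \<epsilon> n) \<longlonglongrightarrow> y + 0"
    by (intro tendsto_intros eps)
  then have "\<forall>\<^sub>F n in sequentially. u < y + \<epsilon> n" "\<forall>\<^sub>F n in sequentially. y + \<epsilon> n < v"
    using y by (auto intro: order_tendstoD)
  ultimately have "\<forall>\<^sub>F n in sequentially. False"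
  proof eventually_elim
    case (elim n)
    have "Re (z (y + \<epsilon> n)) = r" "Re (z y) = r"
      using elim y by (auto intro: const)
    moreover have "c n * Re (z (y + \<epsilon> n)) = Re (z y)"
      using elim(1) Re_moved[of n y] by simp
    ultimately show False
      using c(3)[of n] pos by simp
  qed
  then show False by simp
qed

text \<open>The factor that turns an increment of \<open>weight a\<close> over a step
  \<open>\<epsilon> n\<close> into \<open>- d n * exp ((1 - a) * x)\<close>. Besides the given
  sequences it involves only \<open>a\<close>, so its limit is the same near every point.\<close>

definition drift :: "real \<Rightarrow> nat \<Rightarrow> real" where
  "drift a n = (if a = 1 then - d n / \<epsilon> n else - d n / (exp ((1 - a) * \<epsilon> n) - 1))"

text \<open>On a neighbourhood of a noncritical point of \<open>\<Phi>\<close> the functional equation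
  \<open>moved n = z\<close> holds for arbitrarily small steps \<open>\<epsilon> n\<close>; it determines the derivative of
  \<open>ln (Re z)\<close>, and then that of \<open>exp (- a x) * Im z\<close> relative to the weight.\<close>
lemma noncritical_form:
  assumes x: "Re (z x) > 0" "deriv \<Phi> (z x) \<noteq> 0"
  obtains a B \<delta> where "\<delta> > 0" "a \<noteq> 0" "(\<lambda>n. - ln (c n) / \<epsilon> n) \<longlonglongrightarrow> a" "drift a \<longlonglongrightarrow> B"
    "\<And>u v. \<bar>u - x\<bar> < \<delta> \<Longrightarrow> \<bar>v - x\<bar> < \<delta> \<Longrightarrow> ln (Re (z v)) - a * v = ln (Re (z u)) - a * u"
    "\<And>u v. \<bar>u - x\<bar> < \<delta> \<Longrightarrow> \<bar>v - x\<bar> < \<delta> \<Longrightarrow>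
      exp (- a * v) * Im (z v) - B * weight a v = exp (- a * u) * Im (z u) - B * weight a u"
proof -
  obtain \<delta> where delta: "\<delta> > 0" and pos: "\<And>y. \<bar>y - x\<bar> < \<delta> \<Longrightarrow> Re (z y) > 0"
    and ev: "\<forall>\<^sub>F n in sequentially. \<forall>y. \<bar>y - x\<bar> < \<delta> \<longrightarrow> moved n y = z y"
    using moved_locally_eq[OF x] by blast
  define I where "I = {x - \<delta><..<x + \<delta>}"
  have I: "y \<in> I \<longleftrightarrow> \<bar>y - x\<bar> < \<delta>" for y
    by (auto simp: I_def)
  have x_I: "x \<in> I" using delta by (simp add: I_def)
  \<comment> \<open>A step 0 would leave \<open>c n * Re (z x) = Re (z x)\<close> with
    \<open>c n \<noteq> 1\<close>.\<close>
  have eps0: "\<forall>\<^sub>F n in sequentially. \<epsilon> n \<noteq> 0"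
    using ev
  proof eventually_elim
    case (elim n)
    have "c n * Re (z (x + \<epsilon> n)) = Re (z x)"
      using elim delta Re_moved[of n x] by simp
    then show ?case
      using c(3)[of n] x(1) by auto
  qed
  have ln_step: "\<forall>\<^sub>F n in sequentially. \<epsilon> n \<noteq> 0 \<and>
      (\<forall>y. y \<in> I \<longrightarrow> y + \<epsilon> n \<in> I \<longrightarrow>
        ln (Re (z (y + \<epsilon> n))) - ln (Re (z y)) = - ln (c n) / \<epsilon> n * ((y + \<epsilon> n) - y))"
    using ev eps0
  proof eventually_elim
    case (elim n)
    have "ln (Re (z (y + \<epsilon> n))) - ln (Re (z y)) = - ln (c n)" if y: "y \<in> I" "y + \<epsilon> n \<in> I" for y
    proof -
      have "Re (z y) = c n * Re (z (y + \<epsilon> n))"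
        using elim y Re_moved[of n y] by (auto simp: I)
      then have "ln (Re (z y)) = ln (c n) + ln (Re (z (y + \<epsilon> n)))"
        using pos[of "y + \<epsilon> n"] y c(2)[of n] by (simp add: I ln_mult)
      then show ?thesis by simp
    qed
    with elim show ?case by simp
  qed
  have ln_cont: "isCont (\<lambda>y. ln (Re (z y))) y" if "y \<in> {x - \<delta><..<x + \<delta>}" for y
  proof -
    have "Re (z y) > 0" using that by (intro pos) auto
    then show ?thesis
      by (intro isCont_ln' isCont_Re z_cont) auto
  qed
  have ln_lim: "(\<lambda>n. - ln (c n) / \<epsilon> n) \<longlonglongrightarrow> (ln (Re (z v)) - ln (Re (z u))) / (v - u)"
    if "u \<in> I" "v \<in> I" "u < v" for u v
    by (rule difference_quotient_limit[where w = "\<lambda>x. x", OF ln_cont continuous_ident eps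
          ln_step[unfolded I_def] that[unfolded I_def]]) (use that in auto)
  define v0 where "v0 = x + \<delta> / 2"
  have v0: "v0 \<in> I" "x < v0" using delta by (auto simp: v0_def I_def)
  define a where "a = (ln (Re (z v0)) - ln (Re (z x))) / (v0 - x)"
  have a_lim: "(\<lambda>n. - ln (c n) / \<epsilon> n) \<longlonglongrightarrow> a"
    unfolding a_def using x_I v0 by (intro ln_lim)
  have form1_less: "ln (Re (z v)) - a * v = ln (Re (z u)) - a * u" if "u \<in> I" "v \<in> I" "u < v" for u v
    using LIMSEQ_unique[OF a_lim ln_lim[OF that]] that by (simp add: field_simps)
  have form1: "ln (Re (z v)) - a * v = ln (Re (z u)) - a * u" if "u \<in> I" "v \<in> I" for u v
    using form1_less[of u v] form1_less[of v u] that by (cases u v rule: linorder_cases) auto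
  have eps_I: "\<forall>\<^sub>F n in sequentially. x + \<epsilon> n \<in> I"
  proof -
    have "(\<lambda>n. x + \<epsilon> n) \<longlonglongrightarrow> x + 0"
      by (intro tendsto_intros eps)
    then show ?thesis
      using delta unfolding I_def by (intro topological_tendstoD) auto
  qed
  have c_exp: "\<forall>\<^sub>F n in sequentially. c n = exp (- a * \<epsilon> n)"
    using ln_step eps_I
  proof eventually_elim
    case (elim n)
    have "ln (Re (z (x + \<epsilon> n))) - ln (Re (z x)) = - ln (c n)"
      using elim x_I by simp
    moreover have "ln (Re (z (x + \<epsilon> n))) - ln (Re (z x)) = a * \<epsilon> n"
      using form1[OF x_I elim(2)] by (simp add: algebra_simps)
    ultimately have "ln (c n) = - a * \<epsilon> n" by simp
    then show ?case
      using c(2)[of n] by (metis exp_ln)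
  qed
  have a0: "a \<noteq> 0"
  proof
    assume "a = 0"
    then have "\<forall>\<^sub>F n in sequentially. False"
      using c_exp c(3) by simp
    then show False by simp
  qed
  \<comment> \<open>As \<open>c n = exp (- a * \<epsilon> n)\<close>, the factor
    \<open>exp (- a * y)\<close> absorbs the scaling and leaves a pure difference equation with the
    drift on the right.\<close>
  define \<mu> where "\<mu> y = exp (- a * y) * Im (z y)" for y
  have mu_step: "\<forall>\<^sub>F n in sequentially. \<epsilon> n \<noteq> 0 \<and>
      (\<forall>y. y \<in> I \<longrightarrow> y + \<epsilon> n \<in> I \<longrightarrow> \<mu> (y + \<epsilon> n) - \<mu> y = drift a n * (weight a (y + \<epsilon> n) - weight a y))"
    using ev eps0 c_exp
  proof eventually_elim
    case (elim n)
    have "\<mu> (y + \<epsilon> n) - \<mu> y = drift a n * (weight a (y + \<epsilon> n) - weight a y)" if y: "y \<in> I" for y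
    proof -
      have "Im (z y) = exp (- a * \<epsilon> n) * Im (z (y + \<epsilon> n)) + d n * exp y"
        using elim y Im_moved[of n y] by (auto simp: I)
      then have "\<mu> y = exp (- a * y) * exp (- a * \<epsilon> n) * Im (z (y + \<epsilon> n)) + d n * (exp (- a * y) * exp y)"
        by (simp add: \<mu>_def algebra_simps)
      also have "exp (- a * y) * exp (- a * \<epsilon> n) = exp (- a * (y + \<epsilon> n))"
        by (simp add: exp_add[symmetric] algebra_simps)
      also have "exp (- a * y) * exp y = exp ((1 - a) * y)"
        by (simp add: exp_add[symmetric] algebra_simps)
      finally have diff: "\<mu> (y + \<epsilon> n) - \<mu> y = - d n * exp ((1 - a) * y)"
        by (simp add: \<mu>_def)
      show ?thesis
      proof (cases "a = 1")
        case True
        then show ?thesis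
          using elim(2) unfolding diff by (simp add: drift_def weight_def)
      next
        case False
        have "exp ((1 - a) * (y + \<epsilon> n)) = exp ((1 - a) * y) * exp ((1 - a) * \<epsilon> n)"
          by (simp add: distrib_left exp_add)
        then have "weight a (y + \<epsilon> n) - weight a y = exp ((1 - a) * y) * (exp ((1 - a) * \<epsilon> n) - 1)"
          using False by (simp add: weight_def right_diff_distrib)
        moreover have "exp ((1 - a) * \<epsilon> n) - 1 \<noteq> 0"
          using False elim(2) by simp
        ultimately show ?thesis
          using False unfolding diff by (simp add: drift_def)
      qed
    qed
    with elim(2) show ?case by blast
  qed
  have mu_cont: "isCont \<mu> y" for y
    unfolding \<mu>_def by (intro continuous_intros isCont_Im z_cont)
  have mu_lim: "drift a \<longlonglongrightarrow> (\<mu> v - \<mu> u) / (weight a v - weight a u)"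
    if "u \<in> I" "v \<in> I" "u < v" for u v
    by (rule difference_quotient_limit[OF mu_cont isCont_weight eps mu_step[unfolded I_def]
          that[unfolded I_def] weight_neq[OF that(3)]])
  define B where "B = (\<mu> v0 - \<mu> x) / (weight a v0 - weight a x)"
  have B_lim: "drift a \<longlonglongrightarrow> B"
    unfolding B_def using x_I v0 by (intro mu_lim)
  have form2_less: "\<mu> v - B * weight a v = \<mu> u - B * weight a u" if "u \<in> I" "v \<in> I" "u < v" for u v
    using LIMSEQ_unique[OF B_lim mu_lim[OF that]] weight_neq[OF that(3), of a]
    by (simp add: field_simps)
  have form2: "\<mu> v - B * weight a v = \<mu> u - B * weight a u" if "u \<in> I" "v \<in> I" for u v
    using form2_less[of u v] form2_less[of v u] that by (cases u v rule: linorder_cases) auto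
  show ?thesis
    by (rule that[OF delta a0 a_lim B_lim form1[unfolded I] form2[unfolded I \<mu>_def]])
qed

text \<open>The two expressions are the constants of motion of the curves in
  \<open>curve_form\<close>; local constancy is the form that suits a connectedness
  argument.\<close>

definition of_form :: "real \<Rightarrow> real \<Rightarrow> real \<Rightarrow> bool" where
  "of_form a B x \<longleftrightarrow> (\<exists>\<delta>>0. \<forall>u. \<bar>u - x\<bar> < \<delta> \<longrightarrow> Re (z u) > 0 \<and>
    ln (Re (z u)) - a * u = ln (Re (z x)) - a * x \<and>
    exp (- a * u) * Im (z u) - B * weight a u = exp (- a * x) * Im (z x) - B * weight a x)"

text \<open>Critical points are isolated and \<open>z\<close> cannot rest at one, because its real
  part is not locally constant.\<close>

lemma exists_noncritical:
  assumes "Re (z x) > 0"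
  obtains y where "Re (z y) > 0" "deriv \<Phi> (z y) \<noteq> 0"
proof -
  obtain r where r: "r > 0" "ball (z x) r \<subseteq> {s. Re s > 0}"
    "\<And>w. w \<in> ball (z x) r \<Longrightarrow> w \<noteq> z x \<Longrightarrow> deriv \<Phi> w \<noteq> 0"
    using laplace_critical_isolated[OF assms] by blast
  obtain \<delta> where delta: "\<delta> > 0" "\<And>y. \<bar>y - x\<bar> < \<delta> \<Longrightarrow> z y \<in> ball (z x) r"
    using z_cont[of x] r(1) unfolding continuous_at_eps_delta
    by (metis dist_commute dist_real_def mem_ball)
  obtain y where y: "\<bar>y - x\<bar> < \<delta>" "z y \<noteq> z x"
  proof (rule ccontr)
    assume "\<not> thesis"
    then have eq: "z y = z x" if "\<bar>y - x\<bar> < \<delta>" for y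
      using \<open>\<And>y. \<bar>y - x\<bar> < \<delta> \<Longrightarrow> z y \<noteq> z x \<Longrightarrow> thesis\<close> that by blast
    have "Re (z y) = Re (z x)" if "x \<le> y" "y \<le> x + \<delta> / 2" for y
      using eq[of y] that delta(1) by simp
    moreover have "x < x + \<delta> / 2"
      using delta(1) by simp
    ultimately show False
      by (intro Re_not_locally_constant[of x "x + \<delta> / 2" "Re (z x)"] assms)
  qed
  then show ?thesis
    using r(2,3) delta(2)[OF y(1)] by (intro that[of y]) auto
qed

text \<open>Near a critical point \<open>x\<close>, the curve \<open>z\<close> cannot return to the value \<open>z x\<close>: between two visits
  \<open>Re z\<close> would have an extremum at a noncritical point, where it is strictly monotone.\<close>
lemma of_form_everywhere:
  assumes a: "a \<noteq> 0"
    and form: "\<And>x. Re (z x) > 0 \<Longrightarrow> deriv \<Phi> (z x) \<noteq> 0 \<Longrightarrow> of_form a B x"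
    and x: "Re (z x) > 0"
  shows "of_form a B x"
proof -
  obtain r where r: "r > 0" "ball (z x) r \<subseteq> {s. Re s > 0}"
    "\<And>w. w \<in> ball (z x) r \<Longrightarrow> w \<noteq> z x \<Longrightarrow> deriv \<Phi> w \<noteq> 0"
    using laplace_critical_isolated[OF x] by blast
  obtain \<delta> where delta: "\<delta> > 0" "\<And>y. \<bar>y - x\<bar> < \<delta> \<Longrightarrow> z y \<in> ball (z x) r"
    using z_cont[of x] r(1) unfolding continuous_at_eps_delta
    by (metis dist_commute dist_real_def mem_ball)
  have pos: "Re (z y) > 0" if "\<bar>y - x\<bar> < \<delta>" for y
    using delta(2)[OF that] r(2) by auto
  have off: "of_form a B y" if "\<bar>y - x\<bar> < \<delta>" "z y \<noteq> z x" for y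
    using that by (intro form pos r(3) delta(2)) auto
  \<comment> \<open>Near \<open>y\<close>, \<open>ln (Re (z w))\<close> is affine in
    \<open>w\<close> with slope \<open>a \<noteq> 0\<close>, so the values before and after
    \<open>y\<close> lie on opposite sides of \<open>Re (z y)\<close>.\<close>
  have no_extremum: False
    if y: "u < y" "y < v" "of_form a B y"
      and ext: "(\<forall>w. u \<le> w \<longrightarrow> w \<le> v \<longrightarrow> Re (z w) \<le> Re (z y)) \<or> (\<forall>w. u \<le> w \<longrightarrow> w \<le> v \<longrightarrow> Re (z y) \<le> Re (z w))"
    for u v y
  proof -
    obtain e where e: "e > 0" "\<And>w. \<bar>w - y\<bar> < e \<Longrightarrow> Re (z w) > 0 \<and> ln (Re (z w)) - a * w = ln (Re (z y)) - a * y"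
      using y(3) unfolding of_form_def by blast
    define h where "h = min (e / 2) (min (y - u) (v - y))"
    have h: "h > 0" "h < e" "u \<le> y - h" "y + h \<le> v"
      using y e(1) by (auto simp: h_def)
    have l: "ln (Re (z (y + h))) = ln (Re (z y)) + a * h" "ln (Re (z (y - h))) = ln (Re (z y)) - a * h"
      using e(2)[of "y + h"] e(2)[of "y - h"] h by (auto simp: algebra_simps)
    have p: "Re (z y) > 0" "Re (z (y + h)) > 0" "Re (z (y - h)) > 0"
      using e(2)[of y] e(2)[of "y + h"] e(2)[of "y - h"] h by auto
    have "a * h \<noteq> 0" using a h by simp
    then have "Re (z (y + h)) < Re (z y) \<and> Re (z y) < Re (z (y - h))
      \<or> Re (z (y + h)) > Re (z y) \<and> Re (z y) > Re (z (y - h))"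
      using l p by (metis diff_add_cancel less_add_same_cancel1 linorder_less_linear ln_less_cancel_iff add_less_same_cancel1)
    moreover have "u \<le> y - h" "y - h \<le> v" "u \<le> y + h" "y + h \<le> v"
      using h y by auto
    ultimately show False
      using ext by (metis not_less)
  qed
  have no_return: False
    if uv: "\<bar>u - x\<bar> < \<delta>" "\<bar>v - x\<bar> < \<delta>" "u < v" and zuv: "z u = z x" "z v = z x" for u v
  proof -
    have cont: "continuous_on {u..v} (\<lambda>y. Re (z y))"
      by (intro continuous_at_imp_continuous_on ballI isCont_Re z_cont)
    have in_nbhd: "\<bar>y - x\<bar> < \<delta>" if "u \<le> y" "y \<le> v" for y
      using uv that by auto
    obtain p where p: "u \<le> p" "p \<le> v" "\<And>w. u \<le> w \<Longrightarrow> w \<le> v \<Longrightarrow> Re (z w) \<le> Re (z p)"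
      using continuous_attains_sup[OF _ _ cont] uv(3) by auto
    obtain q where q: "u \<le> q" "q \<le> v" "\<And>w. u \<le> w \<Longrightarrow> w \<le> v \<Longrightarrow> Re (z q) \<le> Re (z w)"
      using continuous_attains_inf[OF _ _ cont] uv(3) by auto
    consider "Re (z p) \<noteq> Re (z x)" | "Re (z q) \<noteq> Re (z x)" | "Re (z p) = Re (z x)" "Re (z q) = Re (z x)"
      by blast
    then show False
    proof cases
      case 1
      then have "p \<noteq> u" "p \<noteq> v" "z p \<noteq> z x" using zuv by auto
      then show False
        using p by (intro no_extremum[of u p v] off in_nbhd) auto
    next
      case 2
      then have "q \<noteq> u" "q \<noteq> v" "z q \<noteq> z x" using zuv by auto
      then show False
        using q by (intro no_extremum[of u q v] off in_nbhd) auto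
    next
      case 3
      then have "Re (z w) = Re (z x)" if "u \<le> w" "w \<le> v" for w
        using p(3)[OF that] q(3)[OF that] by simp
      then show False
        by (rule Re_not_locally_constant[OF uv(3) x])
    qed
  qed
  \<comment> \<open>Both functions are locally constant off the single visit to \<open>z x\<close>,
    namely at \<open>x\<close>; continuity joins the constants on the two sides.\<close>
  define P where "P y = ln (Re (z y)) - a * y" for y
  define Q where "Q y = exp (- a * y) * Im (z y) - B * weight a y" for y
  have cont: "isCont P y \<and> isCont Q y" if "\<bar>y - x\<bar> < \<delta>" for y
    unfolding P_def Q_def using pos[OF that]
    by (intro conjI continuous_intros isCont_ln' isCont_Re isCont_Im z_cont isCont_weight) auto
  have deriv: "(P has_real_derivative 0) (at y) \<and> (Q has_real_derivative 0) (at y)"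
    if y: "\<bar>y - x\<bar> < \<delta>" "z y \<noteq> z x" for y
  proof -
    obtain e where e: "e > 0" "\<And>u. \<bar>u - y\<bar> < e \<Longrightarrow> P u = P y \<and> Q u = Q y"
      using off[OF y] unfolding of_form_def P_def Q_def by blast
    have ev: "\<forall>\<^sub>F u in nhds y. P u = P y" "\<forall>\<^sub>F u in nhds y. Q u = Q y"
      unfolding eventually_nhds_metric dist_real_def using e by blast+
    show ?thesis
      using DERIV_cong_ev[OF refl ev(1) refl, of 0] DERIV_cong_ev[OF refl ev(2) refl, of 0] by simp
  qed
  have const: "P v = P u \<and> Q v = Q u"
    if uv: "\<bar>u - x\<bar> < \<delta>" "\<bar>v - x\<bar> < \<delta>" "u < v" and ne: "\<And>y. u < y \<Longrightarrow> y < v \<Longrightarrow> z y \<noteq> z x" for u v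
  proof -
    have nb: "\<bar>y - x\<bar> < \<delta>" if "u \<le> y" "y \<le> v" for y
      using uv that by auto
    show ?thesis
      using deriv ne nb cont uv(3)
      by (intro conjI DERIV_isconst_end[of u v] continuous_at_imp_continuous_on) auto
  qed
  have "P u = P x \<and> Q u = Q x" if u: "\<bar>u - x\<bar> < \<delta>" for u
  proof (cases u x rule: linorder_cases)
    case less
    then have "z y \<noteq> z x" if "u < y" "y < x" for y
      using no_return[of y x] that u delta(1) by auto
    then show ?thesis
      using const[of u x] u less delta(1) by auto
  next
    case greater
    then have "z y \<noteq> z x" if "x < y" "y < u" for y
      using no_return[of x y] that u delta(1) by auto
    then show ?thesis
      using const[of x u] u greater delta(1) by auto
  qed simp
  then show ?thesis
    using delta(1) pos unfolding of_form_def P_def Q_def by blast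
qed

text \<open>The limits defining \<open>a\<close> and \<open>B\<close> involve only the given
  sequences, so every noncritical point yields the same pair. The set where the formulas hold is
  then open and closed; closedness also prevents the real part from reaching 0.\<close>

theorem curve_form:
  assumes "Re (z x) > 0"
  obtains a B K A where "a \<noteq> 0" "\<And>x. Re (z x) = exp (K + a * x)"
    "\<And>x. Im (z x) = exp (a * x) * (A + B * weight a x)"
proof -
  obtain y where y: "Re (z y) > 0" "deriv \<Phi> (z y) \<noteq> 0"
    using exists_noncritical[OF assms] by blast
  obtain a B where a: "a \<noteq> 0" "(\<lambda>n. - ln (c n) / \<epsilon> n) \<longlonglongrightarrow> a" and B: "drift a \<longlonglongrightarrow> B"
    using noncritical_form[OF y] by metis
  have "of_form a B w" if w: "Re (z w) > 0" "deriv \<Phi> (z w) \<noteq> 0" for w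
  proof -
    obtain a' B' e where e: "e > 0" and "a' \<noteq> 0" and a': "(\<lambda>n. - ln (c n) / \<epsilon> n) \<longlonglongrightarrow> a'" and B': "drift a' \<longlonglongrightarrow> B'"
      and form: "\<And>u v. \<bar>u - w\<bar> < e \<Longrightarrow> \<bar>v - w\<bar> < e \<Longrightarrow> ln (Re (z v)) - a' * v = ln (Re (z u)) - a' * u"
        "\<And>u v. \<bar>u - w\<bar> < e \<Longrightarrow> \<bar>v - w\<bar> < e \<Longrightarrow>
          exp (- a' * v) * Im (z v) - B' * weight a' v = exp (- a' * u) * Im (z u) - B' * weight a' u"
      by (rule noncritical_form[OF w]) (rule that)
    have aa: "a' = a" using a(2) a' by (rule LIMSEQ_unique[rotated])
    then have BB: "B' = B" using B B' LIMSEQ_unique by blast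
    obtain e' where e': "e' > 0" "\<And>u. \<bar>u - w\<bar> < e' \<Longrightarrow> Re (z u) > 0"
      "\<forall>\<^sub>F n in sequentially. \<forall>y. \<bar>y - w\<bar> < e' \<longrightarrow> moved n y = z y"
      by (rule moved_locally_eq[OF w]) (rule that)
    define h where "h = min e e'"
    have h: "h > 0" "h \<le> e" "h \<le> e'"
      using e e'(1) by (auto simp: h_def)
    have "Re (z u) > 0 \<and> ln (Re (z u)) - a * u = ln (Re (z w)) - a * w \<and>
        exp (- a * u) * Im (z u) - B * weight a u = exp (- a * w) * Im (z w) - B * weight a w"
      if "\<bar>u - w\<bar> < h" for u
      using form[of w u] e'(2)[of u] that h unfolding aa BB by simp
    then show ?thesis
      unfolding of_form_def using h(1) by blast
  qed
  then have form: "of_form a B w" if "Re (z w) > 0" for w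
    using of_form_everywhere[OF a(1)] that by blast
  define K where "K = ln (Re (z y)) - a * y"
  define A where "A = exp (- a * y) * Im (z y) - B * weight a y"
  define V where "V = {w. Re (z w) = exp (K + a * w) \<and> Im (z w) = exp (a * w) * (A + B * weight a w)}"
  have "closed V"
    unfolding V_def
    by (intro closed_Collect_conj closed_Collect_eq continuous_at_imp_continuous_on ballI
        continuous_intros isCont_Re isCont_Im z_cont isCont_weight)
  moreover have "open V"
    unfolding open_dist
  proof
    fix w assume w: "w \<in> V"
    then have pos: "Re (z w) > 0" by (simp add: V_def)
    obtain e where e: "e > 0" "\<And>u. \<bar>u - w\<bar> < e \<Longrightarrow> Re (z u) > 0 \<and>
        ln (Re (z u)) - a * u = ln (Re (z w)) - a * w \<and>
        exp (- a * u) * Im (z u) - B * weight a u = exp (- a * w) * Im (z w) - B * weight a w"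
      using form[OF pos] unfolding of_form_def by blast
    have wK: "ln (Re (z w)) - a * w = K" and wA: "exp (- a * w) * Im (z w) - B * weight a w = A"
      using w by (simp_all add: V_def mult.assoc[symmetric] exp_add[symmetric])
    have "u \<in> V" if "\<bar>u - w\<bar> < e" for u
    proof -
      have u: "Re (z u) > 0" "ln (Re (z u)) = K + a * u" "exp (- a * u) * Im (z u) = A + B * weight a u"
        using e(2)[OF that] wK wA by auto
      have "Re (z u) = exp (K + a * u)"
        using u(1,2) by (metis exp_ln)
      moreover have "Im (z u) = exp (a * u) * (exp (- a * u) * Im (z u))"
        by (simp add: mult.assoc[symmetric] exp_add[symmetric])
      ultimately show ?thesis
        unfolding V_def u(3) by blast
    qed
    then show "\<exists>e>0. \<forall>u. dist u w < e \<longrightarrow> u \<in> V"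
      using e(1) by (auto simp: dist_real_def)
  qed
  moreover have "y \<in> V"
    using y(1) by (simp add: V_def K_def A_def mult.assoc[symmetric] exp_add[symmetric])
  ultimately have "V = UNIV"
    using clopen by auto
  then have "Re (z x) = exp (K + a * x)" "Im (z x) = exp (a * x) * (A + B * weight a x)" for x
    by (auto simp: V_def set_eq_iff)
  then show ?thesis
    by (rule that[OF a(1)])
qed

end

end

section \<open>Limits of normalized sums\<close>

definition summand_exponent :: "(real \<Rightarrow> complex) \<Rightarrow> (nat \<Rightarrow> real) \<Rightarrow> (nat \<Rightarrow> real) \<Rightarrow> nat \<Rightarrow> real \<Rightarrow> complex" where
  "summand_exponent g a b n t = of_nat n * (1 - g (t / a n) * iexp (- (t * b n)))"

lemma char_function_normed:
  "char_function g \<Longrightarrow> char_function (\<lambda>t. g (t / a n) * iexp (- (t * b n)))"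
  using char_function_affine[of g "1 / a n" "- b n"] by simp

lemma exponent_summand: "char_function g \<Longrightarrow> exponent (summand_exponent g a b n)"
  using exponent_one_minus_char_function[OF char_function_normed, of g "real n" a n b]
  unfolding summand_exponent_def by simp

section \<open>Convergence of types\<close>

text \<open>Compactness of the half-line with infinity added, taken from \<open>{0..1}\<close> by
  \<open>x / (1 + x)\<close>; an infinite limit appears as limit 0 of the reciprocals.\<close>

lemma positive_sequence_subseq:
  fixes \<kappa> :: "nat \<Rightarrow> real"
  assumes "\<And>n. \<kappa> n > 0"
  obtains r k where "strict_mono (r :: nat \<Rightarrow> nat)" "0 \<le> k"
    "(\<lambda>n. \<kappa> (r n)) \<longlonglongrightarrow> k \<or> (\<lambda>n. 1 / \<kappa> (r n)) \<longlonglongrightarrow> k"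
proof -
  define x where "x n = \<kappa> n / (1 + \<kappa> n)" for n
  have x: "x n \<in> {0..1}" for n
    using assms[of n] by (simp add: x_def field_simps)
  obtain l r where l: "l \<in> {0..1}" and r: "strict_mono r" and lim: "(x \<circ> r) \<longlonglongrightarrow> l"
    using compact_Icc[of 0 "1 :: real"] x unfolding compact_def by metis
  have lim: "(\<lambda>n. x (r n)) \<longlonglongrightarrow> l"
    using lim by (simp add: o_def)
  have inv: "x (r n) / (1 - x (r n)) = \<kappa> (r n)" "(1 - x (r n)) / x (r n) = 1 / \<kappa> (r n)" for n
  proof -
    have p: "\<kappa> (r n) > 0" by (rule assms)
    then have "1 - x (r n) = 1 / (1 + \<kappa> (r n))"
      by (simp add: x_def field_simps)
    with p show "x (r n) / (1 - x (r n)) = \<kappa> (r n)" "(1 - x (r n)) / x (r n) = 1 / \<kappa> (r n)"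
      by (simp_all add: x_def)
  qed
  show ?thesis
  proof (cases "l = 1")
    case False
    have "(\<lambda>n. x (r n) / (1 - x (r n))) \<longlonglongrightarrow> l / (1 - l)"
      using False by (intro tendsto_intros lim) auto
    then show ?thesis
      using l r unfolding inv by (intro that[of r "l / (1 - l)"]) auto
  next
    case True
    have "(\<lambda>n. (1 - x (r n)) / x (r n)) \<longlonglongrightarrow> (1 - l) / l"
      using True by (intro tendsto_intros lim) auto
    then show ?thesis
      using True r unfolding inv by (intro that[of r 0]) auto
  qed
qed

text \<open>The factor \<open>iexp (t * \<beta> j)\<close> relating two normalizations of the same characteristic
  function contributes the compound Poisson exponents \<open>D j\<close> of point masses; their limit is additive.\<close>
lemma summand_exponent_types:
  fixes m m' :: "nat \<Rightarrow> nat"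
  assumes a: "\<And>n. a n > 0"
    and m: "filterlim m at_top sequentially" and m': "filterlim m' at_top sequentially"
    and s: "exponent s" and s': "exponent s'"
    and conv: "continuously_converges (\<lambda>j. summand_exponent g a b (m j)) s"
    and conv': "continuously_converges (\<lambda>j. summand_exponent g a b (m' j)) s'"
    and ratio: "(\<lambda>j. real (m' j) / real (m j)) \<longlonglongrightarrow> l"
    and kap: "(\<lambda>j. a (m j) / a (m' j)) \<longlonglongrightarrow> \<kappa>"
  obtains d where "\<And>t. s' t = of_real l * s (\<kappa> * t) + \<i> * of_real (d * t)"
proof -
  define k where "k j = a (m j) / a (m' j)" for j
  define \<beta> where "\<beta> j = k j * b (m j) - b (m' j)" for j
  define E where "E j t = iexp (t * \<beta> j)" for j t
  define S where "S j t = summand_exponent g a b (m j) (k j * t)" for j t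
  define S' where "S' j = summand_exponent g a b (m' j)" for j
  define D where "D j t = of_nat (m' j) * (1 - E j t)" for j t
  have S_lim: "(\<lambda>j. S j t) \<longlonglongrightarrow> s (\<kappa> * t)" for t
    unfolding S_def k_def by (intro continuously_convergesD(1)[OF conv] tendsto_intros kap)
  have S'_lim: "(\<lambda>j. S' j t) \<longlonglongrightarrow> s' t" for t
    unfolding S'_def by (rule continuously_convergesD(2)[OF conv'])
  have m_pos: "\<forall>\<^sub>F j in sequentially. 0 < m j" "\<forall>\<^sub>F j in sequentially. 0 < m' j"
    by (rule eventually_compose_filterlim[OF eventually_gt_at_top m])
       (rule eventually_compose_filterlim[OF eventually_gt_at_top m'])
  have inv_lim: "(\<lambda>j. 1 / complex_of_nat (u j)) \<longlonglongrightarrow> 0" if "filterlim u at_top sequentially" for u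
    by (rule filterlim_compose[OF lim_1_over_n that])
  have vanish: "(\<lambda>j. S j t / of_nat (m j)) \<longlonglongrightarrow> 0" "(\<lambda>j. S' j t / of_nat (m' j)) \<longlonglongrightarrow> 0" for t
    using tendsto_mult[OF S_lim inv_lim[OF m], of t] tendsto_mult[OF S'_lim inv_lim[OF m'], of t] by simp_all
  \<comment> \<open>At \<open>k j * t\<close> the normalization along \<open>m\<close> evaluates
    \<open>g\<close> at the same point as the one along \<open>m'\<close> does at \<open>t\<close>;
    they differ only by the shift factor \<open>E j t\<close>.\<close>
  have rel: "1 - S' j t / of_nat (m' j) = (1 - S j t / of_nat (m j)) * E j t"
    if "0 < m j" "0 < m' j" for j t
  proof -
    have "k j * t / a (m j) = t / a (m' j)"
      using a[of "m j"] by (simp add: k_def)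
    then have "1 - S j t / of_nat (m j) = g (t / a (m' j)) * iexp (- (k j * t * b (m j)))"
      using that by (simp add: S_def summand_exponent_def)
    moreover have "1 - S' j t / of_nat (m' j) = g (t / a (m' j)) * iexp (- (t * b (m' j)))"
      using that by (simp add: S'_def summand_exponent_def)
    moreover have "iexp (- (k j * t * b (m j))) * E j t = iexp (- (t * b (m' j)))"
      by (simp add: E_def \<beta>_def exp_add[symmetric] algebra_simps)
    ultimately show ?thesis
      by (simp add: mult.assoc)
  qed
  have E_lim: "(\<lambda>j. E j t) \<longlonglongrightarrow> 1" for t
  proof -
    have lim1: "(\<lambda>j. (1 - S' j t / of_nat (m' j)) / (1 - S j t / of_nat (m j))) \<longlonglongrightarrow> (1 - 0) / (1 - 0)"
      by (intro tendsto_intros vanish) auto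
    have "(\<lambda>j. 1 - S j t / of_nat (m j)) \<longlonglongrightarrow> 1 - 0"
      by (intro tendsto_intros vanish)
    then have "\<forall>\<^sub>F j in sequentially. 1 - S j t / of_nat (m j) \<noteq> 0"
      by (rule tendsto_imp_eventually_ne) simp
    then have "\<forall>\<^sub>F j in sequentially. (1 - S' j t / of_nat (m' j)) / (1 - S j t / of_nat (m j)) = E j t"
      using m_pos by eventually_elim (simp add: rel)
    from Lim_transform_eventually[OF lim1 this] show ?thesis by simp
  qed
  define D' where "D' t = s' t - of_real l * s (\<kappa> * t)" for t
  have D_lim: "(\<lambda>j. D j t) \<longlonglongrightarrow> D' t" for t
  proof -
    have lim1: "(\<lambda>j. S' j t - of_real (real (m' j) / real (m j)) * S j t * E j t) \<longlonglongrightarrow> s' t - of_real l * s (\<kappa> * t) * 1"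
      by (intro tendsto_intros S_lim S'_lim E_lim ratio)
    have "\<forall>\<^sub>F j in sequentially. S' j t - of_real (real (m' j) / real (m j)) * S j t * E j t = D j t"
      using m_pos
    proof eventually_elim
      case (elim j)
      have "S' j t = of_nat (m' j) * (1 - (1 - S j t / of_nat (m j)) * E j t)"
        unfolding rel[OF elim, symmetric] using elim by simp
      then show ?case
        by (simp add: D_def algebra_simps)
    qed
    from Lim_transform_eventually[OF lim1 this] show ?thesis
      by (simp add: D'_def)
  qed
  have "D' (t + u) = D' t + D' u" for t u
  proof (rule LIMSEQ_unique[OF D_lim])
    \<comment> \<open>Expanding \<open>1 - E j t * E j u\<close> leaves a cross term that vanishes
      along with \<open>1 - E j u\<close>.\<close>
    have "(\<lambda>j. D j t + D j u - D j t * (1 - E j u)) \<longlonglongrightarrow> D' t + D' u - D' t * (1 - 1)"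
      by (intro tendsto_intros D_lim E_lim)
    moreover have "D j t + D j u - D j t * (1 - E j u) = D j (t + u)" for j
    proof -
      have "E j (t + u) = E j t * E j u"
        by (simp add: E_def exp_add[symmetric] algebra_simps)
      then show ?thesis
        by (simp add: D_def algebra_simps)
    qed
    ultimately show "(\<lambda>j. D j (t + u)) \<longlonglongrightarrow> D' t + D' u" by simp
  qed
  moreover have "isCont D' t" for t
  proof -
    have "isCont (\<lambda>t. s (\<kappa> * t)) t"
      by (rule isCont_o2[where g = s]) (auto intro!: continuous_intros exponentD[OF s])
    then show ?thesis
      unfolding D'_def by (intro continuous_intros exponentD[OF s']) auto
  qed
  ultimately have lin: "D' t = of_real t * D' 1" for t
    by (intro continuous_additive_linear)
  have "Re (D' 1) = 0"
  proof (rule LIMSEQ_unique[OF tendsto_Re[OF D_lim]])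
    \<comment> \<open>Since \<open>cmod (E j 1) = 1\<close>, \<open>Re (1 - E j 1)\<close> is half
      the square of \<open>cmod (1 - E j 1)\<close>; being of second order, the real part disappears
      in the limit.\<close>
    have "(\<lambda>j. cmod (D j 1) * cmod (1 - E j 1) / 2) \<longlonglongrightarrow> cmod (D' 1) * cmod (1 - 1) / 2"
      by (intro tendsto_intros D_lim E_lim) auto
    moreover have "cmod (D j 1) * cmod (1 - E j 1) / 2 = Re (D j 1)" for j
    proof -
      have "(cmod (1 - E j 1))\<^sup>2 = 2 * Re (1 - E j 1)"
      proof -
        have "(Re (E j 1))\<^sup>2 + (Im (E j 1))\<^sup>2 = 1"
          by (simp add: E_def cmod_power2[symmetric])
        then show ?thesis
          unfolding cmod_power2 by (simp add: power2_eq_square algebra_simps)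
      qed
      then show ?thesis
        by (simp add: D_def norm_mult power2_eq_square)
    qed
    ultimately show "(\<lambda>j. Re (D j 1)) \<longlonglongrightarrow> 0" by simp
  qed
  then have D1: "D' 1 = \<i> * of_real (Im (D' 1))"
    by (simp add: complex_eq_iff)
  have "s' t = of_real l * s (\<kappa> * t) + \<i> * of_real (Im (D' 1) * t)" for t
  proof -
    have "s' t = of_real l * s (\<kappa> * t) + D' t"
      by (simp add: D'_def)
    also have "D' t = of_real t * (\<i> * of_real (Im (D' 1)))"
      using lin[of t] D1 by metis
    finally show ?thesis
      by (simp add: algebra_simps)
  qed
  then show ?thesis by (rule that)
qed

text \<open>Along a subsequence the scale ratios or their reciprocals converge; in the second case
  the roles of \<open>s\<close> and \<open>s'\<close> are exchanged. A limit 0 would make a real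
  part vanish identically.\<close>

lemma summand_exponent_types_nondegenerate:
  fixes m m' :: "nat \<Rightarrow> nat"
  assumes a: "\<And>n. a n > 0"
    and m: "filterlim m at_top sequentially" and m': "filterlim m' at_top sequentially"
    and s: "exponent s" "Re (s t0) \<noteq> 0" and s': "exponent s'" "Re (s' t0') \<noteq> 0"
    and conv: "continuously_converges (\<lambda>j. summand_exponent g a b (m j)) s"
    and conv': "continuously_converges (\<lambda>j. summand_exponent g a b (m' j)) s'"
    and ratio: "(\<lambda>j. real (m' j) / real (m j)) \<longlonglongrightarrow> l" and l: "l > 0"
  obtains \<kappa> d where "\<kappa> > 0" "\<And>t. s' t = of_real l * s (\<kappa> * t) + \<i> * of_real (d * t)"
proof -
  have "a (m j) / a (m' j) > 0" for j
    using a by simp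
  then obtain r k where r: "strict_mono r" and k: "0 \<le> k"
    "(\<lambda>j. a (m (r j)) / a (m' (r j))) \<longlonglongrightarrow> k \<or> (\<lambda>j. 1 / (a (m (r j)) / a (m' (r j)))) \<longlonglongrightarrow> k"
    by (rule positive_sequence_subseq)
  have r': "filterlim r at_top sequentially"
    using r by (rule filterlim_subseq)
  note seq = filterlim_compose[OF m r'] filterlim_compose[OF m' r']
  note convs = continuously_converges_subseq[OF conv r] continuously_converges_subseq[OF conv' r]
  have ratio_r: "(\<lambda>j. real (m' (r j)) / real (m (r j))) \<longlonglongrightarrow> l"
    using LIMSEQ_subseq_LIMSEQ[OF ratio r] by (simp add: o_def)
  from k(2) show ?thesis
  proof
    assume "(\<lambda>j. a (m (r j)) / a (m' (r j))) \<longlonglongrightarrow> k"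
    then obtain d where d: "\<And>t. s' t = of_real l * s (k * t) + \<i> * of_real (d * t)"
      by (rule summand_exponent_types[OF a seq s(1) s'(1) convs ratio_r]) (rule that)
    have "k \<noteq> 0"
    proof
      assume "k = 0"
      then have "Re (s' t0') = 0"
        unfolding d using exponentD(1)[OF s(1)] by simp
      then show False using s'(2) by simp
    qed
    with k(1) d show ?thesis by (intro that[of k d]) auto
  next
    assume "(\<lambda>j. 1 / (a (m (r j)) / a (m' (r j)))) \<longlonglongrightarrow> k"
    then have kap: "(\<lambda>j. a (m' (r j)) / a (m (r j))) \<longlonglongrightarrow> k"
      by simp
    have "(\<lambda>j. 1 / (real (m' (r j)) / real (m (r j)))) \<longlonglongrightarrow> 1 / l"
      using l by (intro tendsto_intros ratio_r) auto
    then have "(\<lambda>j. real (m (r j)) / real (m' (r j))) \<longlonglongrightarrow> 1 / l"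
      by simp
    then obtain d where d: "\<And>t. s t = of_real (1 / l) * s' (k * t) + \<i> * of_real (d * t)"
      by (rule summand_exponent_types[OF a seq(2,1) s'(1) s(1) convs(2,1) _ kap]) (rule that)
    have k0: "k \<noteq> 0"
    proof
      assume "k = 0"
      then have "Re (s t0) = 0"
        unfolding d using exponentD(1)[OF s'(1)] by simp
      then show False using s(2) by simp
    qed
    have "s' t = of_real l * s (1 / k * t) + \<i> * of_real (- (l * d / k) * t)" for t
      unfolding d[of "1 / k * t"] using k0 l by (simp add: algebra_simps)
    moreover have "1 / k > 0"
      using k0 k(1) by simp
    ultimately show ?thesis
      using that by blast
  qed
qed

section \<open>Powers of normed characteristic functions\<close>

lemma exp_remainder:
  obtains q :: "complex \<Rightarrow> complex" where "\<And>w. exp w - 1 - w = w * q w" "(q \<longlongrightarrow> 0) (nhds 0)"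
proof -
  define q :: "complex \<Rightarrow> complex" where "q w = (if w = 0 then 0 else (exp w - 1) / w - 1)" for w
  have "((\<lambda>w :: complex. (exp (0 + w) - exp 0) / w) \<longlongrightarrow> exp 0) (at 0)"
    using DERIV_exp[of "0 :: complex"] by (simp only: DERIV_def)
  then have lim: "((\<lambda>w :: complex. (exp w - 1) / w - 1) \<longlongrightarrow> 1 - 1) (at 0)"
    by (intro tendsto_intros) simp
  have "\<forall>\<^sub>F w in at 0. (exp w - 1) / w - 1 = q w"
    by (auto simp: eventually_at_filter q_def)
  from Lim_transform_eventually[OF lim this] have "(q \<longlongrightarrow> 0) (at 0)"
    by simp
  then have "(q \<longlongrightarrow> 0) (nhds 0)"
    using tendsto_at_iff_tendsto_nhds[of q 0] by (simp add: q_def)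
  moreover have "exp w - 1 - w = w * q w" for w
    by (simp add: q_def field_simps)
  ultimately show ?thesis using that by blast
qed

text \<open>The error of replacing \<open>1 - w\<close> by \<open>exp (- w)\<close> is of smaller
  order than \<open>w\<close>. This serves both directions of the equivalence: powers of normed
  characteristic functions, and the logarithm of a stable law.\<close>

lemma scaled_one_minus_exp_tendsto:
  fixes z :: "nat \<Rightarrow> complex" and m :: "nat \<Rightarrow> nat"
  assumes z: "z \<longlonglongrightarrow> z0" and m: "filterlim m at_top sequentially"
  shows "(\<lambda>j. of_nat (m j) * (1 - z j / of_nat (m j) - exp (- z j / of_nat (m j)))) \<longlonglongrightarrow> 0"
proof -
  obtain q :: "complex \<Rightarrow> complex" where q: "\<And>w. exp w - 1 - w = w * q w" "(q \<longlongrightarrow> 0) (nhds 0)"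
    by (rule exp_remainder) (rule that)
  have "(\<lambda>j. 1 / complex_of_nat (m j)) \<longlonglongrightarrow> 0"
    by (rule filterlim_compose[OF lim_1_over_n m])
  from tendsto_mult[OF tendsto_minus[OF z] this]
  have "(\<lambda>j. - z j / of_nat (m j)) \<longlonglongrightarrow> 0" by simp
  then have "(\<lambda>j. q (- z j / of_nat (m j))) \<longlonglongrightarrow> 0"
    by (rule filterlim_compose[OF q(2)])
  from tendsto_mult[OF z this] have lim: "(\<lambda>j. z j * q (- z j / of_nat (m j))) \<longlonglongrightarrow> 0"
    by simp
  have "\<forall>\<^sub>F j in sequentially. 0 < m j"
    by (rule eventually_compose_filterlim[OF eventually_gt_at_top m])
  then have "\<forall>\<^sub>F j in sequentially. z j * q (- z j / of_nat (m j))
      = of_nat (m j) * (1 - z j / of_nat (m j) - exp (- z j / of_nat (m j)))"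
  proof eventually_elim
    case (elim j)
    have "1 - z j / of_nat (m j) - exp (- z j / of_nat (m j))
        = - (exp (- z j / of_nat (m j)) - 1 - - z j / of_nat (m j))"
      by simp
    also have "\<dots> = z j / of_nat (m j) * q (- z j / of_nat (m j))"
      unfolding q(1) by simp
    finally show ?case
      using elim by simp
  qed
  then show ?thesis
    by (rule Lim_transform_eventually[OF lim])
qed

text \<open>The powers \<open>(1 - S / m) ^ m\<close> belong to sums with a fixed number of terms
  and tend to \<open>exp (- s)\<close>: in the unit disc, \<open>m\<close>-th powers differ by at
  most \<open>m\<close> times the difference.\<close>

lemma char_function_exp_exponent:
  assumes g: "char_function g" and s: "exponent s"
    and m: "filterlim m at_top sequentially"
    and conv: "\<And>t. (\<lambda>j. summand_exponent g a b (m j) t) \<longlonglongrightarrow> s t"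
  shows "char_function (\<lambda>t. exp (- s t))"
proof (rule char_function_limit)
  define G where "G j t = g (t / a (m j)) * iexp (- (t * b (m j)))" for j t
  define S where "S j = summand_exponent g a b (m j)" for j
  show "char_function (\<lambda>t. G j t ^ m j)" for j
    unfolding G_def by (intro char_function_power char_function_normed g)
  show "isCont (\<lambda>t. exp (- s t)) 0"
    by (intro continuous_intros exponentD[OF s])
  fix t
  have m_pos: "\<forall>\<^sub>F j in sequentially. 0 < m j"
    by (rule eventually_compose_filterlim[OF eventually_gt_at_top m])
  have "(\<lambda>j. G j t ^ m j - exp (- S j t)) \<longlonglongrightarrow> 0"
  proof (rule Lim_null_comparison)
    show "(\<lambda>j. cmod (of_nat (m j) * (1 - S j t / of_nat (m j) - exp (- S j t / of_nat (m j))))) \<longlonglongrightarrow> 0"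
      using tendsto_norm[OF scaled_one_minus_exp_tendsto[OF conv m, of t]] by (simp add: S_def)
    show "\<forall>\<^sub>F j in sequentially. norm (G j t ^ m j - exp (- S j t))
        \<le> cmod (of_nat (m j) * (1 - S j t / of_nat (m j) - exp (- S j t / of_nat (m j))))"
      using m_pos
    proof eventually_elim
      case (elim j)
      have G: "1 - S j t / of_nat (m j) = G j t"
        using elim by (simp add: S_def G_def summand_exponent_def)
      have "exp (- S j t) = exp (- S j t / of_nat (m j)) ^ m j"
        using elim by (simp add: exp_of_nat_mult[symmetric])
      moreover have "cmod (G j t) \<le> 1"
        unfolding G_def by (rule char_function_basic(2)[OF char_function_normed[OF g]])
      moreover have "cmod (exp (- S j t / of_nat (m j))) \<le> 1"
        using exponentD(3)[OF exponent_summand[OF g], of a b "m j" t] by (simp add: S_def Re_divide_of_nat)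
      ultimately have "cmod (G j t ^ m j - exp (- S j t)) \<le> real (m j) * cmod (G j t - exp (- S j t / of_nat (m j)))"
        using norm_power_diff by metis
      then show ?case
        unfolding G by (simp add: norm_mult)
    qed
  qed
  moreover have "(\<lambda>j. exp (- S j t)) \<longlonglongrightarrow> exp (- s t)"
    unfolding S_def by (intro tendsto_intros conv)
  ultimately have "(\<lambda>j. (G j t ^ m j - exp (- S j t)) + exp (- S j t)) \<longlonglongrightarrow> 0 + exp (- s t)"
    by (rule tendsto_add)
  then show "(\<lambda>j. G j t ^ m j) \<longlonglongrightarrow> exp (- s t)" by simp
qed

lemma floor_multiple_ratio:
  fixes r :: "nat \<Rightarrow> nat" and l :: real
  assumes r: "filterlim r at_top sequentially" and l: "l > 0"
  shows "filterlim (\<lambda>j. nat \<lfloor>l * real (r j)\<rfloor>) at_top sequentially"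
    and "(\<lambda>j. real (nat \<lfloor>l * real (r j)\<rfloor>) / real (r j)) \<longlonglongrightarrow> l"
proof -
  have "filterlim (\<lambda>j. l * real (r j)) at_top sequentially"
    using l by (intro filterlim_tendsto_pos_mult_at_top[OF tendsto_const]
        filterlim_compose[OF filterlim_real_sequentially r])
  then show "filterlim (\<lambda>j. nat \<lfloor>l * real (r j)\<rfloor>) at_top sequentially"
    by (intro filterlim_compose[OF filterlim_nat_sequentially] filterlim_compose[OF filterlim_floor_sequentially])
  have eq: "real (nat \<lfloor>l * real n\<rfloor>) = of_int \<lfloor>l * real n\<rfloor>" for n
    using l by simp
  show "(\<lambda>j. real (nat \<lfloor>l * real (r j)\<rfloor>) / real (r j)) \<longlonglongrightarrow> l"
  proof (rule filterlim_compose[OF _ r])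
    show "(\<lambda>n. real (nat \<lfloor>l * real n\<rfloor>) / real n) \<longlonglongrightarrow> l"
    proof (rule tendsto_sandwich)
      have "(\<lambda>n. l - 1 / real n) \<longlonglongrightarrow> l - 0"
        by (intro tendsto_intros lim_1_over_n)
      then show "(\<lambda>n. l - 1 / real n) \<longlonglongrightarrow> l" by simp
      show "\<forall>\<^sub>F n in sequentially. l - 1 / real n \<le> real (nat \<lfloor>l * real n\<rfloor>) / real n"
        using eventually_gt_at_top[of 0]
      proof eventually_elim
        case (elim n)
        have "l - 1 / real n = (l * real n - 1) / real n"
          using elim by (simp add: diff_divide_distrib)
        also have "\<dots> \<le> of_int \<lfloor>l * real n\<rfloor> / real n"
          by (intro divide_right_mono) linarith+
        finally show ?case unfolding eq .
      qed
      show "\<forall>\<^sub>F n in sequentially. real (nat \<lfloor>l * real n\<rfloor>) / real n \<le> l"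
        using eventually_gt_at_top[of 0]
      proof eventually_elim
        case (elim n)
        have "of_int \<lfloor>l * real n\<rfloor> \<le> l * real n" by linarith
        then show ?case
          using elim unfolding eq by (simp add: field_simps)
      qed
    qed simp
  qed
qed

section \<open>Solutions obtained by changing the number of summands\<close>

context nontrivial_mixing
begin

context
  fixes f g :: "real \<Rightarrow> complex" and a b :: "nat \<Rightarrow> real"
  assumes f: "char_function f" and g: "char_function g" and a: "\<And>n. a n > 0"
    and lim: "\<And>t. (\<lambda>n. \<Phi> (summand_exponent g a b n t)) \<longlonglongrightarrow> f t"
    and nondegenerate: "\<And>s. exponent s \<Longrightarrow> (\<And>t. \<Phi> (s t) = f t) \<Longrightarrow> \<exists>t. Re (s t) \<noteq> 0"
begin

lemma summand_exponent_limit: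
  fixes m :: "nat \<Rightarrow> nat"
  assumes m: "filterlim m at_top sequentially"
  obtains r l where "strict_mono r" "exponent l"
    "continuously_converges (\<lambda>n. summand_exponent g a b (m (r n))) l" "\<And>t. \<Phi> (l t) = f t"
  by (rule exponent_limit_of_laplace[of "\<lambda>n. summand_exponent g a b (m n)" f])
     (auto intro: exponent_summand g filterlim_compose[OF lim m] char_function_basic[OF f] that)

lemma rescaled_limit:
  assumes r: "strict_mono (r :: nat \<Rightarrow> nat)" and s: "exponent s" "\<And>t. \<Phi> (s t) = f t"
    and conv: "continuously_converges (\<lambda>n. summand_exponent g a b (r n)) s"
    and l: "l > 0"
  shows "\<exists>\<kappa> d. \<kappa> > 0 \<and> (\<forall>t. \<Phi> (of_real l * s (\<kappa> * t) + \<i> * of_real (d * t)) = f t)"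
proof -
  define m where "m j = nat \<lfloor>l * real (r j)\<rfloor>" for j
  have r': "filterlim r at_top sequentially"
    using r by (rule filterlim_subseq)
  have m: "filterlim m at_top sequentially" and ratio: "(\<lambda>j. real (m j) / real (r j)) \<longlonglongrightarrow> l"
    unfolding m_def using floor_multiple_ratio[OF r' l] by auto
  obtain q s' where q: "strict_mono q" and s': "exponent s'"
    and conv': "continuously_converges (\<lambda>n. summand_exponent g a b (m (q n))) s'"
    and s'f: "\<And>t. \<Phi> (s' t) = f t"
    by (rule summand_exponent_limit[OF m]) (rule that)
  have q': "filterlim q at_top sequentially"
    using q by (rule filterlim_subseq)
  obtain t0 where t0: "Re (s t0) \<noteq> 0"
    using nondegenerate[OF s] by blast
  obtain t0' where t0': "Re (s' t0') \<noteq> 0"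
    using nondegenerate[OF s' s'f] by blast
  have ratio': "(\<lambda>j. real (m (q j)) / real (r (q j))) \<longlonglongrightarrow> l"
    using LIMSEQ_subseq_LIMSEQ[OF ratio q] by (simp add: o_def)
  obtain \<kappa> d where "\<kappa> > 0" "\<And>t. s' t = of_real l * s (\<kappa> * t) + \<i> * of_real (d * t)"
    by (rule summand_exponent_types_nondegenerate[OF a filterlim_compose[OF r' q'] filterlim_compose[OF m q']
          s(1) t0 s' t0' continuously_converges_subseq[OF conv q] conv' ratio' l]) (rule that)
  then show ?thesis
    using s'f by metis
qed

text \<open>All exponents \<open>c k * s (\<kappa> k * t) + \<i> d k t\<close> with \<open>c k = 1 + 1 / (k + 1)\<close> solve \<open>\<Phi> \<circ> s = f\<close>; by compactness
  they accumulate, and an accumulation point is again of the form \<open>s (K t) + \<i> D t\<close>.\<close>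
lemma accumulating_rescalings:
  obtains \<sigma> c \<kappa> d where "exponent \<sigma>" "\<And>t. \<Phi> (\<sigma> t) = f t" "char_function (\<lambda>t. exp (- \<sigma> t))"
    "c \<longlonglongrightarrow> 1" "\<And>n. c n > 0" "\<And>n. c n \<noteq> 1" "\<kappa> \<longlonglongrightarrow> 1" "\<And>n. \<kappa> n > 0" "d \<longlonglongrightarrow> 0"
    "\<And>n t. \<Phi> (of_real (c n) * \<sigma> (\<kappa> n * t) + \<i> * of_real (d n * t)) = f t"
proof -
  obtain r s where r: "strict_mono r" and s: "exponent s"
    and conv: "continuously_converges (\<lambda>n. summand_exponent g a b (r n)) s"
    and sf: "\<And>t. \<Phi> (s t) = f t"
    by (rule summand_exponent_limit[OF filterlim_ident]) (rule that)
  \<comment> \<open>Any sequence of positive numbers with limit 1 that avoids 1 would do.\<close>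
  define C where "C k = 1 + 1 / real (Suc k)" for k
  have C: "C k > 0" "C k \<noteq> 1" for k
    by (simp_all add: C_def add_pos_pos)
  have C_lim: "C \<longlonglongrightarrow> 1"
    unfolding C_def using tendsto_add[OF tendsto_const[of 1] LIMSEQ_inverse_real_of_nat] by (simp add: inverse_eq_divide)
  have "\<exists>\<kappa> d. \<kappa> > 0 \<and> (\<forall>t. \<Phi> (of_real (C k) * s (\<kappa> * t) + \<i> * of_real (d * t)) = f t)" for k
    by (rule rescaled_limit[OF r s sf conv C(1)])
  then obtain K0 D0 where K0: "\<And>k. K0 k > 0"
    and KD0: "\<And>k t. \<Phi> (of_real (C k) * s (K0 k * t) + \<i> * of_real (D0 k * t)) = f t"
    by metis
  define S where "S k t = of_real (C k) * s (K0 k * t) + \<i> * of_real (D0 k * t)" for k t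
  have S: "exponent (S k)" for k
    unfolding S_def using C(1)[of k] by (intro exponent_rescale s) simp
  have Sf: "(\<lambda>k. \<Phi> (S k t)) \<longlonglongrightarrow> f t" for t
    unfolding S_def KD0 by (rule tendsto_const)
  obtain r3 \<sigma> where r3: "strict_mono r3" and sig: "exponent \<sigma>"
    and conv3: "continuously_converges (\<lambda>n. S (r3 n)) \<sigma>" and sigf: "\<And>t. \<Phi> (\<sigma> t) = f t"
    by (rule exponent_limit_of_laplace[OF S Sf char_function_basic(3)[OF f] char_function_basic(1)[OF f]]) (rule that)
  obtain t0 where t0: "Re (s t0) \<noteq> 0"
    using nondegenerate[OF s sf] by blast
  obtain t1 where t1: "Re (\<sigma> t1) \<noteq> 0"
    using nondegenerate[OF sig sigf] by blast
  obtain r4 k where r4: "strict_mono r4" and k: "0 \<le> k"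
    "(\<lambda>n. K0 (r3 (r4 n))) \<longlonglongrightarrow> k \<or> (\<lambda>n. 1 / K0 (r3 (r4 n))) \<longlonglongrightarrow> k"
    by (rule positive_sequence_subseq[of "\<lambda>n. K0 (r3 n)"]) (use K0 in auto)
  define p where "p n = r3 (r4 n)" for n
  have p: "strict_mono p"
    unfolding p_def using strict_mono_o[OF r3 r4] by (simp add: o_def)
  have conv4: "continuously_converges (\<lambda>n. S (p n)) \<sigma>"
    unfolding p_def by (rule continuously_converges_subseq[OF conv3 r4])
  have Cp: "(\<lambda>n. C (p n)) \<longlonglongrightarrow> 1"
    using LIMSEQ_subseq_LIMSEQ[OF C_lim p] by (simp add: o_def)
  \<comment> \<open>If the scales tended to 0, \<open>Re \<sigma>\<close> would vanish at
    \<open>t1\<close>; if they tended to infinity, the points \<open>t0 / K0 (p n)\<close> would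
    tend to 0 and \<open>Re (s t0)\<close> would equal \<open>Re (\<sigma> 0) = 0\<close>.\<close>
  have "\<exists>K>0. (\<lambda>n. K0 (p n)) \<longlonglongrightarrow> K"
    using k(2)
  proof
    assume K: "(\<lambda>n. K0 (r3 (r4 n))) \<longlonglongrightarrow> k"
    have "k \<noteq> 0"
    proof
      assume "k = 0"
      have "(\<lambda>n. K0 (p n) * t1) \<longlonglongrightarrow> k * t1"
        unfolding p_def by (intro tendsto_intros K)
      then have "(\<lambda>n. s (K0 (p n) * t1)) \<longlonglongrightarrow> s (k * t1)"
        by (intro isCont_tendsto_compose[OF exponentD(2)[OF s]])
      then have "(\<lambda>n. C (p n) * Re (s (K0 (p n) * t1))) \<longlonglongrightarrow> 1 * Re (s (k * t1))"
        by (intro tendsto_intros Cp)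
      moreover have "(\<lambda>n. Re (S (p n) t1)) \<longlonglongrightarrow> Re (\<sigma> t1)"
        by (intro tendsto_intros continuously_convergesD(2)[OF conv4])
      ultimately have "Re (\<sigma> t1) = Re (s (k * t1))"
        using LIMSEQ_unique by (fastforce simp: S_def)
      then show False
        using t1 \<open>k = 0\<close> exponentD(1)[OF s] by simp
    qed
    with k(1) K show ?thesis
      unfolding p_def by (intro exI[of _ k]) simp
  next
    assume K: "(\<lambda>n. 1 / K0 (r3 (r4 n))) \<longlonglongrightarrow> k"
    have "k \<noteq> 0"
    proof
      assume "k = 0"
      have "(\<lambda>n. 1 / K0 (p n) * t0) \<longlonglongrightarrow> k * t0"
        unfolding p_def by (intro tendsto_intros K)
      from continuously_convergesD(1)[OF conv4 this]
      have "(\<lambda>n. Re (S (p n) (1 / K0 (p n) * t0)) / C (p n)) \<longlonglongrightarrow> Re (\<sigma> (k * t0)) / 1"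
        by (intro tendsto_intros Cp) auto
      moreover have "Re (S (p n) (1 / K0 (p n) * t0)) / C (p n) = Re (s t0)" for n
        using K0[of "p n"] C(1)[of "p n"] by (simp add: S_def)
      ultimately have "Re (s t0) = Re (\<sigma> (k * t0))"
        by (simp add: LIMSEQ_const_iff)
      then show False
        using t0 \<open>k = 0\<close> exponentD(1)[OF sig] by simp
    qed
    moreover have "(\<lambda>n. 1 / (1 / K0 (p n))) \<longlonglongrightarrow> 1 / k"
      unfolding p_def using \<open>k \<noteq> 0\<close> by (intro tendsto_intros K)
    ultimately show ?thesis
      using k(1) by (intro exI[of _ "1 / k"]) simp
  qed
  then obtain K where K: "K > 0" "(\<lambda>n. K0 (p n)) \<longlonglongrightarrow> K" by blast
  define D where "D = Im (\<sigma> 1 - s K)"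
  have s_lim: "(\<lambda>n. s (K0 (p n) * t)) \<longlonglongrightarrow> s (K * t)" for t
    by (intro isCont_tendsto_compose[OF exponentD(2)[OF s]] tendsto_intros K)
  have D0_lim: "(\<lambda>n. D0 (p n)) \<longlonglongrightarrow> D"
  proof -
    have "(\<lambda>n. Im (S (p n) 1 - of_real (C (p n)) * s (K0 (p n) * 1))) \<longlonglongrightarrow> Im (\<sigma> 1 - of_real 1 * s (K * 1))"
      by (intro tendsto_intros Cp s_lim continuously_convergesD(2)[OF conv4])
    then show ?thesis
      by (simp add: S_def D_def)
  qed
  have sig_eq: "\<sigma> t = s (K * t) + \<i> * of_real (D * t)" for t
  proof (rule LIMSEQ_unique[OF continuously_convergesD(2)[OF conv4]])
    have "(\<lambda>n. of_real (C (p n)) * s (K0 (p n) * t) + \<i> * of_real (D0 (p n) * t))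
        \<longlonglongrightarrow> of_real 1 * s (K * t) + \<i> * of_real (D * t)"
      by (intro tendsto_intros Cp s_lim D0_lim)
    then show "(\<lambda>n. S (p n) t) \<longlonglongrightarrow> s (K * t) + \<i> * of_real (D * t)"
      by (simp add: S_def)
  qed
  \<comment> \<open>The rescalings \<open>S (p n)\<close> of \<open>s\<close> are rewritten in terms
    of their limit \<open>\<sigma>\<close>: its scale \<open>K\<close> and drift \<open>D\<close>
    are taken out, so that what remains tends to the identity.\<close>
  define c where "c n = C (p n)" for n
  define \<kappa> where "\<kappa> n = K0 (p n) / K" for n
  define d where "d n = D0 (p n) - c n * \<kappa> n * D" for n
  have kap: "\<kappa> \<longlonglongrightarrow> 1"
    using tendsto_divide[OF K(2) tendsto_const, of K] K(1) by (simp add: \<kappa>_def[abs_def])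
  show ?thesis
  proof (rule that[of \<sigma> c \<kappa> d])
    have "char_function (\<lambda>t. exp (- s (K * t)) * iexp (t * - D))"
      using r conv
      by (intro char_function_affine[of "\<lambda>t. exp (- s t)" K "- D"] char_function_exp_exponent[OF g s, of r a b])
         (auto intro: filterlim_subseq continuously_convergesD(2))
    moreover have "exp (- \<sigma> t) = exp (- s (K * t)) * iexp (t * - D)" for t
      by (simp add: sig_eq exp_add[symmetric] algebra_simps)
    ultimately show "char_function (\<lambda>t. exp (- \<sigma> t))" by simp
    show "c \<longlonglongrightarrow> 1" using Cp by (simp add: c_def[abs_def])
    have "(\<lambda>n. D0 (p n) - c n * \<kappa> n * D) \<longlonglongrightarrow> D - 1 * 1 * D"
      using Cp by (intro tendsto_intros D0_lim kap) (simp add: c_def)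
    then show "d \<longlonglongrightarrow> 0" by (simp add: d_def[abs_def])
    show "\<Phi> (of_real (c n) * \<sigma> (\<kappa> n * t) + \<i> * of_real (d n * t)) = f t" for n t
    proof -
      have Kt: "K * (\<kappa> n * t) = K0 (p n) * t"
        using K(1) by (simp add: \<kappa>_def)
      have "of_real (c n) * \<sigma> (\<kappa> n * t) + \<i> * of_real (d n * t) = S (p n) t"
        unfolding sig_eq Kt S_def by (simp add: c_def d_def algebra_simps)
      then show ?thesis
        using KD0[of "p n" t] by (simp add: S_def)
    qed
  qed (use sig sigf C K0 K(1) kap in \<open>auto simp: c_def \<kappa>_def\<close>)
qed

end

end

section \<open>Stable laws\<close>

text \<open>The scale \<open>c\<close> solves
  \<open>c powr \<alpha> = p powr \<alpha> + q powr \<alpha>\<close>. The linear term of the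
  imaginary part, or \<open>t * ln t\<close> if \<open>\<alpha> = 1\<close>, then leaves only a
  multiple of \<open>t\<close>, which the shift absorbs.\<close>

lemma stable_law_of_power_exponent:
  assumes \<sigma>: "exponent \<sigma>" and M: "real_distribution M" "\<And>t. char M t = exp (- \<sigma> t)"
    and \<alpha>: "\<alpha> > 0"
    and Re: "\<And>t. t > 0 \<Longrightarrow> Re (\<sigma> t) = C * t powr \<alpha>"
    and Im: "\<And>t. t > 0 \<Longrightarrow> Im (\<sigma> t) = A * t powr \<alpha> + B * t * (if \<alpha> = 1 then ln t else 1)"
  shows "stable_law M"
  unfolding stable_law_iff
proof (intro conjI allI impI M(1))
  fix p q :: real
  assume p: "p > 0" and q: "q > 0"
  define c where "c = (p powr \<alpha> + q powr \<alpha>) powr (1 / \<alpha>)"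
  have "p powr \<alpha> + q powr \<alpha> > 0"
    using p q by (intro add_pos_pos) auto
  then have c: "c > 0" and c_powr: "c powr \<alpha> = p powr \<alpha> + q powr \<alpha>"
    using \<alpha> by (auto simp: c_def powr_powr)
  define d where "d = B * (if \<alpha> = 1 then p * ln p + q * ln q - c * ln c else p + q - c)"
  have pos: "\<sigma> (p * t) + \<sigma> (q * t) = \<sigma> (c * t) + \<i> * of_real (d * t)" if t: "t > 0" for t
  proof (rule complex_eqI)
    show "Re (\<sigma> (p * t) + \<sigma> (q * t)) = Re (\<sigma> (c * t) + \<i> * of_real (d * t))"
      using p q c t by (simp add: Re powr_mult c_powr algebra_simps)
    show "Im (\<sigma> (p * t) + \<sigma> (q * t)) = Im (\<sigma> (c * t) + \<i> * of_real (d * t))"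
    proof (cases "\<alpha> = 1")
      case True
      then have cpq: "c = p + q" using p q c c_powr by simp
      have ln: "ln (p * t) = ln p + ln t" "ln (q * t) = ln q + ln t" "ln (c * t) = ln c + ln t"
        using p q c t by (simp_all add: ln_mult)
      have "Im (\<sigma> (p * t) + \<sigma> (q * t)) = A * ((p + q) * t) + B * (p * t * ln (p * t) + q * t * ln (q * t))"
        using True p q t by (simp add: Im algebra_simps)
      also have "\<dots> = A * (c * t) + B * (c * t * ln (c * t)) + d * t"
        unfolding ln using True by (simp add: d_def cpq algebra_simps)
      also have "\<dots> = Im (\<sigma> (c * t) + \<i> * of_real (d * t))"
        using True c t by (simp add: Im algebra_simps)
      finally show ?thesis .
    next
      case False
      then show ?thesis
        using p q c t by (simp add: Im powr_mult c_powr d_def algebra_simps)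
    qed
  qed
  have all: "\<sigma> (p * t) + \<sigma> (q * t) = \<sigma> (c * t) + \<i> * of_real (d * t)" for t
  proof (cases t "0 :: real" rule: linorder_cases)
    case less
    then have "cnj (\<sigma> (p * - t) + \<sigma> (q * - t)) = cnj (\<sigma> (c * - t) + \<i> * of_real (d * - t))"
      by (subst pos) auto
    then show ?thesis
      using exponentD(4)[OF \<sigma>, of "p * t"] exponentD(4)[OF \<sigma>, of "q * t"] exponentD(4)[OF \<sigma>, of "c * t"]
      by simp
  qed (use pos exponentD(1)[OF \<sigma>] in auto)
  have "char M (p * t) * char M (q * t) = iexp (t * - d) * char M (c * t)" for t
  proof -
    have "char M (p * t) * char M (q * t) = exp (- (\<sigma> (p * t) + \<sigma> (q * t)))"
      by (simp add: M(2) exp_add[symmetric])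
    also have "\<dots> = iexp (t * - d) * char M (c * t)"
      unfolding all M(2) by (simp add: exp_add[symmetric] algebra_simps)
    finally show ?thesis .
  qed
  with c show "\<exists>c>0. \<exists>d. \<forall>t. char M (p * t) * char M (q * t) = iexp (t * d) * char M (c * t)"
    by blast
qed

lemma stable_law_of_linear_exponent:
  assumes M: "real_distribution M" "\<And>t. char M t = iexp (t * d)"
  shows "stable_law M"
  unfolding stable_law_iff
proof (intro conjI allI impI M(1))
  fix p q :: real
  assume "p > 0" "q > 0"
  moreover have "char M (p * t) * char M (q * t) = iexp (t * 0) * char M ((p + q) * t)" for t
    by (simp add: M(2) exp_add[symmetric] algebra_simps)
  ultimately show "\<exists>c>0. \<exists>d. \<forall>t. char M (p * t) * char M (q * t) = iexp (t * d) * char M (c * t)"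
    by (intro exI[of _ "p + q"] exI[of _ 0] conjI allI) (simp, blast)
qed

lemma phi_stable_of_exponent:
  assumes "exponent s" "stable_law M" "\<And>t. char M t = exp (- s t)" "\<And>t. f t = \<phi> (s t)"
  shows "phi_stable \<phi> f"
  unfolding phi_stable_def continuous_log_def
  using assms(2-4) exponentD(1)[OF assms(1)] exponent_continuous_on[OF assms(1), of UNIV]
  by (intro exI[of _ M] exI[of _ "\<lambda>t. - s t"]) (auto intro!: continuous_intros)

context nontrivial_mixing
begin

text \<open>The cases are split by purely imaginary solutions because \<open>curve_form\<close>
  starts from a point in the open half-plane.\<close>

lemma stable_exponent_if_limit:
  assumes f: "char_function f" and g: "char_function g" and a: "\<And>n. a n > 0"
    and lim: "\<And>t. (\<lambda>n. \<Phi> (summand_exponent g a b n t)) \<longlonglongrightarrow> f t"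
  shows "\<exists>M s. stable_law M \<and> exponent s \<and> (\<forall>t. char M t = exp (- s t)) \<and> (\<forall>t. \<Phi> (s t) = f t)"
proof (cases "\<exists>s. exponent s \<and> (\<forall>t. \<Phi> (s t) = f t) \<and> (\<forall>t. Re (s t) = 0)")
  case True
  then obtain s where s: "exponent s" "\<And>t. \<Phi> (s t) = f t" "\<And>t. Re (s t) = 0" by blast
  obtain M where M: "real_distribution M" "char M = (\<lambda>t. iexp (t * - Im (s 1)))"
    using char_function_iexp[of "- Im (s 1)"] unfolding char_function_def by metis
  have "char M t = exp (- s t)" for t
    unfolding M(2) exponent_Re_zero[OF s(1,3), of t] by simp
  moreover have "stable_law M"
    using M by (intro stable_law_of_linear_exponent[where d = "- Im (s 1)"]) auto
  ultimately show ?thesis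
    using s(1,2) by blast
next
  case False
  then have nondeg: "\<exists>t. Re (s t) \<noteq> 0" if "exponent s" "\<And>t. \<Phi> (s t) = f t" for s
    using that by blast
  obtain \<sigma> c \<kappa> d where \<sigma>: "exponent \<sigma>" and \<sigma>f: "\<And>t. \<Phi> (\<sigma> t) = f t"
    and cf: "char_function (\<lambda>t. exp (- \<sigma> t))"
    and c: "c \<longlonglongrightarrow> 1" "\<And>n. c n > 0" "\<And>n. c n \<noteq> 1" and \<kappa>: "\<kappa> \<longlonglongrightarrow> 1" "\<And>n. \<kappa> n > 0"
    and d: "d \<longlonglongrightarrow> 0"
    and inv: "\<And>n t. \<Phi> (of_real (c n) * \<sigma> (\<kappa> n * t) + \<i> * of_real (d n * t)) = f t"
    by (rule accumulating_rescalings[OF f g a lim nondeg]) (assumption | rule that)+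
  define z where "z x = \<sigma> (exp x)" for x
  have z_cont: "isCont z x" for x
    unfolding z_def by (rule isCont_o2[where g = \<sigma>]) (auto intro!: continuous_intros exponentD[OF \<sigma>])
  have z_Re: "0 \<le> Re (z x)" for x
    by (simp add: z_def exponentD[OF \<sigma>])
  have eps: "(\<lambda>n. ln (\<kappa> n)) \<longlonglongrightarrow> 0"
    using tendsto_ln[OF \<kappa>(1)] by simp
  have z_inv: "\<Phi> (of_real (c n) * z (x + ln (\<kappa> n)) + \<i> * of_real (d n * exp x)) = \<Phi> (z x)" for n x
    using inv[of n "exp x"] \<kappa>(2)[of n] by (simp add: z_def \<sigma>f exp_add mult.commute)
  obtain t0 where t0: "Re (\<sigma> t0) \<noteq> 0"
    using nondeg[OF \<sigma> \<sigma>f] by blast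
  have "t0 \<noteq> 0"
    using t0 exponentD(1)[OF \<sigma>] by auto
  moreover have "Re (\<sigma> \<bar>t0\<bar>) = Re (\<sigma> t0)"
    using exponentD(4)[OF \<sigma>, of t0] by (simp add: abs_if)
  ultimately have "Re (z (ln \<bar>t0\<bar>)) \<noteq> 0"
    using t0 by (simp add: z_def)
  then have "Re (z (ln \<bar>t0\<bar>)) > 0"
    using z_Re[of "ln \<bar>t0\<bar>"] by simp
  then obtain \<alpha> B K A where \<alpha>: "\<alpha> \<noteq> 0" and zRe: "\<And>x. Re (z x) = exp (K + \<alpha> * x)"
    and zIm: "\<And>x. Im (z x) = exp (\<alpha> * x) * (A + B * weight \<alpha> x)"
    by (rule curve_form[OF z_cont z_Re c eps d z_inv]) (assumption | rule that)+
  have Re: "Re (\<sigma> t) = exp K * t powr \<alpha>" if "t > 0" for t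
    using zRe[of "ln t"] that by (simp add: z_def exp_add powr_def)
  have Im: "Im (\<sigma> t) = A * t powr \<alpha> + B * t * (if \<alpha> = 1 then ln t else 1)" if "t > 0" for t
  proof -
    have "exp (\<alpha> * ln t) * exp ((1 - \<alpha>) * ln t) = t"
      using that by (simp add: exp_add[symmetric] algebra_simps)
    then show ?thesis
      using zIm[of "ln t"] that by (auto simp: z_def weight_def powr_def algebra_simps)
  qed
  \<comment> \<open>A negative power would keep \<open>Re \<sigma>\<close> above
    \<open>exp K\<close> on \<open>{0<..1}\<close>, against continuity and
    \<open>\<sigma> 0 = 0\<close>.\<close>
  have "\<alpha> > 0"
  proof (rule ccontr)
    assume "\<not> \<alpha> > 0"
    then have neg: "\<alpha> < 0" using \<alpha> by simp
    have "(\<lambda>n. Re (\<sigma> (1 / real (Suc n)))) \<longlonglongrightarrow> Re (\<sigma> 0)"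
      by (intro tendsto_Re isCont_tendsto_compose[OF exponentD(2)[OF \<sigma>]])
         (use LIMSEQ_inverse_real_of_nat in \<open>simp add: inverse_eq_divide\<close>)
    moreover have "exp K \<le> Re (\<sigma> (1 / real (Suc n)))" for n
    proof -
      have "ln (1 / real (Suc n)) \<le> 0"
        by (simp add: ln_div)
      then have "0 \<le> \<alpha> * ln (1 / real (Suc n))"
        using neg by (intro mult_nonpos_nonpos) auto
      then have "1 \<le> (1 / real (Suc n)) powr \<alpha>"
        by (simp add: powr_def)
      then show ?thesis
        using Re[of "1 / real (Suc n)"] by simp
    qed
    ultimately have "exp K \<le> Re (\<sigma> 0)"
      by (intro LIMSEQ_le_const) auto
    then show False
      using exponentD(1)[OF \<sigma>] by simp
  qed
  moreover obtain M where M: "real_distribution M" "(\<lambda>t. exp (- \<sigma> t)) = char M"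
    using cf unfolding char_function_def by blast
  moreover have "char M t = exp (- \<sigma> t)" for t
    using M(2) by (simp add: fun_eq_iff)
  ultimately have "stable_law M"
    using Re Im by (intro stable_law_of_power_exponent[OF \<sigma> M(1)]) auto
  with \<sigma> \<sigma>f \<open>\<And>t. char M t = exp (- \<sigma> t)\<close> show ?thesis by blast
qed

end

section \<open>Stable laws attract themselves\<close>

lemma stable_law_power:
  assumes "stable_law M"
  shows "\<exists>c>0. \<exists>d. \<forall>t. char M t ^ Suc n = char M (c * t) * iexp (t * d)"
proof (induction n)
  case 0
  show ?case by (intro exI[of _ 1] conjI exI[of _ 0]) auto
next
  case (Suc n)
  then obtain c d where c: "c > 0" and cd: "\<And>t. char M t ^ Suc n = char M (c * t) * iexp (t * d)"
    by blast
  obtain c' d' where c': "c' > 0" and cd': "\<And>t. char M (c * t) * char M (1 * t) = iexp (t * d') * char M (c' * t)"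
    using assms c unfolding stable_law_iff by (meson zero_less_one)
  have "char M t ^ Suc (Suc n) = char M (c' * t) * iexp (t * (d + d'))" for t
  proof -
    have "char M t ^ Suc (Suc n) = iexp (t * d) * (char M (c * t) * char M (1 * t))"
      by (simp only: power_Suc[of _ "Suc n"] cd mult_1 ac_simps)
    also have "\<dots> = char M (c' * t) * (iexp (t * d) * iexp (t * d'))"
      unfolding cd' by (simp only: ac_simps)
    also have "iexp (t * d) * iexp (t * d') = iexp (t * (d + d'))"
      by (simp add: exp_add[symmetric] algebra_simps)
    finally show ?thesis .
  qed
  with c' show ?case by blast
qed

text \<open>Powers of \<open>char M\<close> determine \<open>n * L\<close> only up to multiples of
  \<open>2 * pi * \<i>\<close>; uniqueness of the continuous logarithm settles the
  ambiguity.\<close>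

lemma stable_law_log_scaling:
  assumes M: "stable_law M" and L: "continuous_log (char M) L" and n: "n > 0"
  shows "\<exists>c>0. \<exists>b. \<forall>t. L (t / c) - \<i> * of_real (t * b) = L t / of_nat n"
proof -
  obtain k where k: "n = Suc k" using n by (cases n) auto
  obtain c d where c: "c > 0" and cd: "\<And>t. char M t ^ n = char M (c * t) * iexp (t * d)"
    using stable_law_power[OF M, of k] unfolding k by blast
  have L': "continuous_on UNIV L" "L 0 = 0" "\<And>t. exp (L t) = char M t"
    using L by (auto simp: continuous_log_def)
  have "continuous_log (\<lambda>t. char M t ^ n) (\<lambda>t. of_nat n * L t)"
    using L' by (auto simp: continuous_log_def exp_of_nat_mult intro!: continuous_intros)
  moreover have "continuous_on UNIV (\<lambda>t. L (c * t))"
    by (rule continuous_on_compose2[OF L'(1)]) (auto intro!: continuous_intros)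
  then have "continuous_log (\<lambda>t. char M t ^ n) (\<lambda>t. L (c * t) + \<i> * of_real (t * d))"
    using L' unfolding cd by (auto simp: continuous_log_def exp_add intro!: continuous_intros)
  ultimately have eq: "of_nat n * L t = L (c * t) + \<i> * of_real (t * d)" for t
    using continuous_log_unique by (metis (no_types, lifting))
  have "L (t / c) - \<i> * of_real (t * (d / (c * real n))) = L t / of_nat n" for t
  proof -
    have "of_nat n * L (t / c) = L t + \<i> * of_real (t / c * d)"
      using eq[of "t / c"] c by simp
    then have "L (t / c) = (L t + \<i> * of_real (t / c * d)) / of_nat n"
      using n by (simp add: field_simps)
    then show ?thesis
      by (simp add: add_divide_distrib field_simps)
  qed
  with c show ?thesis by blast
qed

text \<open>With norming constants from \<open>stable_law_log_scaling\<close> the normed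
  characteristic function is \<open>exp (L t / n)\<close>, and
  \<open>n * (1 - exp (L t / n))\<close> tends to \<open>- L t\<close>.\<close>

lemma (in mixing) stable_log_limit:
  assumes M: "stable_law M" and L: "continuous_log (char M) L"
  shows "\<exists>a b. (\<forall>n. a n > 0) \<and> (\<forall>t. (\<lambda>n. \<Phi> (summand_exponent (char M) a b n t)) \<longlonglongrightarrow> \<Phi> (- L t))"
proof -
  interpret M: real_distribution M
    using M by (simp add: stable_law_def)
  have L': "exp (L t) = char M t" for t
    using L by (auto simp: continuous_log_def)
  have Re_L: "Re (L t) \<le> 0" for t
    using M.cmod_char_le_1[of t] unfolding L'[symmetric] by simp
  \<comment> \<open>At \<open>n = 0\<close> only positivity of the scale is asked, and 1 is
    taken.\<close>
  have "\<exists>c b. c > 0 \<and> (n > 0 \<longrightarrow> (\<forall>t. L (t / c) - \<i> * of_real (t * b) = L t / of_nat n))" for n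
    using stable_law_log_scaling[OF M L, of n] by (cases "n = 0") (auto intro: exI[of _ 1])
  then obtain a b where a: "\<And>n. a n > (0 :: real)"
    and ab: "\<And>n t. n > 0 \<Longrightarrow> L (t / a n) - \<i> * of_real (t * b n) = L t / of_nat n"
    by metis
  have S: "summand_exponent (char M) a b n t = of_nat n * (1 - exp (L t / of_nat n))" if "n > 0" for n t
    unfolding ab[OF that, symmetric] by (simp add: summand_exponent_def L'[symmetric] exp_diff exp_minus divide_inverse)
  have "(\<lambda>n. summand_exponent (char M) a b n t) \<longlonglongrightarrow> - L t" for t
  proof -
    have "(\<lambda>n. of_nat n * (1 - - L t / of_nat n - exp (- (- L t) / of_nat n))) \<longlonglongrightarrow> 0"
      by (rule scaled_one_minus_exp_tendsto[OF tendsto_const filterlim_ident])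
    from tendsto_add[OF this tendsto_const[of "- L t"]]
    have lim: "(\<lambda>n. of_nat n * (1 - - L t / of_nat n - exp (- (- L t) / of_nat n)) + - L t) \<longlonglongrightarrow> - L t"
      by simp
    have "\<forall>\<^sub>F n in sequentially. of_nat n * (1 - - L t / of_nat n - exp (- (- L t) / of_nat n)) + - L t
        = summand_exponent (char M) a b n t"
      using eventually_gt_at_top[of 0] by eventually_elim (simp add: S algebra_simps)
    then show ?thesis
      by (rule Lim_transform_eventually[OF lim])
  qed
  moreover have "exponent (summand_exponent (char M) a b n)" for n
    using M.real_distribution_axioms by (intro exponent_summand) (auto simp: char_function_def)
  ultimately have "(\<lambda>n. \<Phi> (summand_exponent (char M) a b n t)) \<longlonglongrightarrow> \<Phi> (- L t)" for t
    using Re_L by (intro tendsto_laplace) (auto simp: exponentD)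
  with a show ?thesis by blast
qed

theorem theorem4p1:
  fixes \<nu> :: "real measure" and \<phi> :: "complex \<Rightarrow> complex" and f :: "real \<Rightarrow> complex"
  assumes "real_distribution \<nu>" and "AE u in \<nu>. 0 \<le> u"
    and "\<And>s. Re s \<ge> 0 \<Longrightarrow> \<phi> s = laplace_transform \<nu> s"
    and "char_function f"
  shows "attraction_domain \<phi> f \<noteq> {} \<longleftrightarrow> phi_stable \<phi> f"
proof -
  interpret mixing \<nu>
    using assms(1,2) by (simp add: mixing_def mixing_axioms_def)
  have eq: "\<phi> (summand_exponent g a b n t) = \<Phi> (summand_exponent g a b n t)" if "char_function g" for g a b n t
    using that by (intro assms(3) exponentD(3) exponent_summand)
  have domain: "attraction_domain \<phi> f \<noteq> {} \<longleftrightarrow> (\<exists>g a b. char_function g \<and> (\<forall>n. a n > 0) \<and>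
      (\<forall>t. (\<lambda>n. \<Phi> (summand_exponent g a b n t)) \<longlonglongrightarrow> f t))"
    unfolding attraction_domain_def summand_exponent_def[symmetric] using eq by auto
  show ?thesis
  proof
    assume "attraction_domain \<phi> f \<noteq> {}"
    then obtain g a b where g: "char_function g" and a: "\<And>n. a n > 0"
      and lim: "\<And>t. (\<lambda>n. \<Phi> (summand_exponent g a b n t)) \<longlonglongrightarrow> f t"
      unfolding domain by blast
    have "\<exists>M s. stable_law M \<and> exponent s \<and> (\<forall>t. char M t = exp (- s t)) \<and> (\<forall>t. \<Phi> (s t) = f t)"
    proof (cases "measure \<nu> {0} < 1")
      case True
      then interpret nontrivial_mixing \<nu>
        by unfold_locales
      show ?thesis
        by (rule stable_exponent_if_limit[OF assms(4) g a lim])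
    next
      \<comment> \<open>All mass lies at 0: the transform is 1 throughout, so \<open>f = 1\<close>,
        and the point mass at 0 with exponent 0 will do.\<close>
      case False
      then have "AE u in \<nu>. u \<in> {0}"
        using prob_le_1[of "{0}"] by (intro prob_eq_1[THEN iffD1]) auto
      then have "AE u in \<nu>. exp (- (s * complex_of_real u)) = 1" for s
        by eventually_elim simp
      then have "\<Phi> s = (CLINT u|\<nu>. 1)" for s
        unfolding laplace_transform_def by (intro integral_cong_AE) auto
      then have one: "\<Phi> s = 1" for s
        using prob_space by (simp del: space_eq_univ)
      then have "f t = 1" for t
        using lim[of t] by (simp add: LIMSEQ_const_iff)
      moreover obtain M where M: "real_distribution M" "char M = (\<lambda>t. iexp (t * 0))"
        using char_function_iexp[of 0] unfolding char_function_def by metis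
      then have "stable_law M"
        by (intro stable_law_of_linear_exponent[where d = 0]) auto
      moreover have "exponent (\<lambda>t. 0)"
        by (simp add: exponent_def)
      ultimately show ?thesis
        using one M(2) by (intro exI[of _ M] exI[of _ "\<lambda>t. 0"]) simp
    qed
    then obtain M s where "stable_law M" "exponent s" "\<And>t. char M t = exp (- s t)" "\<And>t. \<Phi> (s t) = f t"
      by blast
    then show "phi_stable \<phi> f"
      using assms(3) by (intro phi_stable_of_exponent[of s M]) (auto simp: exponentD)
  next
    assume "phi_stable \<phi> f"
    then obtain M L where M: "stable_law M" and L: "continuous_log (char M) L" and fL: "\<And>t. f t = \<phi> (- L t)"
      unfolding phi_stable_def by blast
    have cf: "char_function (char M)"
      using M by (auto simp: char_function_def stable_law_def)
    \<comment> \<open>\<open>\<phi>\<close> is tied to the transform only on the closed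
      half-plane.\<close>
    have "Re (- L t) \<ge> 0" for t
    proof -
      have "exp (Re (L t)) \<le> 1"
        using char_function_basic(2)[OF cf, of t] L by (metis continuous_log_def norm_exp_eq_Re)
      then show ?thesis by simp
    qed
    then have "f t = \<Phi> (- L t)" for t
      by (simp only: fL assms(3))
    then show "attraction_domain \<phi> f \<noteq> {}"
      unfolding domain using stable_log_limit[OF M L] cf by metis
  qed
qed

end
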